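(* Let $G$ be an open subset of $\mathbb R$. Let $A$ and $B$ be unital complex Banach algebras with continuous involutions, and let $\pi:G\to\mathcal B(A,B)$ be a real analytic map whose values are surjective unit-preserving ${}^*$-homomorphisms $A\to B$. Suppose that for each $\lambda\in G$ the spectrum (in $A$) of each element of $\operatorname{Ker}\pi(\lambda)$ is $\{0\}$. Let $b(\cdot):G\to S_p(B)\ (\subset B)$ be a real analytic map. Then there exists a real analytic map $a(\cdot):G\to S_p(A)\ (\subset A)$ such that $$\pi(\lambda)a(\lambda)=b(\lambda)\quad\text{for each }\lambda\in G.$$
   Context: All Banach algebras have a unit of norm $1$. Fix an integer $n\ge2$, distinct $\lambda_1,\dots,\lambda_n\in\mathbb R$, and let $p(\lambda)=\prod_{i=1}^n(\lambda-\lambda_i)$. For a unital complex Banach algebra $A$ with continuous involution ${}^*$ (conjugate-linear), $S_p(A)=\{a\in A\mid a=a^*,\ p(a)=0\}$. $\mathcal B(A,B)$ is the Banach space of all bounded linear operators $A\to B$. A map $f$ from an open subset $G$ of $\mathbb R$ to a Banach space is real analytic if for each $x_0\in G$ it has locally a power series expansion $f(x)=\sum_{i=0}^\infty a_i(x-x_0)^i$. A map into $S_p(A)$ is real analytic if it is so as a map into $A$. *)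

theory Defs
  imports "HOL-Analysis.Analysis" "HOL-Computational_Algebra.Polynomial"
begin

text \<open>
  The superclass \<^class>\<open>real_normed_algebra_1\<close> supplies submultiplicativity of the norm
  and \<^prop>\<open>norm 1 = 1\<close>.
\<close>

class complex_banach_algebra_1 = real_normed_algebra_1 + banach +
  fixes scaleC :: "complex \<Rightarrow> 'a \<Rightarrow> 'a"  (infixr \<open>*\<^sub>C\<close> 75)
  assumes scaleC_add_right: "z *\<^sub>C (x + y) = z *\<^sub>C x + z *\<^sub>C y"
    and scaleC_add_left: "(z + w) *\<^sub>C x = z *\<^sub>C x + w *\<^sub>C x"
    and scaleC_scaleC: "z *\<^sub>C (w *\<^sub>C x) = (z * w) *\<^sub>C x"
    and scaleR_scaleC: "r *\<^sub>R x = complex_of_real r *\<^sub>C x"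
    and mult_scaleC_left: "(z *\<^sub>C x) * y = z *\<^sub>C (x * y)"
    and mult_scaleC_right: "x * (z *\<^sub>C y) = z *\<^sub>C (x * y)"
    and norm_scaleC: "norm (z *\<^sub>C x) = cmod z * norm x"

definition continuous_involution :: "('a::complex_banach_algebra_1 \<Rightarrow> 'a) \<Rightarrow> bool" where
  "continuous_involution star \<longleftrightarrow>
     (\<forall>x y. star (x + y) = star x + star y) \<and>
     (\<forall>z x. star (z *\<^sub>C x) = cnj z *\<^sub>C star x) \<and>
     (\<forall>x y. star (x * y) = star y * star x) \<and>
     (\<forall>x. star (star x) = x) \<and>
     continuous_on UNIV star"

definition spectrum :: "'a::complex_banach_algebra_1 \<Rightarrow> complex set" where
  "spectrum x = {z. \<not> (\<exists>y. (x - z *\<^sub>C 1) * y = 1 \<and> y * (x - z *\<^sub>C 1) = 1)}"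

text \<open>
  The library's \<^const>\<open>poly\<close> only evaluates at elements of commutative rings.
\<close>

definition poly_at :: "real poly \<Rightarrow> 'a::real_algebra_1 \<Rightarrow> 'a" where
  "poly_at p x = (\<Sum>i\<le>degree p. coeff p i *\<^sub>R x ^ i)"

definition S_set ::
    "real poly \<Rightarrow> ('a::complex_banach_algebra_1 \<Rightarrow> 'a) \<Rightarrow> 'a set" where
  "S_set p star = {x. x = star x \<and> poly_at p x = 0}"

definition unital_star_hom ::
    "('a::complex_banach_algebra_1 \<Rightarrow> 'a) \<Rightarrow> ('b::complex_banach_algebra_1 \<Rightarrow> 'b)
      \<Rightarrow> ('a \<Rightarrow> 'b) \<Rightarrow> bool" where
  "unital_star_hom starA starB h \<longleftrightarrow>
     (\<forall>x y. h (x + y) = h x + h y) \<and>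
     (\<forall>z x. h (z *\<^sub>C x) = z *\<^sub>C h x) \<and>
     (\<forall>x y. h (x * y) = h x * h y) \<and>
     h 1 = 1 \<and>
     (\<forall>x. h (starA x) = starB (h x))"

text \<open>
  The set \<open>G\<close> is meant to be open, so that a neighbourhood of a point of \<open>G\<close> may be taken
  inside \<open>G\<close>.

  For operator-valued maps this is used with the type of bounded \<^emph>\<open>real\<close>-linear
  operators. The bounded complex-linear operators form a closed real subspace of that
  Banach space, with the same norm. The coefficients of a local expansion are limits of
  real linear combinations of values, hence are complex linear whenever all values are.
\<close>

definition real_analytic_on :: "(real \<Rightarrow> 'a::real_normed_vector) \<Rightarrow> real set \<Rightarrow> bool"
    (infixl \<open>real'_analytic'_on\<close> 50) where
  "f real_analytic_on G \<longleftrightarrow>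
     (\<forall>x0\<in>G. \<exists>c. \<forall>\<^sub>F x in nhds x0. (\<lambda>i. (x - x0) ^ i *\<^sub>R c i) sums f x)"

end

theory Submission
  imports Defs "HOL-Computational_Algebra.Formal_Power_Series"
begin

text \<open>
  The map \<open>b\<close> is first lifted to some real analytic map \<open>a0\<close> with \<open>\<pi> a0 = b\<close>, and then \<open>a0\<close> is
  corrected by an element of the kernel so that it becomes self-adjoint and annihilated by \<open>p\<close>.

  The linear lifting \<open>analytic_lift\<close> is the main difficulty. Near a point it is easy: the open mapping
  theorem allows the coefficients of a power series to be lifted one after the other. But the kernels
  \<open>Ker \<pi>(\<lambda>)\<close> need not be complemented, so local lifts cannot be glued with projections, and solving the gluing
  problem with values in the kernels is as hard as the original problem. The way out is to separate the
  dependence on \<open>\<lambda>\<close> from the values. By \<open>global_expansion\<close> every real analytic map from an open interval to a Banach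
  space is a sum \<open>\<Sum>k. f k(\<lambda>) c k\<close> with scalar real analytic \<open>f k\<close>, constant \<open>c k\<close> in the unit ball, and
  convergence that is absolute in a space of power series at every point. For \<open>b\<close> this reduces
  the problem to constants \<open>e\<close>, provided that all \<open>e\<close> in the unit ball are lifted with common bounds
  (\<open>uniform_lift\<close>). For \<open>\<pi>\<close> it does the following. Choose a scalar analytic partition \<open>\<chi> j\<close> of the constant
  \<open>1\<close>, concentrated so near to points \<open>y j\<close> that \<open>\<pi>\<close> hardly varies there, and points \<open>s j\<close> with
  \<open>\<pi>(y j) s j = e\<close>. Then \<open>\<Sum>j. \<chi> j s j\<close> is an approximate lift of \<open>e\<close>, and the expansion of \<open>\<pi>\<close> shows that its
  error is a sum of constants in the unit ball multiplied by scalar functions \<open>g n\<close> that do not depend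
  on \<open>e\<close> and satisfy \<open>\<Sum>n. \<bar>g n\<bar> \<le> 1/2\<close>. So the errors can be lifted in the same way, and the
  iteration converges (\<open>uniform_lift_of_contraction\<close>). Since power series norms on small intervals are close to the value
  at the centre, all smallness conditions concern values at real points only.

  The scalar functions come from an analytic replacement of the decomposition of \<open>b\<close> into its
  restrictions to short intervals. The sharp cut of a power series at a point is replaced by the smooth
  step \<open>1/2 + arctan (v/\<eta>) / pi\<close>, with a polynomial correction that makes the difference from the sharp cut
  decay away from the point (\<open>cut_error_far\<close>). The differences at common end points cancel
  (\<open>phi_sum\<close>), and small \<open>\<eta>\<close> makes everything converge.

  For the correction, replace \<open>a0\<close> by its self-adjoint part and insert it in the Lagrange polynomials of
  the \<open>\<lambda>\<^sub>i\<close>. The results are idempotents modulo the kernel. Elements \<open>q\<close> of the kernel are quasinilpotent,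
  that is \<open>t ^ n * norm (q ^ n)\<close> tends to \<open>0\<close> for every \<open>t \<ge> 0\<close> (\<open>quasinilpotent_powers\<close>), so the binomial series for
  \<open>(1 + 4 q)\<^sup>-\<^sup>1\<^sup>/\<^sup>2\<close> converges and turns them into idempotents \<open>E i\<close> that depend analytically on the parameter.
  The only idempotent in the kernel is \<open>0\<close>. Hence the \<open>E i\<close> are orthogonal with sum \<open>1\<close>, and
  \<open>\<Sum>i. \<lambda>\<^sub>i E i\<close> is the required map.
\<close>

section \<open>Absolutely summable families\<close>

text \<open>
  A bound for all finite partial sums of the norms expresses absolute summability and a bound for the sum
  at once. It can be verified without any convergence argument.
\<close>

definition l1_le :: "('i \<Rightarrow> 'a::real_normed_vector) \<Rightarrow> real \<Rightarrow> bool" where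
  "l1_le f w \<longleftrightarrow> (\<forall>F. finite F \<longrightarrow> (\<Sum>i\<in>F. norm (f i)) \<le> w)"

lemma l1_le_nonneg: "l1_le f w \<Longrightarrow> 0 \<le> w"
  unfolding l1_le_def by (drule spec[of _ "{}"]) simp

lemma l1_le_mono:
  assumes "l1_le f w" "\<And>i. norm (g i) \<le> norm (f i)" "w \<le> w'"
  shows "l1_le g w'"
  unfolding l1_le_def
proof (intro allI impI)
  fix F :: "'a set" assume F: "finite F"
  have "(\<Sum>i\<in>F. norm (g i)) \<le> (\<Sum>i\<in>F. norm (f i))" by (intro sum_mono assms)
  also have "\<dots> \<le> w" using assms(1) F unfolding l1_le_def by blast
  finally show "(\<Sum>i\<in>F. norm (g i)) \<le> w'" using assms(3) by simp
qed

lemma l1_le_scale: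
  assumes "l1_le f w" "\<And>i. norm (g i) \<le> k * norm (f i)" "0 \<le> k"
  shows "l1_le g (k * w)"
  unfolding l1_le_def
proof (intro allI impI)
  fix F :: "'a set" assume F: "finite F"
  have "(\<Sum>i\<in>F. norm (g i)) \<le> k * (\<Sum>i\<in>F. norm (f i))"
    unfolding sum_distrib_left by (intro sum_mono assms)
  also have "\<dots> \<le> k * w" using assms F unfolding l1_le_def by (intro mult_left_mono) blast+
  finally show "(\<Sum>i\<in>F. norm (g i)) \<le> k * w" .
qed

lemma l1_le_add:
  assumes "l1_le f w" "l1_le g v"
  shows "l1_le (\<lambda>i. f i + g i) (w + v)"
  unfolding l1_le_def
proof (intro allI impI)
  fix F :: "'a set" assume F: "finite F"
  have "(\<Sum>i\<in>F. norm (f i + g i)) \<le> (\<Sum>i\<in>F. norm (f i)) + (\<Sum>i\<in>F. norm (g i))"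
    unfolding sum.distrib[symmetric] by (intro sum_mono norm_triangle_ineq)
  also have "\<dots> \<le> w + v" using assms F unfolding l1_le_def by (intro add_mono) blast+
  finally show "(\<Sum>i\<in>F. norm (f i + g i)) \<le> w + v" .
qed

lemma l1_le_diff:
  assumes "l1_le f w" "l1_le g v"
  shows "l1_le (\<lambda>i. f i - g i) (w + v)"
proof -
  have "l1_le (\<lambda>i. - g i) v" using assms(2) by (simp add: l1_le_def)
  from l1_le_add[OF assms(1) this] show ?thesis by simp
qed

lemma l1_le_abs_summable:
  assumes "l1_le f w"
  shows "(\<lambda>i. norm (f i)) summable_on UNIV"
proof (rule nonneg_bdd_above_summable_on)
  show "bdd_above (sum (\<lambda>i. norm (f i)) ` {F. F \<subseteq> UNIV \<and> finite F})"
    using assms unfolding l1_le_def bdd_above_def by auto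
qed simp

lemma l1_le_infsum_norm:
  assumes "l1_le f w"
  shows "(\<Sum>\<^sub>\<infinity>i. norm (f i)) \<le> w"
  by (rule infsum_le_finite_sums[OF l1_le_abs_summable[OF assms]])
     (use assms in \<open>auto simp: l1_le_def\<close>)

lemma l1_le_iff:
  "l1_le f w \<longleftrightarrow> (\<lambda>i. norm (f i)) summable_on UNIV \<and> (\<Sum>\<^sub>\<infinity>i. norm (f i)) \<le> w"
proof
  assume R: "(\<lambda>i. norm (f i)) summable_on UNIV \<and> (\<Sum>\<^sub>\<infinity>i. norm (f i)) \<le> w"
  show "l1_le f w" unfolding l1_le_def
  proof (intro allI impI)
    fix F :: "'a set" assume F: "finite F"
    have "(\<Sum>i\<in>F. norm (f i)) \<le> (\<Sum>\<^sub>\<infinity>i. norm (f i))"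
      using R F by (intro finite_sum_le_infsum) auto
    thus "(\<Sum>i\<in>F. norm (f i)) \<le> w" using R by linarith
  qed
qed (use l1_le_abs_summable l1_le_infsum_norm in blast)

lemma l1_le_summable:
  fixes f :: "'i \<Rightarrow> 'a::banach"
  shows "l1_le f w \<Longrightarrow> f summable_on UNIV"
  using l1_le_abs_summable Infinite_Sum.abs_summable_summable by blast

lemma l1_le_infsum:
  fixes f :: "'i \<Rightarrow> 'a::banach"
  assumes "l1_le f w"
  shows "norm (\<Sum>\<^sub>\<infinity>i. f i) \<le> w"
  using norm_infsum_bound[OF l1_le_abs_summable[OF assms]] l1_le_infsum_norm[OF assms] by linarith

lemma l1_le_norm [simp]: "l1_le (\<lambda>i. norm (f i)) w = l1_le f w"
  unfolding l1_le_def by simp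

lemma l1_le_finite_support:
  assumes "finite K" "\<And>i. i \<notin> K \<Longrightarrow> f i = 0" "(\<Sum>i\<in>K. norm (f i)) \<le> w"
  shows "l1_le f w"
  unfolding l1_le_def
proof (intro allI impI)
  fix F :: "'a set" assume F: "finite F"
  have "(\<Sum>i\<in>F. norm (f i)) = (\<Sum>i\<in>F \<inter> K. norm (f i))"
    using F assms(1,2) by (intro sum.mono_neutral_right) auto
  also have "\<dots> \<le> (\<Sum>i\<in>K. norm (f i))" using assms(1) by (intro sum_mono2) auto
  finally show "(\<Sum>i\<in>F. norm (f i)) \<le> w" using assms(3) by simp
qed

lemma l1_le_Sigma:
  fixes f :: "'i \<times> 'j \<Rightarrow> 'a::real_normed_vector"
  assumes f: "\<And>i. l1_le (\<lambda>j. f (i, j)) (w i)" and w: "l1_le w W"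
  shows "l1_le f W"
  unfolding l1_le_def
proof (intro allI impI)
  fix F :: "('i \<times> 'j) set" assume F: "finite F"
  have "(\<Sum>p\<in>F. norm (f p)) \<le> (\<Sum>p\<in>fst ` F \<times> snd ` F. norm (f p))"
    using F by (intro sum_mono2) (auto simp: rev_image_eqI)
  also have "\<dots> = (\<Sum>i\<in>fst ` F. \<Sum>j\<in>snd ` F. norm (f (i, j)))"
    by (simp add: sum.cartesian_product)
  also have "\<dots> \<le> (\<Sum>i\<in>fst ` F. norm (w i))"
  proof (intro sum_mono)
    fix i
    have "(\<Sum>j\<in>snd ` F. norm (f (i, j))) \<le> w i" using f[of i] F unfolding l1_le_def by blast
    thus "(\<Sum>j\<in>snd ` F. norm (f (i, j))) \<le> norm (w i)" by simp
  qed
  also have "\<dots> \<le> W" using w F unfolding l1_le_def by blast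
  finally show "(\<Sum>p\<in>F. norm (f p)) \<le> W" .
qed

lemma l1_le_reindex:
  assumes "l1_le f W" "inj h"
  shows "l1_le (\<lambda>i. f (h i)) W"
  unfolding l1_le_def
proof (intro allI impI)
  fix F :: "'c set" assume F: "finite F"
  have "(\<Sum>i\<in>F. norm (f (h i))) = (\<Sum>i\<in>h ` F. norm (f i))"
    using assms(2) by (subst sum.reindex) (auto simp: inj_on_def)
  thus "(\<Sum>i\<in>F. norm (f (h i))) \<le> W" using assms(1) F unfolding l1_le_def by auto
qed

lemma l1_le_swap:
  assumes "l1_le (f :: 'i \<times> 'j \<Rightarrow> 'a::real_normed_vector) W"
  shows "l1_le (\<lambda>p. f (snd p, fst p)) W"
  using l1_le_reindex[OF assms, of "\<lambda>p. (snd p, fst p)"] by (simp add: inj_def)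

lemma l1_le_section:
  assumes "l1_le (f :: 'i \<times> 'j \<Rightarrow> 'a::real_normed_vector) W"
  shows "l1_le (\<lambda>j. f (i, j)) W"
  using l1_le_reindex[OF assms, of "\<lambda>j. (i, j)"] by (simp add: inj_def)

text \<open>
  Absolute summability over pairs passes to the iterated sums, which is what makes rearrangements
  of power series of power series possible.
\<close>

lemma l1_fubini:
  fixes f :: "'i \<times> 'j \<Rightarrow> 'a::banach"
  assumes "l1_le f W"
  shows "l1_le (\<lambda>i. \<Sum>\<^sub>\<infinity>j. norm (f (i, j))) W"
    and "l1_le (\<lambda>i. \<Sum>\<^sub>\<infinity>j. f (i, j)) W"
    and "(\<Sum>\<^sub>\<infinity>i. \<Sum>\<^sub>\<infinity>j. f (i, j)) = (\<Sum>\<^sub>\<infinity>p. f p)"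
proof -
  have s: "(\<lambda>p. norm (f p)) summable_on Sigma UNIV (\<lambda>_. UNIV)" using l1_le_abs_summable[OF assms] by simp
  have sec: "(\<lambda>j. norm (f (i, j))) summable_on UNIV" for i
    using l1_le_abs_summable[OF l1_le_section[OF assms]] .
  have 1: "(\<lambda>i. norm (\<Sum>\<^sub>\<infinity>j. norm (f (i, j)))) summable_on UNIV"
    using s unfolding Infinite_Sum.abs_summable_on_Sigma_iff by blast
  have 2: "(\<Sum>\<^sub>\<infinity>i. \<Sum>\<^sub>\<infinity>j. norm (f (i, j))) = (\<Sum>\<^sub>\<infinity>p. norm (f p))"
    using infsum_Sigma_banach[OF s] by simp
  have nn: "0 \<le> (\<Sum>\<^sub>\<infinity>j. norm (f (i, j)))" for i by (simp add: infsum_nonneg)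
  show A: "l1_le (\<lambda>i. \<Sum>\<^sub>\<infinity>j. norm (f (i, j))) W"
    unfolding l1_le_iff using 1 2 nn l1_le_infsum_norm[OF assms] by (simp)
  show "l1_le (\<lambda>i. \<Sum>\<^sub>\<infinity>j. f (i, j)) W"
    by (rule l1_le_mono[OF A]) (use norm_infsum_bound[OF sec] nn in auto)
  show "(\<Sum>\<^sub>\<infinity>i. \<Sum>\<^sub>\<infinity>j. f (i, j)) = (\<Sum>\<^sub>\<infinity>p. f p)"
    using infsum_Sigma_banach[OF Infinite_Sum.abs_summable_summable[OF s]] by simp
qed

lemma l1_swap:
  fixes f :: "'i \<times> 'j \<Rightarrow> 'a::banach"
  assumes "l1_le f W"
  shows "(\<Sum>\<^sub>\<infinity>i. \<Sum>\<^sub>\<infinity>j. f (i, j)) = (\<Sum>\<^sub>\<infinity>j. \<Sum>\<^sub>\<infinity>i. f (i, j))"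
  using infsum_swap_banach[of "\<lambda>i j. f (i, j)" UNIV UNIV] l1_le_summable[OF assms] by simp

lemma infsum_bounded_linear_l1:
  fixes f :: "'i \<Rightarrow> 'a::banach"
  assumes "bounded_linear T" "l1_le f w"
  shows "T (\<Sum>\<^sub>\<infinity>i. f i) = (\<Sum>\<^sub>\<infinity>i. T (f i))"
  using has_sum_bounded_linear[OF assms(1) has_sum_infsum[OF l1_le_summable[OF assms(2)]]]
  by (simp add: infsumI)

lemma infsum_add_l1:
  fixes f :: "'i \<Rightarrow> 'a::banach"
  assumes "l1_le f w" "l1_le g v"
  shows "(\<Sum>\<^sub>\<infinity>i. f i + g i) = (\<Sum>\<^sub>\<infinity>i. f i) + (\<Sum>\<^sub>\<infinity>i. g i)"
  using infsum_add[OF l1_le_summable[OF assms(1)] l1_le_summable[OF assms(2)]] .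

lemma infsum_diff_l1:
  fixes f :: "'i \<Rightarrow> 'a::banach"
  assumes "l1_le f w" "l1_le g v"
  shows "(\<Sum>\<^sub>\<infinity>i. f i - g i) = (\<Sum>\<^sub>\<infinity>i. f i) - (\<Sum>\<^sub>\<infinity>i. g i)"
proof -
  have "l1_le (\<lambda>i. - g i) v" using assms(2) unfolding l1_le_def by simp
  from infsum_add_l1[OF assms(1) this] show ?thesis by (simp add: infsum_uminus)
qed

lemma infsum_single:
  fixes f :: "'i \<Rightarrow> 'a::banach"
  assumes "\<And>i. i \<noteq> k \<Longrightarrow> f i = 0"
  shows "(\<Sum>\<^sub>\<infinity>i. f i) = f k"
proof -
  have "(\<Sum>\<^sub>\<infinity>i. f i) = (\<Sum>\<^sub>\<infinity>i\<in>{k}. f i)"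
    using assms by (intro infsum_cong_neutral) auto
  thus ?thesis by simp
qed

lemma l1_le_geometric:
  fixes q :: real
  assumes "0 \<le> q" "q < 1"
  shows "l1_le (\<lambda>n. q ^ n) (1 / (1 - q))"
  unfolding l1_le_def
proof (intro allI impI)
  fix F :: "nat set" assume "finite F"
  hence "(\<Sum>i\<in>F. norm (q ^ i)) \<le> (\<Sum>n. q ^ n)"
    using assms by (simp add: sum_le_suminf summable_geometric)
  thus "(\<Sum>i\<in>F. norm (q ^ i)) \<le> 1 / (1 - q)" using assms suminf_geometric[of q] by simp
qed

lemma l1_le_sums:
  fixes f :: "nat \<Rightarrow> 'a::banach"
  assumes "l1_le f w"
  shows "f sums (\<Sum>\<^sub>\<infinity>n. f n)" "summable (\<lambda>n. norm (f n))"
  using has_sum_imp_sums[OF has_sum_infsum[OF l1_le_summable[OF assms]]]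
    summable_on_imp_summable[OF l1_le_abs_summable[OF assms]] by auto

section \<open>Functions given by a power series\<close>

text \<open>
  The function \<open>f\<close> is on \<open>[x - r, x + r]\<close> the sum of a power series whose norm in the weighted space
  \<open>\<ell>\<^sup>1\<close> with weights \<open>r ^ m\<close> is at most \<open>w\<close>. These norms take the place of suprema over complex discs: they
  are submultiplicative and complete.
\<close>

definition ps_bound :: "real \<Rightarrow> real \<Rightarrow> (real \<Rightarrow> 'a::banach) \<Rightarrow> real \<Rightarrow> bool" where
  "ps_bound x r f w \<longleftrightarrow> 0 < r \<and> (\<exists>c. l1_le (\<lambda>m. r ^ m *\<^sub>R c m) w \<and>
     (\<forall>t. \<bar>t - x\<bar> \<le> r \<longrightarrow> f t = (\<Sum>\<^sub>\<infinity>m. (t - x) ^ m *\<^sub>R c m)))"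

lemma ps_boundI:
  assumes "0 < r" "l1_le (\<lambda>m. r ^ m *\<^sub>R c m) w"
    "\<And>t. \<bar>t - x\<bar> \<le> r \<Longrightarrow> f t = (\<Sum>\<^sub>\<infinity>m. (t - x) ^ m *\<^sub>R c m)"
  shows "ps_bound x r f w"
  unfolding ps_bound_def using assms by blast

lemma ps_boundE:
  assumes "ps_bound x r f w"
  obtains c where "0 < r" "l1_le (\<lambda>m. r ^ m *\<^sub>R c m) w"
    "\<And>t. \<bar>t - x\<bar> \<le> r \<Longrightarrow> f t = (\<Sum>\<^sub>\<infinity>m. (t - x) ^ m *\<^sub>R c m)"
  using assms unfolding ps_bound_def by blast

lemma ps_bound_radius: "ps_bound x r f w \<Longrightarrow> 0 < r"
  unfolding ps_bound_def by blast

lemma ps_bound_nonneg: "ps_bound x r f w \<Longrightarrow> 0 \<le> w"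
  unfolding ps_bound_def using l1_le_nonneg by blast

lemma l1_le_smaller_radius:
  fixes c :: "nat \<Rightarrow> 'a::real_normed_vector"
  assumes "l1_le (\<lambda>m. r ^ m *\<^sub>R c m) w" "\<bar>s\<bar> \<le> r"
  shows "l1_le (\<lambda>m. s ^ m *\<^sub>R c m) w"
proof (rule l1_le_mono[OF assms(1) _ order_refl])
  fix m
  have "\<bar>s ^ m\<bar> \<le> \<bar>r ^ m\<bar>" unfolding power_abs using assms(2) by (intro power_mono) auto
  thus "norm (s ^ m *\<^sub>R c m) \<le> norm (r ^ m *\<^sub>R c m)" by (simp add: mult_right_mono)
qed

lemma ps_bound_norm:
  assumes "ps_bound x r f w" "\<bar>t - x\<bar> \<le> r"
  shows "norm (f t) \<le> w"
proof -
  obtain c where c: "0 < r" "l1_le (\<lambda>m. r ^ m *\<^sub>R c m) w"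
    "\<And>t. \<bar>t - x\<bar> \<le> r \<Longrightarrow> f t = (\<Sum>\<^sub>\<infinity>m. (t - x) ^ m *\<^sub>R c m)"
    using ps_boundE[OF assms(1)] by metis
  show ?thesis using l1_le_infsum[OF l1_le_smaller_radius[OF c(2) assms(2)]] c(3)[OF assms(2)] by simp
qed

lemma ps_bound_cong:
  assumes "ps_bound x r f w" "\<And>t. \<bar>t - x\<bar> \<le> r \<Longrightarrow> g t = f t" "w \<le> w'"
  shows "ps_bound x r g w'"
proof -
  obtain c where c: "0 < r" "l1_le (\<lambda>m. r ^ m *\<^sub>R c m) w"
    "\<And>t. \<bar>t - x\<bar> \<le> r \<Longrightarrow> f t = (\<Sum>\<^sub>\<infinity>m. (t - x) ^ m *\<^sub>R c m)"
    using ps_boundE[OF assms(1)] by metis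
  show ?thesis
    by (rule ps_boundI[of _ c]) (use c assms l1_le_mono[OF c(2) order_refl assms(3)] in auto)
qed

lemma ps_bound_mono: "ps_bound x r f w \<Longrightarrow> w \<le> w' \<Longrightarrow> ps_bound x r f w'"
  by (erule ps_bound_cong) auto

lemma ps_bound_const: "0 < r \<Longrightarrow> ps_bound x r (\<lambda>_. c) (norm c)"
proof (rule ps_boundI[of _ "\<lambda>m. if m = 0 then c else 0"])
  show "l1_le (\<lambda>m. r ^ m *\<^sub>R (if m = 0 then c else 0)) (norm c)"
    by (rule l1_le_finite_support[of "{0}"]) auto
  show "c = (\<Sum>\<^sub>\<infinity>m. (t - x) ^ m *\<^sub>R (if m = 0 then c else 0))" for t
    by (subst infsum_single[of 0]) auto
qed

text \<open>
  Multiplication by a power of \<open>t - x\<close> shifts the coefficients. Together with sums of series this gives products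
  (\<open>ps_bound_bilinear\<close>) without a convolution of coefficients.
\<close>

lemma ps_bound_shift:
  assumes "ps_bound x r f w"
  shows "ps_bound x r (\<lambda>t. (t - x) ^ n *\<^sub>R f t) (r ^ n * w)"
proof -
  obtain c where c: "0 < r" "l1_le (\<lambda>m. r ^ m *\<^sub>R c m) w"
    "\<And>t. \<bar>t - x\<bar> \<le> r \<Longrightarrow> f t = (\<Sum>\<^sub>\<infinity>m. (t - x) ^ m *\<^sub>R c m)"
    using ps_boundE[OF assms(1)] by metis
  let ?d = "\<lambda>m. if m < n then 0 else c (m - n)"
  show ?thesis
  proof (rule ps_boundI[of _ ?d])
    show "l1_le (\<lambda>m. r ^ m *\<^sub>R ?d m) (r ^ n * w)"
      unfolding l1_le_def
    proof (intro allI impI)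
      fix F :: "nat set" assume F: "finite F"
      have "(\<Sum>i\<in>F. norm (r ^ i *\<^sub>R ?d i)) \<le> (\<Sum>i\<in>(\<lambda>m. m + n) ` (\<lambda>m. m - n) ` F. norm (r ^ i *\<^sub>R ?d i))"
      proof -
        have "(\<Sum>i\<in>F. norm (r ^ i *\<^sub>R ?d i)) = (\<Sum>i\<in>F \<inter> {n..}. norm (r ^ i *\<^sub>R ?d i))"
          using F by (intro sum.mono_neutral_right) auto
        also have "\<dots> \<le> (\<Sum>i\<in>(\<lambda>m. m + n) ` (\<lambda>m. m - n) ` F. norm (r ^ i *\<^sub>R ?d i))"
          using F by (intro sum_mono2) (auto simp: image_iff intro!: bexI le_add_diff_inverse2[symmetric])
        finally show ?thesis .
      qed
      also have "\<dots> = (\<Sum>m\<in>(\<lambda>m. m - n) ` F. norm (r ^ (m + n) *\<^sub>R c m))"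
        by (subst sum.reindex) auto
      also have "\<dots> = r ^ n * (\<Sum>m\<in>(\<lambda>m. m - n) ` F. norm (r ^ m *\<^sub>R c m))"
        unfolding sum_distrib_left using c(1) by (intro sum.cong) (auto simp: power_add)
      also have "\<dots> \<le> r ^ n * w"
        using c(1,2) F unfolding l1_le_def by (intro mult_left_mono) auto
      finally show "(\<Sum>i\<in>F. norm (r ^ i *\<^sub>R ?d i)) \<le> r ^ n * w" .
    qed
    show "(t - x) ^ n *\<^sub>R f t = (\<Sum>\<^sub>\<infinity>m. (t - x) ^ m *\<^sub>R ?d m)" if t: "\<bar>t - x\<bar> \<le> r" for t
    proof -
      have "(\<Sum>\<^sub>\<infinity>m. (t - x) ^ m *\<^sub>R ?d m) = (\<Sum>\<^sub>\<infinity>m\<in>range (\<lambda>m. m + n). (t - x) ^ m *\<^sub>R ?d m)"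
        proof (intro infsum_cong_neutral)
          fix m assume "m \<in> UNIV - range (\<lambda>m. m + n)"
          hence "m < n" by (metis DiffE le_add_diff_inverse2 not_less rangeI)
          thus "(t - x) ^ m *\<^sub>R ?d m = 0" by simp
        qed auto
      also have "\<dots> = (\<Sum>\<^sub>\<infinity>m. (t - x) ^ (m + n) *\<^sub>R c m)"
        by (subst infsum_reindex) (auto simp: o_def)
      also have "\<dots> = (\<Sum>\<^sub>\<infinity>m. (t - x) ^ n *\<^sub>R ((t - x) ^ m *\<^sub>R c m))"
        by (simp add: power_add mult.commute)
      also have "\<dots> = (t - x) ^ n *\<^sub>R f t"
        using infsum_bounded_linear_l1[OF bounded_linear_scaleR_right l1_le_smaller_radius[OF c(2) t]]
        by (simp add: c(3)[OF t])
      finally show ?thesis by simp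
    qed
  qed (rule c(1))
qed

lemma ps_bound_linear:
  assumes "ps_bound x r f w" "bounded_linear T" "\<And>v. norm (T v) \<le> k * norm v" "0 \<le> k"
  shows "ps_bound x r (\<lambda>t. T (f t)) (k * w)"
proof -
  interpret T: bounded_linear T by fact
  obtain c where c: "0 < r" "l1_le (\<lambda>m. r ^ m *\<^sub>R c m) w"
    "\<And>t. \<bar>t - x\<bar> \<le> r \<Longrightarrow> f t = (\<Sum>\<^sub>\<infinity>m. (t - x) ^ m *\<^sub>R c m)"
    using ps_boundE[OF assms(1)] by metis
  show ?thesis
  proof (rule ps_boundI[of _ "\<lambda>m. T (c m)"])
    show "l1_le (\<lambda>m. r ^ m *\<^sub>R T (c m)) (k * w)"
      by (rule l1_le_scale[OF c(2) _ assms(4)]) (use assms(3) T.scaleR in metis)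
    show "T (f t) = (\<Sum>\<^sub>\<infinity>m. (t - x) ^ m *\<^sub>R T (c m))" if t: "\<bar>t - x\<bar> \<le> r" for t
      using infsum_bounded_linear_l1[OF assms(2) l1_le_smaller_radius[OF c(2) t]]
      by (simp add: c(3)[OF t] T.scaleR)
  qed (rule c(1))
qed

text \<open>
  Completeness of the power series norms: exchange the sum over \<open>k\<close> with the sum over the exponents.
\<close>

lemma ps_bound_infsum:
  fixes f :: "'k \<Rightarrow> real \<Rightarrow> 'a::banach"
  assumes f: "\<And>k. ps_bound x r (f k) (w k)" and w: "l1_le w W"
  shows "ps_bound x r (\<lambda>t. \<Sum>\<^sub>\<infinity>k. f k t) W"
    and "\<And>t. \<bar>t - x\<bar> \<le> r \<Longrightarrow> l1_le (\<lambda>k. f k t) W"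
proof -
  have r: "0 < r" using f ps_bound_radius by blast
  have "\<forall>k. \<exists>c. l1_le (\<lambda>m. r ^ m *\<^sub>R c m) (w k) \<and>
     (\<forall>t. \<bar>t - x\<bar> \<le> r \<longrightarrow> f k t = (\<Sum>\<^sub>\<infinity>m. (t - x) ^ m *\<^sub>R c m))"
    using f unfolding ps_bound_def by blast
  then obtain c where c: "\<And>k. l1_le (\<lambda>m. r ^ m *\<^sub>R c k m) (w k)"
    "\<And>k t. \<bar>t - x\<bar> \<le> r \<Longrightarrow> f k t = (\<Sum>\<^sub>\<infinity>m. (t - x) ^ m *\<^sub>R c k m)" by metis
  show "l1_le (\<lambda>k. f k t) W" if "\<bar>t - x\<bar> \<le> r" for t
    by (rule l1_le_mono[OF w _ order_refl])
       (use ps_bound_norm[OF f that] ps_bound_nonneg[OF f] in auto)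
  have dbl: "l1_le (\<lambda>(k, m). s ^ m *\<^sub>R c k m) W" if "\<bar>s\<bar> \<le> r" for s
    by (rule l1_le_Sigma[OF _ w]) (use l1_le_smaller_radius[OF c(1) that] in simp)
  define d where "d m = (\<Sum>\<^sub>\<infinity>k. c k m)" for m
  have col: "s ^ m *\<^sub>R d m = (\<Sum>\<^sub>\<infinity>k. s ^ m *\<^sub>R c k m)" for s m
  proof -
    have "l1_le (\<lambda>k. r ^ m *\<^sub>R c k m) W"
      using l1_le_section[OF l1_le_swap[OF dbl[of r]], of m] r by simp
    from l1_le_scale[OF this, of "\<lambda>k. c k m" "1 / r ^ m"] r
    have "l1_le (\<lambda>k. c k m) (1 / r ^ m * W)" by simp
    from infsum_bounded_linear_l1[OF bounded_linear_scaleR_right this] show ?thesis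
      by (simp add: d_def)
  qed
  show "ps_bound x r (\<lambda>t. \<Sum>\<^sub>\<infinity>k. f k t) W"
  proof (rule ps_boundI[of _ d, OF r])
    show "l1_le (\<lambda>m. r ^ m *\<^sub>R d m) W"
      using l1_fubini(2)[OF l1_le_swap[OF dbl[of r]]] r by (simp add: col)
    show "(\<Sum>\<^sub>\<infinity>k. f k t) = (\<Sum>\<^sub>\<infinity>m. (t - x) ^ m *\<^sub>R d m)" if t: "\<bar>t - x\<bar> \<le> r" for t
      using l1_swap[OF dbl[OF t]] c(2)[OF t] by (simp add: col)
  qed
qed

lemma ps_bound_add:
  fixes f g :: "real \<Rightarrow> 'a::banach"
  assumes "ps_bound x r f w" "ps_bound x r g v"
  shows "ps_bound x r (\<lambda>t. f t + g t) (w + v)"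
proof -
  let ?h = "\<lambda>b. if b then f else g" and ?u = "\<lambda>b. if b then w else v"
  have "ps_bound x r (\<lambda>t. \<Sum>\<^sub>\<infinity>b. ?h b t) (w + v)"
  proof (rule ps_bound_infsum(1)[of _ _ ?h ?u])
    show "l1_le ?u (w + v)"
      by (rule l1_le_finite_support[of UNIV])
         (use ps_bound_nonneg[OF assms(1)] ps_bound_nonneg[OF assms(2)] in \<open>auto simp: UNIV_bool\<close>)
  qed (use assms in auto)
  thus ?thesis by (simp add: UNIV_bool add.commute)
qed

lemma ps_bound_uminus: "ps_bound x r f w \<Longrightarrow> ps_bound x r (\<lambda>t. - f t) w"
  using ps_bound_linear[of x r f w uminus 1] bounded_linear_minus[OF bounded_linear_ident] by simp

lemma ps_bound_diff:
  assumes "ps_bound x r f w" "ps_bound x r g v"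
  shows "ps_bound x r (\<lambda>t. f t - g t) (w + v)"
  using ps_bound_add[OF assms(1) ps_bound_uminus[OF assms(2)]] by simp

lemma ps_bound_sum:
  assumes "finite I" "\<And>i. i \<in> I \<Longrightarrow> ps_bound x r (f i) (w i)" "0 < r"
  shows "ps_bound x r (\<lambda>t. \<Sum>i\<in>I. f i t) (\<Sum>i\<in>I. w i)"
  using assms(1,2)
proof (induction I rule: finite_induct)
  case empty
  then show ?case using ps_bound_const[OF assms(3), of x 0] by simp
next
  case (insert i I)
  then show ?case using ps_bound_add[of x r "f i" "w i"] by simp
qed

text \<open>
  Expand only the first factor; then each term is a shifted linear image of the second one.
\<close>

lemma ps_bound_bilinear:
  assumes f: "ps_bound x r f u" and g: "ps_bound x r g v" and B: "bounded_bilinear B"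
    and le: "\<And>a b. norm (B a b) \<le> norm a * norm b"
  shows "ps_bound x r (\<lambda>t. B (f t) (g t)) (u * v)"
proof -
  interpret B: bounded_bilinear B by fact
  obtain c where c: "0 < r" "l1_le (\<lambda>m. r ^ m *\<^sub>R c m) u"
    "\<And>t. \<bar>t - x\<bar> \<le> r \<Longrightarrow> f t = (\<Sum>\<^sub>\<infinity>m. (t - x) ^ m *\<^sub>R c m)"
    using ps_boundE[OF f] by metis
  have tm: "ps_bound x r (\<lambda>t. (t - x) ^ m *\<^sub>R B (c m) (g t)) (r ^ m * (norm (c m) * v))" for m
    by (rule ps_bound_shift[OF ps_bound_linear[OF g B.bounded_linear_right]]) (use le in auto)
  \<comment> \<open>Summing the bounds of the terms reproduces the norm of the first factor.\<close>
  have "l1_le (\<lambda>m. r ^ m * (norm (c m) * v)) (v * u)"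
    by (rule l1_le_scale[OF c(2)]) (use c(1) ps_bound_nonneg[OF g] in \<open>auto simp: abs_mult\<close>)
  from ps_bound_infsum(1)[OF tm this] show ?thesis
  proof (rule ps_bound_cong)
    fix t assume t: "\<bar>t - x\<bar> \<le> r"
    show "B (f t) (g t) = (\<Sum>\<^sub>\<infinity>m. (t - x) ^ m *\<^sub>R B (c m) (g t))"
      using infsum_bounded_linear_l1[OF B.bounded_linear_left l1_le_smaller_radius[OF c(2) t], of "g t"]
      by (simp add: c(3)[OF t] B.scaleR_left)
  qed (simp add: mult.commute)
qed

lemma ps_bound_mult:
  fixes f g :: "real \<Rightarrow> 'a::{real_normed_algebra,banach}"
  assumes "ps_bound x r f u" "ps_bound x r g v"
  shows "ps_bound x r (\<lambda>t. f t * g t) (u * v)"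
  by (rule ps_bound_bilinear[OF assms bounded_bilinear_mult norm_mult_ineq])

lemma ps_bound_scaleR:
  fixes f :: "real \<Rightarrow> real" and g :: "real \<Rightarrow> 'a::banach"
  assumes "ps_bound x r f u" "ps_bound x r g v"
  shows "ps_bound x r (\<lambda>t. f t *\<^sub>R g t) (u * v)"
  by (rule ps_bound_bilinear[OF assms bounded_bilinear_scaleR]) simp

lemma ps_bound_power:
  fixes f :: "real \<Rightarrow> 'a::{real_normed_algebra_1,banach}"
  assumes "ps_bound x r f u"
  shows "ps_bound x r (\<lambda>t. f t ^ n) (u ^ n)"
proof (induction n)
  case 0
  then show ?case using ps_bound_const[OF ps_bound_radius[OF assms], of x "1::'a"] by simp
next
  case (Suc n)
  then show ?case using ps_bound_mult[OF assms] by simp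
qed

lemma ps_bound_ident: "0 < r \<Longrightarrow> ps_bound x r (\<lambda>t. t - y) (r + \<bar>x - y\<bar>)"
  using ps_bound_add[OF ps_bound_shift[OF ps_bound_const[of r x "1::real"], of 1] ps_bound_const[of r x "x - y"]]
  by simp

lemma ps_bound_shrink:
  assumes "ps_bound x r f w" "0 < s" "s \<le> r"
  shows "ps_bound x s f w"
proof -
  obtain c where c: "0 < r" "l1_le (\<lambda>m. r ^ m *\<^sub>R c m) w"
    "\<And>t. \<bar>t - x\<bar> \<le> r \<Longrightarrow> f t = (\<Sum>\<^sub>\<infinity>m. (t - x) ^ m *\<^sub>R c m)"
    using ps_boundE[OF assms(1)] by metis
  show ?thesis
    by (rule ps_boundI[of _ c]) (use c assms l1_le_smaller_radius[OF c(2), of s] in auto)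
qed

text \<open>
  Only the constant term survives in the norm when the radius tends to \<open>0\<close>. This is why estimates at the
  centre alone suffice as long as the radius may be chosen afterwards.
\<close>

lemma ps_bound_shrink':
  assumes "ps_bound x r f w" "0 < s" "s \<le> r"
  shows "ps_bound x s f (norm (f x) + s / r * w)"
proof -
  obtain c where c: "0 < r" "l1_le (\<lambda>m. r ^ m *\<^sub>R c m) w"
    "\<And>t. \<bar>t - x\<bar> \<le> r \<Longrightarrow> f t = (\<Sum>\<^sub>\<infinity>m. (t - x) ^ m *\<^sub>R c m)"
    using ps_boundE[OF assms(1)] by metis
  have fx: "f x = c 0"
    using c(1) by (subst c(3)) (auto simp: infsum_single[of 0])
  show ?thesis
  proof (rule ps_boundI[of _ c])
    have A: "l1_le (\<lambda>m::nat. if m = 0 then f x else 0) (norm (f x))"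
      by (rule l1_le_finite_support[of "{0::nat}"]) auto
    have "l1_le (\<lambda>m. if m = 0 then 0 else s ^ m *\<^sub>R c m) (s / r * w)"
    proof (rule l1_le_scale[OF c(2)])
      fix m
      have "(s / r) ^ m \<le> s / r" if "m \<noteq> 0"
        using power_decreasing[of 1 m "s / r"] that assms c(1) by simp
      hence "s ^ m \<le> s / r * r ^ m" if "m \<noteq> 0"
        using that c(1) by (simp add: power_divide divide_simps mult.commute)
      hence "s ^ m * norm (c m) \<le> s / r * r ^ m * norm (c m)" if "m \<noteq> 0"
        using that by (intro mult_right_mono) auto
      thus "norm (if m = 0 then 0 else s ^ m *\<^sub>R c m) \<le> s / r * norm (r ^ m *\<^sub>R c m)"
        using assms c(1) by (auto simp: mult.assoc)
    qed (use assms c(1) in auto)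
    from l1_le_add[OF A this] show "l1_le (\<lambda>m. s ^ m *\<^sub>R c m) (norm (f x) + s / r * w)"
      by (rule l1_le_mono) (auto simp: fx)
  qed (use c assms in auto)
qed

text \<open>
  Replacing the monomials \<open>v ^ k\<close> by arbitrary numbers \<open>L k\<close> of geometric growth costs nothing in the proof that a
  power series can be rearranged about another centre. Apart from the usual case \<open>L k = v ^ k\<close>, the
  errors made by cutting monomials at a point are such numbers.
\<close>

lemma recentre_sum:
  fixes c :: "nat \<Rightarrow> 'a::banach" and L :: "nat \<Rightarrow> real"
  assumes c: "l1_le (\<lambda>m. r ^ m *\<^sub>R c m) w" and s: "0 < s" "\<bar>h\<bar> + s \<le> r"
  defines "d \<equiv> (\<lambda>k. \<Sum>\<^sub>\<infinity>m. (real (m choose k) * h ^ (m - k)) *\<^sub>R c m)"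
  shows "l1_le (\<lambda>k. s ^ k *\<^sub>R d k) w"
    and "(\<And>k. \<bar>L k\<bar> \<le> K * s ^ k) \<Longrightarrow>
      (\<Sum>\<^sub>\<infinity>m. (\<Sum>k\<le>m. real (m choose k) * h ^ (m - k) * L k) *\<^sub>R c m) = (\<Sum>\<^sub>\<infinity>k. L k *\<^sub>R d k)"
proof -
  have dbl: "l1_le (\<lambda>(m, k). (real (m choose k) * h ^ (m - k) * L k) *\<^sub>R c m) (K * w)"
    if L: "\<And>k. \<bar>L k\<bar> \<le> K * s ^ k" for L K
  proof (rule l1_le_Sigma)
    have K: "0 \<le> K" using L[of 0] by simp
    show "l1_le (\<lambda>m. K * (r ^ m * norm (c m))) (K * w)"
      by (rule l1_le_scale[OF c]) (use K s in \<open>auto simp: abs_mult\<close>)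
    show "l1_le (\<lambda>k. case (m, k) of (m, k) \<Rightarrow> (real (m choose k) * h ^ (m - k) * L k) *\<^sub>R c m)
        (K * (r ^ m * norm (c m)))" for m
    proof (rule l1_le_finite_support[of "{..m}"])
      have "(\<Sum>k\<le>m. norm (case (m, k) of (m, k) \<Rightarrow> (real (m choose k) * h ^ (m - k) * L k) *\<^sub>R c m))
        \<le> (\<Sum>k\<le>m. (real (m choose k) * \<bar>h\<bar> ^ (m - k) * (K * s ^ k)) * norm (c m))"
      proof (intro sum_mono)
        fix k
        have "real (m choose k) * \<bar>h\<bar> ^ (m - k) * \<bar>L k\<bar> * norm (c m)
          \<le> real (m choose k) * \<bar>h\<bar> ^ (m - k) * (K * s ^ k) * norm (c m)"
          by (intro mult_right_mono mult_left_mono L) auto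
        thus "norm (case (m, k) of (m, k) \<Rightarrow> (real (m choose k) * h ^ (m - k) * L k) *\<^sub>R c m)
          \<le> (real (m choose k) * \<bar>h\<bar> ^ (m - k) * (K * s ^ k)) * norm (c m)"
          by (simp add: abs_mult power_abs)
      qed
      also have "\<dots> = K * ((\<bar>h\<bar> + s) ^ m * norm (c m))"
        unfolding add.commute[of "\<bar>h\<bar>"] binomial_ring sum_distrib_left sum_distrib_right
        by (intro sum.cong) auto
      also have "\<dots> \<le> K * (r ^ m * norm (c m))"
        using K s by (intro mult_left_mono mult_right_mono power_mono) auto
      finally show "(\<Sum>k\<le>m. norm (case (m, k) of (m, k) \<Rightarrow> (real (m choose k) * h ^ (m - k) * L k) *\<^sub>R c m))
        \<le> K * (r ^ m * norm (c m))" .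
    qed auto
  qed
  have pow: "\<bar>s ^ k\<bar> \<le> 1 * s ^ k" for k using s by simp
  have col: "l1_le (\<lambda>m. (real (m choose k) * h ^ (m - k)) *\<^sub>R c m) (1 / s ^ k * w)" for k
    by (rule l1_le_scale[OF l1_le_section[OF l1_le_swap[OF dbl[OF pow]], of k, unfolded mult_1]])
       (use s in \<open>auto simp: abs_mult\<close>)
  have scale: "(\<Sum>\<^sub>\<infinity>m. (real (m choose k) * h ^ (m - k) * u) *\<^sub>R c m) = u *\<^sub>R d k" for u k
    using infsum_bounded_linear_l1[OF bounded_linear_scaleR_right col, of u]
    by (simp add: d_def mult.commute mult.left_commute)
  show "l1_le (\<lambda>k. s ^ k *\<^sub>R d k) w"
    using l1_fubini(2)[OF l1_le_swap[OF dbl[OF pow]]] by (simp add: scale)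
  assume L: "\<And>k. \<bar>L k\<bar> \<le> K * s ^ k"
  have row: "(\<Sum>\<^sub>\<infinity>k. (real (m choose k) * h ^ (m - k) * L k) *\<^sub>R c m)
      = (\<Sum>k\<le>m. real (m choose k) * h ^ (m - k) * L k) *\<^sub>R c m" for m
  proof -
    have "(\<Sum>\<^sub>\<infinity>k. (real (m choose k) * h ^ (m - k) * L k) *\<^sub>R c m)
        = (\<Sum>\<^sub>\<infinity>k\<in>{..m}. (real (m choose k) * h ^ (m - k) * L k) *\<^sub>R c m)"
      by (intro infsum_cong_neutral) auto
    thus ?thesis by (simp add: scaleR_left.sum)
  qed
  show "(\<Sum>\<^sub>\<infinity>m. (\<Sum>k\<le>m. real (m choose k) * h ^ (m - k) * L k) *\<^sub>R c m) = (\<Sum>\<^sub>\<infinity>k. L k *\<^sub>R d k)"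
    using l1_swap[OF dbl[OF L]] by (simp add: row scale)
qed

lemma ps_bound_recentre:
  assumes "ps_bound x r f w" "\<bar>y - x\<bar> + s \<le> r" "0 < s"
  shows "ps_bound y s f w"
proof -
  obtain c where c: "0 < r" "l1_le (\<lambda>m. r ^ m *\<^sub>R c m) w"
    "\<And>t. \<bar>t - x\<bar> \<le> r \<Longrightarrow> f t = (\<Sum>\<^sub>\<infinity>m. (t - x) ^ m *\<^sub>R c m)"
    using ps_boundE[OF assms(1)] by metis
  let ?d = "\<lambda>k. \<Sum>\<^sub>\<infinity>m. (real (m choose k) * (y - x) ^ (m - k)) *\<^sub>R c m"
  show ?thesis
  proof (rule ps_boundI[of _ ?d, OF assms(3)])
    show "l1_le (\<lambda>k. s ^ k *\<^sub>R ?d k) w" by (rule recentre_sum(1)[OF c(2) assms(3,2)])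
    fix t assume t: "\<bar>t - y\<bar> \<le> s"
    have "\<bar>(t - y) ^ k\<bar> \<le> 1 * s ^ k" for k using t by (simp add: power_abs power_mono)
    from recentre_sum(2)[OF c(2) assms(3,2) this]
    have "(\<Sum>\<^sub>\<infinity>k. (t - y) ^ k *\<^sub>R ?d k)
      = (\<Sum>\<^sub>\<infinity>m. (\<Sum>k\<le>m. real (m choose k) * (y - x) ^ (m - k) * (t - y) ^ k) *\<^sub>R c m)" by simp
    also have "(\<lambda>m. (\<Sum>k\<le>m. real (m choose k) * (y - x) ^ (m - k) * (t - y) ^ k))
       = (\<lambda>m. (t - x) ^ m)"
    proof
      fix m
      have "(t - x) ^ m = ((t - y) + (y - x)) ^ m" by simp
      thus "(\<Sum>k\<le>m. real (m choose k) * (y - x) ^ (m - k) * (t - y) ^ k) = (t - x) ^ m"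
        unfolding binomial_ring by (simp add: ac_simps)
    qed
    finally show "f t = (\<Sum>\<^sub>\<infinity>k. (t - y) ^ k *\<^sub>R ?d k)" using c(3)[of t] t assms(2) by simp
  qed
qed

lemma ps_bound_geometric:
  fixes h :: "real \<Rightarrow> real"
  assumes "ps_bound x r h q" "q < 1"
  shows "ps_bound x r (\<lambda>t. 1 / (1 - h t)) (1 / (1 - q))"
proof -
  have q: "0 \<le> q" using ps_bound_nonneg[OF assms(1)] .
  have "ps_bound x r (\<lambda>t. \<Sum>\<^sub>\<infinity>n. h t ^ n) (1 / (1 - q))"
    by (rule ps_bound_infsum(1)[OF ps_bound_power[OF assms(1)] l1_le_geometric[OF q assms(2)]])
  thus ?thesis
  proof (rule ps_bound_cong)
    fix t assume t: "\<bar>t - x\<bar> \<le> r"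
    have h: "\<bar>h t\<bar> < 1" using ps_bound_norm[OF assms(1) t] assms(2) by simp
    have "l1_le (\<lambda>n. h t ^ n) (1 / (1 - \<bar>h t\<bar>))"
      by (rule l1_le_mono[OF l1_le_geometric[of "\<bar>h t\<bar>"]]) (use h in \<open>auto simp: power_abs\<close>)
    from l1_le_sums(1)[OF this] geometric_sums[of "h t"] h
    show "1 / (1 - h t) = (\<Sum>\<^sub>\<infinity>n. h t ^ n)" by (auto intro: sums_unique2)
  qed simp
qed

lemma ps_bound_inverse_shift:
  assumes "0 < r" "r < \<bar>x - y\<bar>"
  shows "ps_bound x r (\<lambda>t. 1 / (t - y)) (1 / (\<bar>x - y\<bar> - r))"
proof -
  \<comment> \<open>This choice gives \<open>t - y = (x - y) (1 - h t)\<close>.\<close>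
  let ?h = "\<lambda>t. (- 1 / (x - y)) * ((t - x) ^ 1 *\<^sub>R 1)"
  have "ps_bound x r ?h (norm (- 1 / (x - y)) * (r ^ 1 * norm (1::real)))"
    by (intro ps_bound_mult ps_bound_shift ps_bound_const assms(1))
  hence h: "ps_bound x r ?h (r / \<bar>x - y\<bar>)" by simp
  have "r / \<bar>x - y\<bar> < 1" using assms by simp
  from ps_bound_mult[OF ps_bound_const[OF assms(1), of x "1 / (x - y)"] ps_bound_geometric[OF h this]]
  show ?thesis
  proof (rule ps_bound_cong)
    fix t assume "\<bar>t - x\<bar> \<le> r"
    have "(x - y) * (1 - ?h t) = t - y" using assms by (simp add: field_simps)
    thus "1 / (t - y) = 1 / (x - y) * (1 / (1 - ?h t))" by (metis times_divide_times_eq mult_1)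
  next
    have "\<bar>x - y\<bar> * (1 - r / \<bar>x - y\<bar>) = \<bar>x - y\<bar> - r" using assms by (simp add: field_simps)
    thus "norm (1 / (x - y)) * (1 / (1 - r / \<bar>x - y\<bar>)) \<le> 1 / (\<bar>x - y\<bar> - r)" by simp
  qed
qed

text \<open>
  Used to make series in a function converge: near a zero of the function its norm is small.
\<close>

lemma ps_bound_vanishing:
  fixes f :: "real \<Rightarrow> 'a::banach"
  assumes "ps_bound x r f w" "f x = 0" "0 < e"
  obtains s where "0 < s" "s \<le> r" "ps_bound x s f e"
proof
  have w: "0 \<le> w" using ps_bound_nonneg[OF assms(1)] .
  have r: "0 < r" using ps_bound_radius[OF assms(1)] .
  let ?s = "min r (r * e / (w + 1))"
  show s: "0 < ?s" "?s \<le> r" using r w assms(3) by auto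
  have "?s / r \<le> (r * e / (w + 1)) / r" using r by (intro divide_right_mono) auto
  hence "?s / r * w \<le> (e / (w + 1)) * w"
    using r w by (intro mult_right_mono) auto
  also have "\<dots> \<le> e" using w assms(3) by (simp add: field_simps)
  finally show "ps_bound x ?s f e"
    using ps_bound_shrink'[OF assms(1) s] assms(2) by (auto intro: ps_bound_mono)
qed

lemma ps_bound_diff_const:
  assumes "ps_bound x r f w"
  shows "ps_bound x r (\<lambda>t. f t - f x) (2 * w)"
proof -
  have "norm (f x) \<le> w" using ps_bound_norm[OF assms, of x] ps_bound_radius[OF assms] by simp
  thus ?thesis
    using ps_bound_diff[OF assms ps_bound_const[OF ps_bound_radius[OF assms]], of "f x"]
    by (auto intro: ps_bound_mono)
qed

text \<open>
  Geometric series in \<open>1 - f / f x\<close>, which vanishes at \<open>x\<close>.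
\<close>

lemma ps_bound_inverse:
  fixes f :: "real \<Rightarrow> real"
  assumes f: "ps_bound x r f w" and fx: "f x \<noteq> 0"
  obtains s u where "0 < s" "s \<le> r" "ps_bound x s (\<lambda>t. 1 / f t) u"
proof -
  have r: "0 < r" using ps_bound_radius[OF f] .
  let ?h = "\<lambda>t. (- 1 / f x) * (f t - f x)"
  have "ps_bound x r ?h (norm (- 1 / f x) * (2 * w))"
    by (intro ps_bound_mult ps_bound_diff_const ps_bound_const f r)
  then obtain s where s: "0 < s" "s \<le> r" "ps_bound x s ?h (1 / 2)"
    using ps_bound_vanishing[of x r ?h _ "1/2"] by auto
  from ps_bound_mult[OF ps_bound_const[OF s(1), of x "1 / f x"] ps_bound_geometric[OF s(3)]]
  have "ps_bound x s (\<lambda>t. 1 / f t) (norm (1 / f x) * (1 / (1 - 1 / 2)))"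
  proof (rule ps_bound_cong)
    fix t
    have "f x * (1 - ?h t) = f t" using fx by (simp add: field_simps)
    thus "1 / f t = 1 / f x * (1 / (1 - ?h t))" by (metis times_divide_times_eq mult_1)
  qed auto
  with s that show ?thesis by blast
qed

definition arctan_coeff :: "nat \<Rightarrow> real" where
  "arctan_coeff n = (if odd n then (- 1) ^ (n div 2) / real n else 0)"

lemma arctan_coeff_bound: "\<bar>arctan_coeff n\<bar> \<le> 1"
  by (cases "n = 0") (auto simp: arctan_coeff_def power_abs divide_simps)

lemma arctan_coeff_0 [simp]: "arctan_coeff 0 = 0"
  by (simp add: arctan_coeff_def)

lemma arctan_series_l1:
  fixes z :: real
  assumes "\<bar>z\<bar> < 1"
  shows "l1_le (\<lambda>n. arctan_coeff n * z ^ n) (1 / (1 - \<bar>z\<bar>))"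
    and "arctan z = (\<Sum>\<^sub>\<infinity>n. arctan_coeff n * z ^ n)"
proof -
  show l1: "l1_le (\<lambda>n. arctan_coeff n * z ^ n) (1 / (1 - \<bar>z\<bar>))"
  proof (rule l1_le_mono[OF l1_le_geometric[of "\<bar>z\<bar>"]])
    show "norm (arctan_coeff n * z ^ n) \<le> norm (\<bar>z\<bar> ^ n)" for n
      using mult_right_mono[OF arctan_coeff_bound[of n], of "\<bar>z\<bar> ^ n"]
      by (simp add: abs_mult power_abs)
  qed (use assms in auto)
  have inj: "inj (\<lambda>k::nat. k * 2 + 1)" by (simp add: inj_def)
  have l1': "l1_le (\<lambda>k. arctan_coeff (k * 2 + 1) * z ^ (k * 2 + 1)) (1 / (1 - \<bar>z\<bar>))"
    using l1_le_reindex[OF l1 inj] .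
  have "(\<Sum>\<^sub>\<infinity>n. arctan_coeff n * z ^ n) = (\<Sum>\<^sub>\<infinity>n\<in>range (\<lambda>k. k * 2 + 1). arctan_coeff n * z ^ n)"
    by (intro infsum_cong_neutral) (auto simp: arctan_coeff_def elim!: oddE)
  also have "\<dots> = (\<Sum>\<^sub>\<infinity>k. arctan_coeff (k * 2 + 1) * z ^ (k * 2 + 1))"
    by (subst infsum_reindex[OF inj]) (simp add: o_def)
  also have "\<dots> = (\<Sum>k. arctan_coeff (k * 2 + 1) * z ^ (k * 2 + 1))"
    using l1_le_sums(1)[OF l1'] by (simp add: sums_iff)
  also have "\<dots> = arctan z"
    using assms by (subst arctan_series) (auto simp: arctan_coeff_def)
  finally show "arctan z = (\<Sum>\<^sub>\<infinity>n. arctan_coeff n * z ^ n)" ..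
qed

lemma ps_bound_arctan_small:
  fixes h :: "real \<Rightarrow> real"
  assumes h: "ps_bound x r h q" "q < 1"
  shows "ps_bound x r (\<lambda>t. arctan (h t)) (1 / (1 - q))"
proof -
  have q: "0 \<le> q" using ps_bound_nonneg[OF h(1)] .
  have "ps_bound x r (\<lambda>t. arctan_coeff n * h t ^ n) (1 * q ^ n)" for n
    using ps_bound_mult[OF ps_bound_const[OF ps_bound_radius[OF h(1)], of x "arctan_coeff n"]
        ps_bound_power[OF h(1)], of n]
    by (rule ps_bound_mono) (use q arctan_coeff_bound in \<open>auto intro!: mult_left_le_one_le\<close>)
  hence tm: "ps_bound x r (\<lambda>t. arctan_coeff n * h t ^ n) (q ^ n)" for n by simp
  from ps_bound_infsum(1)[OF tm l1_le_geometric[OF q h(2)]] show ?thesis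
    by (rule ps_bound_cong) (use ps_bound_norm[OF h(1)] h(2) arctan_series_l1(2) in fastforce)+
qed

text \<open>
  The addition theorem \<open>arctan g = arctan c + arctan ((g - c) / (1 + c g))\<close> with \<open>c = g x\<close> moves any
  value to \<open>0\<close>, where the power series of the arctangent converges.
\<close>

lemma ps_bound_arctan:
  fixes g :: "real \<Rightarrow> real"
  assumes g: "ps_bound x r g w"
  obtains s u where "0 < s" "s \<le> r" "ps_bound x s (\<lambda>t. arctan (g t)) u"
proof -
  define c where "c = g x"
  have r: "0 < r" using ps_bound_radius[OF g] .
  have den: "ps_bound x r (\<lambda>t. 1 + c * g t) (norm (1::real) + norm c * w)"
    by (intro ps_bound_add ps_bound_mult ps_bound_const g r)
  have pos: "1 + c * c > 0" by (simp add: add_pos_nonneg)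
  hence "1 + c * g x \<noteq> 0" by (simp add: c_def)
  then obtain s u where s: "0 < s" "s \<le> r" "ps_bound x s (\<lambda>t. 1 / (1 + c * g t)) u"
    using ps_bound_inverse[OF den] by metis
  let ?h = "\<lambda>t. (g t - c) * (1 / (1 + c * g t))"
  have gs: "ps_bound x s g w" using ps_bound_shrink[OF g s(1,2)] .
  have "ps_bound x s ?h (2 * w * u)"
    using ps_bound_mult[OF ps_bound_diff_const[OF gs] s(3)] by (simp add: c_def)
  then obtain s' where s': "0 < s'" "s' \<le> s" "ps_bound x s' ?h (1 / 2)"
    using ps_bound_vanishing[of x s ?h _ "1/2"] by (auto simp: c_def)
  let ?k = "\<lambda>t. c * (g t - c)"
  have "ps_bound x s ?k (norm c * (2 * w))"
    using ps_bound_mult[OF ps_bound_const[OF s(1), of x c] ps_bound_diff_const[OF gs]]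
    by (simp add: c_def)
  then obtain s'' where s'': "0 < s''" "s'' \<le> s" "ps_bound x s'' ?k (1 / 2)"
    using ps_bound_vanishing[of x s ?k _ "1/2"] by (auto simp: c_def)
  define v where "v = min s' s''"
  have v: "0 < v" "v \<le> r" "v \<le> s'" "v \<le> s''" using s s' s'' by (auto simp: v_def)
  have "ps_bound x v ?h (1 / 2)" using ps_bound_shrink[OF s'(3) v(1,3)] .
  from ps_bound_add[OF ps_bound_const[OF v(1), of x "arctan c"] ps_bound_arctan_small[OF this]]
  have "ps_bound x v (\<lambda>t. arctan (g t)) (norm (arctan c) + 1 / (1 - 1 / 2))"
  proof (rule ps_bound_cong)
    fix t assume t: "\<bar>t - x\<bar> \<le> v"
    have h: "\<bar>?h t\<bar> \<le> 1 / 2" using ps_bound_norm[OF s'(3), of t] t v by simp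
    have k: "\<bar>?k t\<bar> \<le> 1 / 2" using ps_bound_norm[OF s''(3), of t] t v by simp
    have "1 + c * g t = (1 + c * c) + ?k t" by (simp add: algebra_simps)
    moreover have "0 \<le> c * c" by simp
    ultimately have D: "1 + c * g t > 0" using k unfolding abs_le_iff by linarith
    define z where "z = ?h t"
    have zD: "z * (1 + c * g t) = g t - c" using D by (simp add: z_def)
    have E: "1 - c * z = (1 + c * c) / (1 + c * g t)"
      using D by (simp add: z_def field_simps)
    \<comment> \<open>The tangent of the sum is \<open>g t\<close>, and the sum lies in the range of the arctangent since its cosine is positive.\<close>
    have sqp: "1 + c\<^sup>2 \<noteq> 0" "1 + z\<^sup>2 \<noteq> 0"
      using zero_le_power2[of c] zero_le_power2[of z] by linarith+
    have "tan (arctan c + arctan z) = g t"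
    proof -
      have "1 - c * z > 0" unfolding E using D pos by simp
      hence "cos (arctan c + arctan z) \<noteq> 0"
        using sqp by (simp add: cos_add cos_arctan sin_arctan divide_simps)
      hence "tan (arctan c + arctan z) = (c + z) / (1 - c * z)"
        by (subst tan_add) (auto simp: tan_arctan)
      also have "\<dots> = g t"
        using \<open>1 - c * z > 0\<close> zD by (simp add: field_simps)
      finally show ?thesis .
    qed
    moreover have "\<bar>arctan c + arctan z\<bar> < pi / 2"
    proof (rule ccontr)
      assume "\<not> ?thesis"
      moreover have "\<bar>arctan z\<bar> < pi / 2" "\<bar>arctan c\<bar> < pi / 2"
        using arctan_bounded[of z] arctan_bounded[of c] by (auto simp: abs_less_iff)
      moreover have "cos (arctan c + arctan z) > 0"
      proof -
        have "1 - c * z > 0" unfolding E using D pos by simp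
        moreover have "cos (arctan c + arctan z) = (1 - c * z) / (sqrt (1 + c\<^sup>2) * sqrt (1 + z\<^sup>2))"
          by (simp add: cos_add cos_arctan sin_arctan diff_divide_distrib)
        moreover have "sqrt (1 + c\<^sup>2) * sqrt (1 + z\<^sup>2) > 0" by (simp add: add_pos_nonneg)
        ultimately show ?thesis by simp
      qed
      moreover have "\<bar>arctan c + arctan z\<bar> \<le> pi"
        using calculation abs_triangle_ineq[of "arctan c" "arctan z"] by linarith
      ultimately have "cos \<bar>arctan c + arctan z\<bar> \<le> 0"
        using cos_monotone_0_pi_le[of "pi / 2" "\<bar>arctan c + arctan z\<bar>"] by simp
      with \<open>cos (arctan c + arctan z) > 0\<close> show False by simp
    qed
    ultimately have "arctan (g t) = arctan c + arctan z"
      unfolding abs_less_iff by (intro arctan_unique) linarith+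
    thus "arctan (g t) = arctan c + arctan (?h t)" by (simp add: z_def)
  qed simp_all
  with v that show ?thesis by blast
qed

text \<open>
  A series that converges at one point converges absolutely on every smaller disc.
\<close>

lemma real_analytic_on_iff:
  "f real_analytic_on G \<longleftrightarrow> (\<forall>x\<in>G. \<exists>r w. ps_bound x r f w)"
proof (intro iffI ballI)
  fix x assume "f real_analytic_on G" "x \<in> G"
  then obtain c where "\<forall>\<^sub>F t in nhds x. (\<lambda>i. (t - x) ^ i *\<^sub>R c i) sums f t"
    unfolding real_analytic_on_def by blast
  then obtain e where e: "0 < e" "\<And>t. dist t x < e \<Longrightarrow> (\<lambda>i. (t - x) ^ i *\<^sub>R c i) sums f t"
    unfolding eventually_nhds_metric by blast
  \<comment> \<open>At distance \<open>s\<close> the terms are bounded, so at distance \<open>r = s / 2\<close> they are dominated by a geometric series.\<close>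
  define s r where "s = e / 2" and "r = e / 4"
  have sr: "0 < r" "s = 2 * r" "s < e" using e by (auto simp: s_def r_def)
  have "(\<lambda>i. s ^ i *\<^sub>R c i) sums f (x + s)"
    using e(2)[of "x + s"] sr by (simp add: dist_norm)
  hence "(\<lambda>i. s ^ i *\<^sub>R c i) \<longlonglongrightarrow> 0" by (intro summable_LIMSEQ_zero sums_summable)
  then obtain K where K: "\<And>i. norm (s ^ i *\<^sub>R c i) \<le> K"
    using convergent_imp_Bseq convergentI BseqE by metis
  have K0: "0 \<le> K" using K[of 0] norm_ge_zero order_trans by blast
  have l1: "l1_le (\<lambda>i. r ^ i *\<^sub>R c i) (K * (1 / (1 - 1 / 2)))"
  proof (rule l1_le_scale[OF l1_le_geometric])
    fix i
    have "norm (r ^ i *\<^sub>R c i) = norm (s ^ i *\<^sub>R c i) * (1 / 2) ^ i"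
      using sr by (simp add: power_mult_distrib power_divide)
    also have "\<dots> \<le> K * (1 / 2) ^ i" by (intro mult_right_mono K) auto
    finally show "norm (r ^ i *\<^sub>R c i) \<le> K * norm ((1 / 2 :: real) ^ i)" by simp
  qed (use K0 in auto)
  have "ps_bound x r f (K * (1 / (1 - 1 / 2)))"
  proof (rule ps_boundI[OF sr(1) l1])
    fix t assume t: "\<bar>t - x\<bar> \<le> r"
    hence "dist t x < e" using sr by (simp add: dist_norm)
    from sums_unique2[OF e(2)[OF this] l1_le_sums(1)[OF l1_le_smaller_radius[OF l1 t]]]
    show "f t = (\<Sum>\<^sub>\<infinity>m. (t - x) ^ m *\<^sub>R c m)" .
  qed
  thus "\<exists>r w. ps_bound x r f w" by blast
next
  assume P: "\<forall>x\<in>G. \<exists>r w. ps_bound x r f w"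
  show "f real_analytic_on G" unfolding real_analytic_on_def
  proof
    fix x assume "x \<in> G"
    then obtain r w c where c: "0 < r" "l1_le (\<lambda>m. r ^ m *\<^sub>R c m) w"
      "\<And>t. \<bar>t - x\<bar> \<le> r \<Longrightarrow> f t = (\<Sum>\<^sub>\<infinity>m. (t - x) ^ m *\<^sub>R c m)"
      using P ps_boundE by metis
    have "(\<lambda>i. (t - x) ^ i *\<^sub>R c i) sums f t" if "dist t x < r" for t
      using l1_le_sums(1)[OF l1_le_smaller_radius[OF c(2), of "t - x"]] c(3)[of t] that
      by (simp add: dist_norm)
    thus "\<exists>c. \<forall>\<^sub>F t in nhds x. (\<lambda>i. (t - x) ^ i *\<^sub>R c i) sums f t"
      unfolding eventually_nhds_metric using c(1) by blast
  qed
qed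

section \<open>Separating the two sides of a point analytically\<close>

text \<open>
  The function \<open>arctan\<close> has the required property that its expansions in \<open>1 / v\<close> at both ends of the real line
  differ only by the constant \<open>pi\<close>. Hence one polynomial correction serves on both sides.
\<close>

definition smooth_step :: "real \<Rightarrow> real \<Rightarrow> real" where
  "smooth_step \<eta> v = 1 / 2 + arctan (v / \<eta>) / pi"

text \<open>
  An analytic substitute for the function that is \<open>v ^ k\<close> for \<open>v \<ge> 0\<close> and \<open>0\<close> for \<open>v < 0\<close>. The polynomial removes
  the nonnegative powers of \<open>v\<close> from the expansion of the difference at infinity.
\<close>

definition smooth_cut :: "real \<Rightarrow> nat \<Rightarrow> real \<Rightarrow> real" where
  "smooth_cut \<eta> k v = v ^ k * smooth_step \<eta> v + (\<Sum>n\<le>k. arctan_coeff n / pi * \<eta> ^ n * v ^ (k - n))"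

definition cut_error :: "real \<Rightarrow> nat \<Rightarrow> real \<Rightarrow> real" where
  "cut_error \<eta> k v = smooth_cut \<eta> k v - (if 0 \<le> v then v ^ k else 0)"

lemma arctan_coeff_pi_bound: "\<bar>arctan_coeff n / pi\<bar> \<le> 1"
proof -
  have "\<bar>arctan_coeff n\<bar> \<le> pi" using arctan_coeff_bound[of n] pi_gt3 by linarith
  thus ?thesis by (simp add: abs_mult divide_simps)
qed

lemma arctan_coeff_pi_mult_bound:
  assumes "0 \<le> \<eta>"
  shows "norm (arctan_coeff n / pi * \<eta> ^ n) \<le> \<eta> ^ n"
proof -
  have "\<bar>arctan_coeff n / pi\<bar> * \<eta> ^ n \<le> 1 * \<eta> ^ n"
    by (rule mult_right_mono[OF arctan_coeff_pi_bound]) (use assms in simp)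
  thus ?thesis using assms by (simp add: abs_mult)
qed

lemma smooth_step_range: "0 \<le> smooth_step \<eta> v" "smooth_step \<eta> v \<le> 1"
  using arctan_bounded[of "v / \<eta>"] by (auto simp: smooth_step_def field_simps)

text \<open>
  For \<open>\<bar>v\<bar> > \<eta>\<close> only negative powers of \<open>v\<close> remain, with coefficients that are small for small \<open>\<eta>\<close>. The sum
  starts at \<open>(1 / v) ^ 1\<close>, so that the error decays even for high powers of \<open>v\<close>.
\<close>

lemma cut_error_far:
  assumes "0 < \<eta>" "\<eta> < \<bar>v\<bar>"
  shows "cut_error \<eta> k v = (\<Sum>\<^sub>\<infinity>i. (- arctan_coeff (i + k + 1) / pi * \<eta> ^ (i + k + 1)) * (1 / v) ^ (i + 1))"
proof -
  define z where "z = \<eta> / v"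
  have v: "v \<noteq> 0" using assms by auto
  have z: "\<bar>z\<bar> < 1" using assms by (simp add: z_def)
  have l1: "l1_le (\<lambda>n. arctan_coeff n * z ^ n) (1 / (1 - \<bar>z\<bar>))" by (rule arctan_series_l1(1)[OF z])
  have "smooth_step \<eta> v - (if 0 \<le> v then 1 else 0) = - arctan z / pi"
  proof -
    have "z \<noteq> 0" "1 / z = v / \<eta>" "sgn z = sgn v"
      using assms(1) v by (auto simp: z_def sgn_if divide_simps)
    hence "arctan (v / \<eta>) = sgn v * pi / 2 - arctan z" using Transcendental.arctan_inverse[of z] by metis
    thus ?thesis using v by (cases "0 < v") (simp_all add: smooth_step_def diff_divide_distrib)
  qed
  hence st: "smooth_step \<eta> v = (if 0 \<le> v then 1 else 0) - arctan z / pi" by simp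
  have fin: "(\<Sum>n\<le>k. arctan_coeff n / pi * \<eta> ^ n * v ^ (k - n)) = v ^ k * (\<Sum>n\<le>k. arctan_coeff n * z ^ n) / pi"
    unfolding sum_distrib_left sum_divide_distrib using v
    by (intro sum.cong) (auto simp: z_def power_diff power_divide ac_simps)
  have split: "arctan z = (\<Sum>n\<le>k. arctan_coeff n * z ^ n) + (\<Sum>\<^sub>\<infinity>i. arctan_coeff (i + k + 1) * z ^ (i + k + 1))"
  proof -
    have "arctan z = (\<Sum>n. arctan_coeff n * z ^ n)"
      using arctan_series_l1(2)[OF z] l1_le_sums(1)[OF l1] by (simp add: sums_iff)
    also have "\<dots> = (\<Sum>i. arctan_coeff (i + (k + 1)) * z ^ (i + (k + 1))) + (\<Sum>n<k + 1. arctan_coeff n * z ^ n)"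
      using l1_le_sums(1)[OF l1] by (intro suminf_split_initial_segment sums_summable)
    also have "(\<Sum>i. arctan_coeff (i + (k + 1)) * z ^ (i + (k + 1))) = (\<Sum>\<^sub>\<infinity>i. arctan_coeff (i + k + 1) * z ^ (i + k + 1))"
      using l1_le_sums(1)[OF l1_le_reindex[OF l1, of "\<lambda>i. i + k + 1"]]
      by (simp add: inj_def sums_iff add.assoc)
    finally show ?thesis by (simp add: lessThan_Suc_atMost add.commute)
  qed
  have "cut_error \<eta> k v = - (v ^ k / pi) * (\<Sum>\<^sub>\<infinity>i. arctan_coeff (i + k + 1) * z ^ (i + k + 1))"
    unfolding cut_error_def smooth_cut_def fin st split by (simp add: field_simps)
  also have "\<dots> = (\<Sum>\<^sub>\<infinity>i. - (v ^ k / pi) * (arctan_coeff (i + k + 1) * z ^ (i + k + 1)))"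
    by (rule infsum_bounded_linear_l1[OF bounded_linear_mult_right l1_le_reindex[OF l1]])
       (simp add: inj_def)
  also have "\<dots> = (\<Sum>\<^sub>\<infinity>i. (- arctan_coeff (i + k + 1) / pi * \<eta> ^ (i + k + 1)) * (1 / v) ^ (i + 1))"
    using v by (intro infsum_cong) (simp add: z_def power_divide power_add field_simps)
  finally show ?thesis .
qed

lemma ps_bound_cut_error:
  assumes "0 < \<eta>" "0 < D" "0 < r" "2 * \<eta> \<le> D" "r + D \<le> \<bar>x - y\<bar>"
  shows "ps_bound x r (\<lambda>t. cut_error \<eta> k (t - y)) (\<eta> ^ k * (2 * \<eta> / D))"
proof -
  let ?g = "\<lambda>i t. (- arctan_coeff (i + k + 1) / pi * \<eta> ^ (i + k + 1)) * (1 / (t - y)) ^ (i + 1)"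
  have inv: "ps_bound x r (\<lambda>t. 1 / (t - y)) (1 / D)"
    by (rule ps_bound_mono[OF ps_bound_inverse_shift]) (use assms in \<open>auto intro: divide_left_mono\<close>)
  have g: "ps_bound x r (?g i) (\<eta> ^ k * ((\<eta> / D) * (1 / 2) ^ i))" for i
  proof (rule ps_bound_mono[OF ps_bound_mult[OF ps_bound_const[OF assms(3)] ps_bound_power[OF inv]]])
    have "norm (- arctan_coeff (i + k + 1) / pi * \<eta> ^ (i + k + 1)) \<le> 1 * \<eta> ^ (i + k + 1)"
      using arctan_coeff_pi_mult_bound[of \<eta> "i + k + 1"] assms(1) by simp
    hence "norm (- arctan_coeff (i + k + 1) / pi * \<eta> ^ (i + k + 1)) * (1 / D) ^ (i + 1)
      \<le> 1 * \<eta> ^ (i + k + 1) * (1 / D) ^ (i + 1)"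
      using assms by (intro mult_right_mono) auto
    also have "\<dots> = \<eta> ^ k * ((\<eta> / D) * (\<eta> / D) ^ i)"
      by (simp add: power_add power_divide)
    also have "\<dots> \<le> \<eta> ^ k * ((\<eta> / D) * (1 / 2) ^ i)"
      using assms by (intro mult_left_mono power_mono) (auto simp: field_simps)
    finally show "norm (- arctan_coeff (i + k + 1) / pi * \<eta> ^ (i + k + 1)) * (1 / D) ^ (i + 1)
      \<le> \<eta> ^ k * ((\<eta> / D) * (1 / 2) ^ i)" .
  qed
  have "l1_le (\<lambda>i. \<eta> ^ k * ((\<eta> / D) * (1 / 2) ^ i)) ((\<eta> ^ k * (\<eta> / D)) * (1 / (1 - 1 / 2)))"
    by (rule l1_le_scale[OF l1_le_geometric]) (use assms in \<open>auto simp: abs_mult\<close>)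
  from ps_bound_infsum(1)[OF g this] show ?thesis
  proof (rule ps_bound_cong)
    fix t assume t: "\<bar>t - x\<bar> \<le> r"
    have "\<eta> < \<bar>t - y\<bar>" using t assms by linarith
    from cut_error_far[OF assms(1) this]
    show "cut_error \<eta> k (t - y) = (\<Sum>\<^sub>\<infinity>i. ?g i t)" .
  qed (simp add: field_simps)
qed

lemma cut_error_small:
  assumes "0 < \<eta>" "2 * \<eta> < \<bar>v\<bar>"
  shows "\<bar>cut_error \<eta> k v\<bar> \<le> 2 * \<eta> ^ k * (2 * \<eta> / \<bar>v\<bar>)"
proof -
  have "\<bar>cut_error \<eta> k v\<bar> \<le> \<eta> ^ k * (2 * \<eta> / D)" if "0 < D" "2 * \<eta> \<le> D" "D < \<bar>v\<bar>" for D
    using ps_bound_norm[OF ps_bound_cut_error[of \<eta> D "\<bar>v\<bar> - D" v 0 k], of v] that assms by simp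
  hence *: "\<bar>cut_error \<eta> k v\<bar> \<le> \<eta> ^ k * (2 * \<eta> / D)" if "max (2 * \<eta>) (\<bar>v\<bar> / 2) \<le> D" "D < \<bar>v\<bar>" for D
    using that assms by simp
  have "\<bar>cut_error \<eta> k v\<bar> \<le> \<eta> ^ k * (2 * \<eta> / max (2 * \<eta>) (\<bar>v\<bar> / 2))"
    using assms by (intro *) auto
  also have "\<dots> \<le> \<eta> ^ k * (2 * \<eta> / (\<bar>v\<bar> / 2))"
    using assms by (intro mult_left_mono divide_left_mono) auto
  also have "\<dots> = 2 * \<eta> ^ k * (2 * \<eta> / \<bar>v\<bar>)" by simp
  finally show ?thesis .
qed

lemma smooth_step_analytic:
  assumes "0 < r"
  obtains s u where "0 < s" "s \<le> r" "1 \<le> u" "ps_bound x s (\<lambda>t. smooth_step \<eta> (t - y)) u"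
proof -
  have "ps_bound x r (\<lambda>t. (1 / \<eta>) * (t - y)) (norm (1 / \<eta>) * (r + \<bar>x - y\<bar>))"
    by (intro ps_bound_mult ps_bound_const ps_bound_ident assms)
  then obtain s u where s: "0 < s" "s \<le> r" "ps_bound x s (\<lambda>t. arctan ((1 / \<eta>) * (t - y))) u"
    using ps_bound_arctan by metis
  have "ps_bound x s (\<lambda>t. 1 / 2 + (1 / pi) * arctan ((1 / \<eta>) * (t - y))) (norm (1/2::real) + norm (1 / pi) * u)"
    by (intro ps_bound_add ps_bound_mult ps_bound_const s)
  hence "ps_bound x s (\<lambda>t. smooth_step \<eta> (t - y)) (max 1 (norm (1/2::real) + norm (1 / pi) * u))"
    by (rule ps_bound_cong) (auto simp: smooth_step_def)
  with s that[of s] show ?thesis by (meson max.cobounded1)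
qed

lemma sum_power_ratio_le:
  fixes \<eta> \<sigma> :: real
  assumes "0 \<le> \<eta>" "2 * \<eta> \<le> \<sigma>"
  shows "(\<Sum>n\<le>k. \<eta> ^ n * \<sigma> ^ (k - n)) \<le> 2 * \<sigma> ^ k"
proof -
  have "(\<Sum>n\<le>k. \<eta> ^ n * \<sigma> ^ (k - n)) \<le> (\<Sum>n\<le>k. \<sigma> ^ k * (1 / 2) ^ n)"
  proof (rule sum_mono)
    fix n assume "n \<in> {..k}"
    hence n: "n \<le> k" by simp
    have "\<eta> ^ n * \<sigma> ^ (k - n) \<le> (\<sigma> / 2) ^ n * \<sigma> ^ (k - n)"
      using assms by (intro mult_right_mono power_mono) auto
    also have "\<dots> = \<sigma> ^ (n + (k - n)) * (1 / 2) ^ n" by (simp add: power_divide power_add)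
    finally show "\<eta> ^ n * \<sigma> ^ (k - n) \<le> \<sigma> ^ k * (1 / 2) ^ n" using n by simp
  qed
  also have "\<dots> = \<sigma> ^ k * (\<Sum>n\<le>k. (1 / 2) ^ n)" by (simp add: sum_distrib_left)
  also have "\<dots> \<le> \<sigma> ^ k * 2"
  proof (intro mult_left_mono)
    have "(\<Sum>n\<le>k. (1 / 2 :: real) ^ n) \<le> (\<Sum>n. (1 / 2) ^ n)"
      by (intro sum_le_suminf summable_geometric) auto
    thus "(\<Sum>n\<le>k. (1 / 2 :: real) ^ n) \<le> 2" by (simp add: suminf_geometric)
  qed (use assms in auto)
  finally show ?thesis by simp
qed

text \<open>
  Close to the cut the step contributes a factor \<open>u\<close> that is independent of \<open>k\<close>, while the growth in \<open>k\<close> is that of the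
  monomial itself on the interval in question.
\<close>

lemma ps_bound_smooth_cut:
  assumes S: "ps_bound x r (\<lambda>t. smooth_step \<eta> (t - y)) u"
    and "0 < \<eta>" "2 * \<eta> \<le> \<sigma>" "r + \<bar>x - y\<bar> \<le> \<sigma>"
  shows "ps_bound x r (\<lambda>t. smooth_cut \<eta> k (t - y)) ((u + 2) * \<sigma> ^ k)"
proof -
  have r: "0 < r" using ps_bound_radius[OF S] .
  have u: "0 \<le> u" using ps_bound_nonneg[OF S] .
  have id: "ps_bound x r (\<lambda>t. t - y) \<sigma>" by (rule ps_bound_mono[OF ps_bound_ident[OF r] assms(4)])
  have "ps_bound x r (\<lambda>t. smooth_cut \<eta> k (t - y))
     (\<sigma> ^ k * u + (\<Sum>n\<le>k. norm (arctan_coeff n / pi * \<eta> ^ n) * \<sigma> ^ (k - n)))"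
    unfolding smooth_cut_def
    by (intro ps_bound_add ps_bound_mult ps_bound_power id S ps_bound_sum ps_bound_const r) auto
  thus ?thesis
  proof (rule ps_bound_mono)
    have "(\<Sum>n\<le>k. norm (arctan_coeff n / pi * \<eta> ^ n) * \<sigma> ^ (k - n)) \<le> (\<Sum>n\<le>k. \<eta> ^ n * \<sigma> ^ (k - n))"
      using assms by (intro sum_mono mult_right_mono arctan_coeff_pi_mult_bound) auto
    also have "\<dots> \<le> 2 * \<sigma> ^ k" using sum_power_ratio_le[of \<eta> \<sigma> k] assms by simp
    finally show "\<sigma> ^ k * u + (\<Sum>n\<le>k. norm (arctan_coeff n / pi * \<eta> ^ n) * \<sigma> ^ (k - n)) \<le> (u + 2) * \<sigma> ^ k"
      by (simp add: algebra_simps)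
  qed
qed

lemma smooth_cut_bound:
  assumes "0 < \<eta>" "2 * \<eta> \<le> \<sigma>" "\<bar>v\<bar> \<le> \<sigma>"
  shows "\<bar>smooth_cut \<eta> k v\<bar> \<le> 3 * \<sigma> ^ k"
proof -
  have "\<bar>v ^ k * smooth_step \<eta> v\<bar> \<le> \<sigma> ^ k * 1"
    unfolding abs_mult power_abs using assms smooth_step_range[of \<eta> v] by (intro mult_mono power_mono) auto
  moreover have "\<bar>\<Sum>n\<le>k. arctan_coeff n / pi * \<eta> ^ n * v ^ (k - n)\<bar> \<le> 2 * \<sigma> ^ k"
  proof -
    have "\<bar>\<Sum>n\<le>k. arctan_coeff n / pi * \<eta> ^ n * v ^ (k - n)\<bar>
      \<le> (\<Sum>n\<le>k. \<bar>arctan_coeff n / pi\<bar> * \<bar>\<eta>\<bar> ^ n * \<bar>v\<bar> ^ (k - n))"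
      by (rule order_trans[OF sum_abs]) (simp add: abs_mult power_abs)
    also have "\<dots> \<le> (\<Sum>n\<le>k. 1 * \<eta> ^ n * \<sigma> ^ (k - n))"
      using assms arctan_coeff_pi_bound by (intro sum_mono mult_mono power_mono) auto
    also have "\<dots> \<le> 2 * \<sigma> ^ k" using sum_power_ratio_le[of \<eta> \<sigma> k] assms by simp
    finally show ?thesis .
  qed
  ultimately show ?thesis unfolding smooth_cut_def by linarith
qed

lemma cut_error_bound:
  assumes "0 < \<eta>"
  shows "\<bar>cut_error \<eta> k v\<bar> \<le> 4 * (2 * \<eta>) ^ k"
proof (cases "\<bar>v\<bar> \<le> 2 * \<eta>")
  case True
  have "\<bar>smooth_cut \<eta> k v\<bar> \<le> 3 * (2 * \<eta>) ^ k" by (rule smooth_cut_bound) (use assms True in auto)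
  moreover have "\<bar>if 0 \<le> v then v ^ k else 0\<bar> \<le> (2 * \<eta>) ^ k"
    using True assms power_mono[of v "2 * \<eta>" k] by auto
  ultimately show ?thesis unfolding cut_error_def by linarith
next
  case False
  hence "2 * \<eta> < \<bar>v\<bar>" by simp
  from cut_error_small[OF assms this, of k]
  have "\<bar>cut_error \<eta> k v\<bar> \<le> 2 * \<eta> ^ k * (2 * \<eta> / \<bar>v\<bar>)" .
  also have "\<dots> \<le> 2 * \<eta> ^ k * 1" using assms False by (intro mult_left_mono) auto
  also have "\<dots> \<le> 4 * (2 * \<eta>) ^ k"
    using assms power_mono[of \<eta> "2 * \<eta>" k] zero_le_power[of "2 * \<eta>" k] by linarith
  finally show ?thesis .
qed

section \<open>Cells subordinate to a local property\<close>

text \<open>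
  Steps proportional to a Lipschitz function that is positive on \<open>G\<close> cannot accumulate inside \<open>G\<close>, since there
  the step lengths stay away from \<open>0\<close>.
\<close>

lemma walk:
  fixes \<delta> :: "real \<Rightarrow> real"
  assumes x0: "x0 \<in> G"
    and interval: "\<And>a b t. a \<in> G \<Longrightarrow> b \<in> G \<Longrightarrow> a \<le> t \<Longrightarrow> t \<le> b \<Longrightarrow> t \<in> G"
    and pos: "\<And>x. x \<in> G \<Longrightarrow> 0 < \<delta> x"
    and inG: "\<And>x t. x \<in> G \<Longrightarrow> \<bar>t - x\<bar> \<le> \<delta> x \<Longrightarrow> t \<in> G"
    and lip: "\<And>x t. x \<in> G \<Longrightarrow> t \<in> G \<Longrightarrow> \<delta> x \<le> \<delta> t + \<bar>x - t\<bar>"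
  obtains u :: "nat \<Rightarrow> real" where "u 0 = x0" "\<And>n. u n \<in> G"
    "\<And>n. u (Suc n) = u n + \<delta> (u n) / 32" "\<And>x. x \<in> G \<Longrightarrow> \<exists>n. x < u n"
proof -
  define u where "u = rec_nat x0 (\<lambda>_ t. t + \<delta> t / 32)"
  have u0: "u 0 = x0" and uS: "\<And>n. u (Suc n) = u n + \<delta> (u n) / 32" by (simp_all add: u_def)
  have uG: "u n \<in> G" for n
  proof (induction n)
    case (Suc n)
    have "\<bar>u (Suc n) - u n\<bar> \<le> \<delta> (u n)" using pos[OF Suc] by (simp add: uS)
    thus ?case by (rule inG[OF Suc])
  qed (simp add: u0 x0)
  have "\<exists>n. x < u n" if x: "x \<in> G" for x
  proof (rule ccontr)
    assume "\<not> ?thesis"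
    hence le: "\<And>n. u n \<le> x" by (auto simp: not_less)
    hence bdd: "bdd_above (range u)" by (auto simp: bdd_above_def)
    define L where "L = Sup (range u)"
    have uL: "u n \<le> L" for n unfolding L_def by (rule cSup_upper[OF _ bdd]) auto
    have "L \<le> x" unfolding L_def by (rule cSup_least) (use le in auto)
    moreover have "x0 \<le> L" using uL[of 0] u0 by simp
    ultimately have LG: "L \<in> G" using interval x0 x by blast
    have d: "0 < \<delta> L" by (rule pos[OF LG])
    hence "L - \<delta> L / 100 < Sup (range u)" unfolding L_def[symmetric] by simp
    then obtain n where n: "L - \<delta> L / 100 < u n" by (rule less_cSupE) auto
    have "\<delta> L \<le> \<delta> (u n) + \<bar>L - u n\<bar>" by (rule lip[OF LG uG])
    \<comment> \<open>The step from \<open>u n\<close> is almost \<open>\<delta> L / 32\<close>, more than the remaining distance to \<open>L\<close>.\<close>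
    hence "u (Suc n) > L" using n uL[of n] d by (simp add: uS abs_if split: if_splits)
    thus False using uL[of "Suc n"] by simp
  qed
  from that[OF u0 uG uS this] show thesis .
qed

text \<open>
  The largest radius for which \<open>P\<close> holds is a Lipschitz function of the centre because \<open>P\<close> is
  inherited by smaller intervals. Hence neighbouring cells have comparable lengths, and a cell together
  with its two neighbours fits into the interval that belongs to its left end point.
\<close>

lemma subordinate_cells:
  fixes P :: "real \<Rightarrow> real \<Rightarrow> bool"
  assumes conn: "connected G" and ne: "G \<noteq> {}"
    and hered: "\<And>x r y s. P x r \<Longrightarrow> \<bar>y - x\<bar> + s \<le> r \<Longrightarrow> 0 < s \<Longrightarrow> P y s"
    and loc: "\<And>x. x \<in> G \<Longrightarrow> \<exists>r>0. P x r"
    and inG: "\<And>x r t. P x r \<Longrightarrow> \<bar>t - x\<bar> \<le> r \<Longrightarrow> t \<in> G"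
  obtains y \<rho> :: "int \<Rightarrow> real" where "\<And>j. y j < y (j + 1)" "\<And>j. 0 < \<rho> j" "\<And>j. P (y j) (\<rho> j)"
    "\<And>j. y (j + 2) \<le> y j + \<rho> j / 8" "\<And>j. y j \<le> y (j - 1) + \<rho> j / 8"
    "\<And>x. x \<in> G \<Longrightarrow> \<exists>j. y j \<le> x \<and> x < y (j + 1)"
proof -
  define A where "A x = {r. 0 < r \<and> r \<le> 1 \<and> P x r}" for x
  \<comment> \<open>Half of the supremum is a radius for which \<open>P\<close> holds.\<close>
  define \<delta> where "\<delta> x = Sup (A x) / 2" for x
  have bdd: "bdd_above (A x)" for x by (auto simp: A_def bdd_above_def)
  have A_ne: "A x \<noteq> {}" if "x \<in> G" for x
  proof -
    obtain r where r: "0 < r" "P x r" using loc[OF \<open>x \<in> G\<close>] by blast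
    have "P x (min r 1)" by (rule hered[OF r(2)]) (use r in auto)
    hence "min r 1 \<in> A x" using r by (simp add: A_def)
    thus ?thesis by blast
  qed
  have pos: "0 < \<delta> x" if "x \<in> G" for x
  proof -
    obtain r where "r \<in> A x" using A_ne[OF \<open>x \<in> G\<close>] by blast
    moreover from this have "r \<le> Sup (A x)" by (rule cSup_upper[OF _ bdd])
    ultimately show ?thesis by (simp add: \<delta>_def A_def)
  qed
  have P: "P x (\<delta> x)" if "x \<in> G" for x
  proof -
    have "\<delta> x < Sup (A x)" using pos[OF that] by (simp add: \<delta>_def)
    then obtain r where "r \<in> A x" "\<delta> x < r" by (rule less_cSupE[OF _ A_ne[OF \<open>x \<in> G\<close>]])
    thus ?thesis using hered[of x r x "\<delta> x"] pos[OF that] by (simp add: A_def)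
  qed
  have lip: "\<delta> x \<le> \<delta> t + \<bar>x - t\<bar>" if "x \<in> G" "t \<in> G" for x t
  proof -
    have "Sup (A x) \<le> Sup (A t) + \<bar>x - t\<bar>"
    proof (rule cSup_least[OF A_ne[OF that(1)]])
      fix r assume r: "r \<in> A x"
      show "r \<le> Sup (A t) + \<bar>x - t\<bar>"
      proof (cases "r \<le> \<bar>x - t\<bar>")
        case True
        thus ?thesis using pos[OF that(2)] by (simp add: \<delta>_def)
      next
        case False
        hence "r - \<bar>x - t\<bar> \<in> A t"
          using r hered[of x r t "r - \<bar>x - t\<bar>"] by (auto simp: A_def abs_minus_commute)
        from cSup_upper[OF this bdd] show ?thesis by simp
      qed
    qed
    thus ?thesis using abs_ge_zero[of "x - t"] unfolding \<delta>_def by linarith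
  qed
  have ball: "t \<in> G" if "x \<in> G" "\<bar>t - x\<bar> \<le> \<delta> x" for x t using inG[OF P] that by blast
  have interval: "t \<in> G" if "a \<in> G" "b \<in> G" "a \<le> t" "t \<le> b" for a b t
    using connectedD_interval[OF conn that] .
  obtain x0 where x0: "x0 \<in> G" using ne by blast
  obtain u where u: "u 0 = x0" "\<And>n. u n \<in> G" "\<And>n. u (Suc n) = u n + \<delta> (u n) / 32"
    "\<And>x. x \<in> G \<Longrightarrow> \<exists>n. x < u n"
  proof (rule walk[OF x0, of \<delta>])
    show "t \<in> G" if "a \<in> G" "b \<in> G" "a \<le> t" "t \<le> b" for a b t by (rule interval[OF that])
    show "0 < \<delta> x" if "x \<in> G" for x by (rule pos[OF that])
    show "t \<in> G" if "x \<in> G" "\<bar>t - x\<bar> \<le> \<delta> x" for x t by (rule ball[OF that])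
    show "\<delta> x \<le> \<delta> t + \<bar>x - t\<bar>" if "x \<in> G" "t \<in> G" for x t by (rule lip[OF that])
  qed blast
  obtain w where w: "w 0 = - x0" "\<And>n. w n \<in> uminus ` G" "\<And>n. w (Suc n) = w n + \<delta> (- w n) / 32"
    "\<And>x. x \<in> uminus ` G \<Longrightarrow> \<exists>n. x < w n"
  proof (rule walk[of "- x0" "uminus ` G" "\<lambda>x. \<delta> (- x)"])
    show "- x0 \<in> uminus ` G" using x0 by blast
    show "t \<in> uminus ` G" if "a \<in> uminus ` G" "b \<in> uminus ` G" "a \<le> t" "t \<le> b" for a b t
      using interval[of "- b" "- a" "- t"] that by (auto intro: rev_image_eqI[of "- t"])
    show "t \<in> uminus ` G" if "x \<in> uminus ` G" "\<bar>t - x\<bar> \<le> \<delta> (- x)" for x t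
      using ball[of "- x" "- t"] that by (auto simp: abs_minus_commute intro: rev_image_eqI[of "- t"])
    show "\<delta> (- x) \<le> \<delta> (- t) + \<bar>x - t\<bar>" if "x \<in> uminus ` G" "t \<in> uminus ` G" for x t
      using lip[of "- x" "- t"] that by (auto simp: abs_minus_commute)
    show "0 < \<delta> (- x)" if "x \<in> uminus ` G" for x using pos that by auto
  qed blast
  have wG: "- w n \<in> G" for n using w(2)[of n] by auto
  define y where "y j = (if 0 \<le> j then u (nat j) else - w (nat (- j)))" for j :: int
  have yG: "y j \<in> G" for j using u(2) wG by (simp add: y_def)
  have gap: "y (j + 1) - y j = \<delta> (y j) / 32 \<or> y (j + 1) - y j = \<delta> (y (j + 1)) / 32" for j
  proof (cases "0 \<le> j")
    case True
    hence "nat (j + 1) = Suc (nat j)" by simp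
    thus ?thesis using True u(3)[of "nat j"] by (simp add: y_def)
  next
    case False
    define n where "n = nat (- j - 1)"
    have n: "j = - int (Suc n)" using False by (simp add: n_def)
    have "y (j + 1) = - w n" using w(1) u(1) by (cases n) (auto simp: y_def n nat_add_distrib)
    moreover have "y j = - w (Suc n)" by (simp add: y_def n nat_add_distrib)
    ultimately show ?thesis using w(3)[of n] by simp
  qed
  have mono: "y j < y (j + 1)" for j using gap[of j] pos[OF yG, of j] pos[OF yG, of "j + 1"] by auto
  have gl: "y (j + 1) - y j \<le> \<delta> (y j) / 31" for j
    using gap[of j] lip[OF yG yG, of "j + 1" j] mono[of j] pos[OF yG, of j]
    unfolding abs_if by (auto split: if_splits)
  have gr: "y (j + 1) - y j \<le> \<delta> (y (j + 1)) / 31" for j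
    using gap[of j] lip[OF yG yG, of j "j + 1"] mono[of j] pos[OF yG, of "j + 1"]
    unfolding abs_if by (auto split: if_splits)
  show thesis
  proof (rule that[of y "\<lambda>j. \<delta> (y j)"])
    show "y (j + 2) \<le> y j + \<delta> (y j) / 8" for j
    proof -
      have "y (j + 1 + 1) - y (j + 1) \<le> \<delta> (y (j + 1)) / 31" by (rule gl)
      moreover have "\<delta> (y (j + 1)) \<le> \<delta> (y j) + \<bar>y (j + 1) - y j\<bar>" by (rule lip[OF yG yG])
      moreover have "\<bar>y (j + 1) - y j\<bar> \<le> \<delta> (y j) / 31" using gl[of j] mono[of j] by simp
      moreover have "j + 1 + 1 = j + 2" by simp
      ultimately show ?thesis using gl[of j] pos[OF yG, of j] by (simp add: field_simps)
    qed
    show "y j \<le> y (j - 1) + \<delta> (y j) / 8" for j using gr[of "j - 1"] pos[OF yG, of j] by simp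
    fix x assume x: "x \<in> G"
    show "\<exists>j. y j \<le> x \<and> x < y (j + 1)"
    proof (cases "x0 \<le> x")
      case True
      obtain n where n: "x < u n" using u(4)[OF x] by blast
      define N where "N = (LEAST n. x < u n)"
      have N: "x < u N" unfolding N_def using n by (rule LeastI)
      hence "N \<noteq> 0" using u(1) True by (metis not_less)
      then obtain M where M: "N = Suc M" by (cases N) auto
      hence "\<not> x < u M" unfolding N_def by (metis lessI not_less_Least)
      moreover have "nat (int M + 1) = Suc M" by simp
      ultimately have "y (int M) \<le> x \<and> x < y (int M + 1)" using N M by (simp add: y_def)
      thus ?thesis by blast
    next
      case False
      obtain n where n: "- x < w n" using w(4)[of "- x"] x by blast
      define N where "N = (LEAST n. - x \<le> w n)"
      have N: "- x \<le> w N" unfolding N_def by (rule LeastI[of _ n]) (use n in simp)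
      hence "N \<noteq> 0" using w(1) False by (metis neg_le_iff_le)
      then obtain M where M: "N = Suc M" by (cases N) auto
      hence M': "\<not> - x \<le> w M" unfolding N_def by (metis lessI not_less_Least)
      have "y (- int N) = - w N" using M by (simp add: y_def nat_add_distrib)
      moreover have "y (- int N + 1) = - w M"
        using M w(1) u(1) by (cases M) (auto simp: y_def nat_add_distrib)
      ultimately have "y (- int N) \<le> x \<and> x < y (- int N + 1)" using N M' by simp
      thus ?thesis by blast
    qed
  qed (use mono pos P yG in blast)+
qed

section \<open>Gluing local power series\<close>

text \<open>
  The lowest coefficient in which the two series differ would be the limit at \<open>0\<close> of the difference, divided
  by a power of \<open>t\<close>.
\<close>

lemma power_series_unique:
  fixes c d :: "nat \<Rightarrow> 'a::banach"
  assumes "0 < s" "l1_le (\<lambda>m. s ^ m *\<^sub>R c m) u" "l1_le (\<lambda>m. s ^ m *\<^sub>R d m) v"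
    and eq: "\<And>t. \<bar>t\<bar> \<le> s \<Longrightarrow> (\<Sum>\<^sub>\<infinity>m. t ^ m *\<^sub>R c m) = (\<Sum>\<^sub>\<infinity>m. t ^ m *\<^sub>R d m)"
  shows "c = d"
proof
  fix n
  define e where "e m = c m - d m" for m
  have "l1_le (\<lambda>m. s ^ m *\<^sub>R c m - s ^ m *\<^sub>R d m) (u + v)"
    by (rule l1_le_diff[OF assms(2,3)])
  hence e: "l1_le (\<lambda>m. s ^ m *\<^sub>R e m) (u + v)" by (simp add: e_def scaleR_diff_right)
  have e0: "(\<Sum>\<^sub>\<infinity>m. t ^ m *\<^sub>R e m) = 0" if "\<bar>t\<bar> \<le> s" for t
    using infsum_diff_l1[OF l1_le_smaller_radius[OF assms(2) that] l1_le_smaller_radius[OF assms(3) that]]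
      eq[OF that] by (simp add: e_def scaleR_diff_right)
  have "e n = 0"
  proof (induction n rule: less_induct)
    case (less n)
    define g where "g t = (\<Sum>\<^sub>\<infinity>m. t ^ m *\<^sub>R e (m + n))" for t :: real
    have inj: "inj (\<lambda>m. m + n)" by (simp add: inj_def)
    have l1: "l1_le (\<lambda>m. s ^ m *\<^sub>R e (m + n)) (1 / s ^ n * (u + v))"
      by (rule l1_le_scale[OF l1_le_reindex[OF e inj]]) (use assms(1) in \<open>auto simp: power_add\<close>)
    hence ps: "ps_bound 0 s g (1 / s ^ n * (u + v))"
      by (intro ps_boundI[of _ "\<lambda>m. e (m + n)"]) (use assms(1) in \<open>auto simp: g_def\<close>)
    have g0: "g 0 = e n" unfolding g_def by (subst infsum_single[of 0]) auto
    have gt: "g t = 0" if t: "0 < t" "t \<le> s" for t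
    proof -
      have "(\<Sum>\<^sub>\<infinity>m. t ^ m *\<^sub>R e m) = (\<Sum>\<^sub>\<infinity>m\<in>range (\<lambda>m. m + n). t ^ m *\<^sub>R e m)"
      proof (intro infsum_cong_neutral)
        fix m assume "m \<in> UNIV - range (\<lambda>m. m + n)"
        hence "m < n" by (metis DiffE le_add_diff_inverse2 not_less rangeI)
        thus "t ^ m *\<^sub>R e m = 0" using less by simp
      qed auto
      also have "\<dots> = (\<Sum>\<^sub>\<infinity>m. t ^ n *\<^sub>R (t ^ m *\<^sub>R e (m + n)))"
        by (subst infsum_reindex[OF inj]) (simp add: o_def power_add mult.commute)
      also have "\<dots> = t ^ n *\<^sub>R g t"
        using infsum_bounded_linear_l1[OF bounded_linear_scaleR_right l1_le_smaller_radius[OF l1], of t "t ^ n"] t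
        by (simp add: g_def)
      finally show ?thesis using e0[of t] t by simp
    qed
    have "norm (e n) \<le> x" if "0 < x" for x
    proof -
      obtain \<tau> where \<tau>: "0 < \<tau>" "\<tau> \<le> s" "ps_bound 0 \<tau> (\<lambda>t. g t - g 0) x"
        by (rule ps_bound_vanishing[OF ps_bound_diff_const[OF ps] _ \<open>0 < x\<close>]) simp
      from ps_bound_norm[OF \<tau>(3), of \<tau>] gt[OF \<tau>(1,2)] \<tau>(1) g0 show ?thesis by simp
    qed
    from this[of "norm (e n) / 2"] show "e n = 0" by (cases "e n = 0") auto
  qed
  thus "c n = d n" by (simp add: e_def)
qed

text \<open>
  Some summable family of positive numbers with bounded quotients of neighbours.
\<close>

definition int_weight :: "int \<Rightarrow> real" where
  "int_weight j = (1 / 2) ^ nat \<bar>j\<bar>"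

lemma int_weight_pos: "0 < int_weight j" by (simp add: int_weight_def)

lemma int_weight_le_1: "int_weight j \<le> 1" by (simp add: int_weight_def power_le_one)

lemma int_weight_succ: "int_weight (j + 1) \<le> 2 * int_weight j"
proof -
  have "nat \<bar>j\<bar> \<le> Suc (nat \<bar>j + 1\<bar>)" by auto
  hence "(1 / 2 :: real) ^ Suc (nat \<bar>j + 1\<bar>) \<le> (1 / 2) ^ nat \<bar>j\<bar>" by (intro power_decreasing) auto
  thus ?thesis by (simp add: int_weight_def)
qed

lemma int_weight_l1: "l1_le int_weight 4"
  unfolding l1_le_def
proof (intro allI impI)
  fix F :: "int set" assume F: "finite F"
  have geo: "(\<Sum>n\<in>A. norm ((1 / 2 :: real) ^ n)) \<le> 2" if "finite A" for A :: "nat set"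
    using l1_le_geometric[of "1/2"] that unfolding l1_le_def by simp
  have "(\<Sum>j\<in>F. norm (int_weight j)) = (\<Sum>j\<in>F \<inter> {0..}. norm (int_weight j)) + (\<Sum>j\<in>F - {0..}. norm (int_weight j))"
    by (rule sum.Int_Diff[OF F])
  also have "(\<Sum>j\<in>F \<inter> {0..}. norm (int_weight j)) = (\<Sum>n\<in>nat ` (F \<inter> {0..}). norm ((1 / 2 :: real) ^ n))"
    by (subst sum.reindex) (auto simp: inj_on_def int_weight_def)
  also have "(\<Sum>j\<in>F - {0..}. norm (int_weight j)) = (\<Sum>n\<in>(\<lambda>j. nat (- j)) ` (F - {0..}). norm ((1 / 2 :: real) ^ n))"
    by (subst sum.reindex) (auto simp: inj_on_def int_weight_def)
  finally show "(\<Sum>j\<in>F. norm (int_weight j)) \<le> 4"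
    using geo[of "nat ` (F \<inter> {0..})"] geo[of "(\<lambda>j. nat (- j)) ` (F - {0..})"] F by simp
qed

lemma ps_bound_binomial_sum:
  assumes g: "\<And>k. ps_bound x r (g k) (B * s ^ k)" and "0 \<le> h" "0 \<le> s" "h + s \<le> R" "0 \<le> B"
  shows "ps_bound x r (\<lambda>t. \<Sum>k\<le>m. real (m choose k) * h ^ (m - k) * g k t) (B * R ^ m)"
proof -
  have r: "0 < r" using ps_bound_radius[OF g] .
  have "ps_bound x r (\<lambda>t. \<Sum>k\<le>m. real (m choose k) * h ^ (m - k) * g k t)
      (\<Sum>k\<le>m. norm (real (m choose k) * h ^ (m - k)) * (B * s ^ k))"
    by (intro ps_bound_sum ps_bound_mult ps_bound_const g r) auto
  thus ?thesis
  proof (rule ps_bound_mono)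
    have "(\<Sum>k\<le>m. norm (real (m choose k) * h ^ (m - k)) * (B * s ^ k)) = B * (s + h) ^ m"
      unfolding binomial_ring sum_distrib_left using assms
      by (intro sum.cong) (auto simp: abs_mult)
    also have "\<dots> \<le> B * R ^ m" using assms by (intro mult_left_mono power_mono) auto
    finally show "(\<Sum>k\<le>m. norm (real (m choose k) * h ^ (m - k)) * (B * s ^ k)) \<le> B * R ^ m" .
  qed
qed

text \<open>
  The intervals \<open>[y j, y (j + 1))\<close> cover \<open>G\<close>, and a power series with centre \<open>y j\<close> and radius \<open>\<rho> j\<close> is valid
  on the cells \<open>j - 1\<close>, \<open>j\<close> and \<open>j + 1\<close>, with room to spare for a recentring at \<open>y (j + 1)\<close>. The numbers \<open>K j\<close> are weights,
  for instance the norms of the series. The widths \<open>\<eta> j\<close> of the smooth cuts are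
  small relative to the adjacent cells and weights; the factor \<open>1000\<close> is a convenient margin.
\<close>

locale cell_system =
  fixes G :: "real set" and y \<rho> \<eta> K :: "int \<Rightarrow> real"
  assumes y_less: "y j < y (j + 1)"
    and rho_pos: "0 < \<rho> j"
    and right: "y (j + 2) \<le> y j + \<rho> j / 8"
    and left: "y j \<le> y (j - 1) + \<rho> j / 8"
    and cover: "x \<in> G \<Longrightarrow> \<exists>j. y j \<le> x \<and> x < y (j + 1)"
    and K_nonneg: "0 \<le> K j"
    and eta_pos: "0 < \<eta> j"
    and eta_right: "1000 * \<eta> j * (1 + K j + K (j - 1)) \<le> int_weight j * (y (j + 1) - y j)"
    and eta_left: "1000 * \<eta> j * (1 + K j + K (j - 1)) \<le> int_weight j * (y j - y (j - 1))"
    and eta_weight: "1000 * \<eta> j * (1 + K j + K (j - 1)) \<le> int_weight j"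
begin

definition \<phi> :: "int \<Rightarrow> nat \<Rightarrow> real \<Rightarrow> real" where
  "\<phi> j m x = smooth_cut (\<eta> j) m (x - y j) -
     (\<Sum>k\<le>m. real (m choose k) * (y (j + 1) - y j) ^ (m - k) * smooth_cut (\<eta> (j + 1)) k (x - y (j + 1)))"

lemma y_mono: "i \<le> j \<Longrightarrow> y i \<le> y j"
proof (induction j rule: int_ge_induct)
  case (step j)
  thus ?case using y_less[of j] by simp
qed simp

lemma eta_K:
  shows "1000 * \<eta> j \<le> y (j + 1) - y j" "1000 * \<eta> j \<le> y j - y (j - 1)"
    and "1000 * (\<eta> j * K j) \<le> int_weight j * (y (j + 1) - y j)"
    and "1000 * (\<eta> j * K j) \<le> int_weight j * (y j - y (j - 1))"
    and "1000 * (\<eta> j * K (j - 1)) \<le> int_weight j * (y (j + 1) - y j)"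
    and "1000 * (\<eta> j * K (j - 1)) \<le> int_weight j * (y j - y (j - 1))"
    and "1000 * (\<eta> j * K j) \<le> int_weight j" "1000 * (\<eta> j * K (j - 1)) \<le> int_weight j"
proof -
  have e: "1000 * \<eta> j * (1 + K j + K (j - 1)) = 1000 * \<eta> j + 1000 * (\<eta> j * K j) + 1000 * (\<eta> j * K (j - 1))"
    by (simp add: algebra_simps)
  have nn: "0 \<le> \<eta> j * K j" "0 \<le> \<eta> j * K (j - 1)" "0 < \<eta> j"
    using K_nonneg eta_pos[of j] by auto
  have le: "1000 * \<eta> j \<le> X \<and> 1000 * (\<eta> j * K j) \<le> X \<and> 1000 * (\<eta> j * K (j - 1)) \<le> X"
    if "1000 * \<eta> j * (1 + K j + K (j - 1)) \<le> X" for X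
    using that nn unfolding e by linarith
  note r = le[OF eta_right] and l = le[OF eta_left] and w = le[OF eta_weight]
  have "int_weight j * (y (j + 1) - y j) \<le> 1 * (y (j + 1) - y j)"
    using int_weight_le_1 y_less[of j] by (intro mult_right_mono) auto
  from order_trans[OF conjunct1[OF r] this] show "1000 * \<eta> j \<le> y (j + 1) - y j" by simp
  have "int_weight j * (y j - y (j - 1)) \<le> 1 * (y j - y (j - 1))"
    using int_weight_le_1 y_less[of "j - 1"] by (intro mult_right_mono) auto
  from order_trans[OF conjunct1[OF l] this] show "1000 * \<eta> j \<le> y j - y (j - 1)" by simp
  show "1000 * (\<eta> j * K j) \<le> int_weight j * (y (j + 1) - y j)"
    "1000 * (\<eta> j * K (j - 1)) \<le> int_weight j * (y (j + 1) - y j)" using r by blast+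
  show "1000 * (\<eta> j * K j) \<le> int_weight j * (y j - y (j - 1))"
    "1000 * (\<eta> j * K (j - 1)) \<le> int_weight j * (y j - y (j - 1))" using l by blast+
  show "1000 * (\<eta> j * K j) \<le> int_weight j" "1000 * (\<eta> j * K (j - 1)) \<le> int_weight j"
    using w by blast+
qed

lemma gap_le: "y (j + 1) - y j \<le> \<rho> j / 8" "y j - y (j - 1) \<le> \<rho> j / 8"
  using right[of j] y_less[of "j + 1"] left[of j] by (simp_all add: add.assoc)

text \<open>
  Up to the errors at the two cuts, \<open>\<phi> j m\<close> is the monomial \<open>(x - y j) ^ m\<close> on cell \<open>j\<close> and \<open>0\<close> elsewhere. At
  the right cut the monomial is first expanded about \<open>y (j + 1)\<close>.
\<close>

lemma phi_eq:
  "\<phi> j m x = cut_error (\<eta> j) m (x - y j)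
     - (\<Sum>k\<le>m. real (m choose k) * (y (j + 1) - y j) ^ (m - k) * cut_error (\<eta> (j + 1)) k (x - y (j + 1)))
     + (if y j \<le> x \<and> x < y (j + 1) then (x - y j) ^ m else 0)"
proof -
  let ?h = "y (j + 1) - y j" and ?v = "x - y (j + 1)"
  have "(\<Sum>k\<le>m. real (m choose k) * ?h ^ (m - k) * (if 0 \<le> ?v then ?v ^ k else 0))
      = (if 0 \<le> ?v then (x - y j) ^ m else 0)"
  proof (cases "0 \<le> ?v")
    case True
    have "(x - y j) ^ m = (?v + ?h) ^ m" by simp
    thus ?thesis using True unfolding binomial_ring by (simp add: ac_simps)
  qed (use y_less[of j] in simp)
  thus ?thesis using y_less[of j]
    by (auto simp: \<phi>_def cut_error_def right_diff_distrib sum_subtractf)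
qed

text \<open>
  Every cut except the two ends of the cell of \<open>x\<close> is at least as far from \<open>x\<close> as one of its adjacent cells is
  long, and it is to these lengths that \<open>\<eta>\<close> is adapted.
\<close>

lemma far_cut:
  assumes "y i \<le> x" "x < y (i + 1)" "n \<noteq> i" "n \<noteq> i + 1"
  shows "n < i \<Longrightarrow> y (n + 1) - y n \<le> x - y n" "i < n \<Longrightarrow> y n - y (n - 1) \<le> y n - x"
    and "y i - y (i - 1) \<le> \<bar>x - y n\<bar> \<or> y (i + 2) - y (i + 1) \<le> \<bar>x - y n\<bar>"
    and "1000 * \<eta> n \<le> \<bar>x - y n\<bar>"
    and "1000 * (\<eta> n * K n) \<le> int_weight n * \<bar>x - y n\<bar>"
    and "1000 * (\<eta> n * K (n - 1)) \<le> int_weight n * \<bar>x - y n\<bar>"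
proof -
  show A: "y (n + 1) - y n \<le> x - y n" if "n < i"
    using y_mono[of "n + 1" i] that assms by simp
  show B: "y n - y (n - 1) \<le> y n - x" if "i < n"
    using y_mono[of "i + 1" "n - 1"] that assms by simp
  have cs: "n < i \<or> i < n" using assms by auto
  show "y i - y (i - 1) \<le> \<bar>x - y n\<bar> \<or> y (i + 2) - y (i + 1) \<le> \<bar>x - y n\<bar>"
  proof (cases "n < i")
    case True
    thus ?thesis using y_mono[of n "i - 1"] assms by linarith
  next
    case False
    hence "i + 2 \<le> n" using assms by simp
    thus ?thesis using y_mono[of "i + 2" n] assms by linarith
  qed
  have w: "0 < int_weight n" by (rule int_weight_pos)
  have d: "y (n + 1) - y n \<le> \<bar>x - y n\<bar> \<or> y n - y (n - 1) \<le> \<bar>x - y n\<bar>"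
    using cs A B by fastforce
  show "1000 * \<eta> n \<le> \<bar>x - y n\<bar>" using d eta_K(1,2)[of n] by linarith
  have d': "int_weight n * (y (n + 1) - y n) \<le> int_weight n * \<bar>x - y n\<bar> \<or>
      int_weight n * (y n - y (n - 1)) \<le> int_weight n * \<bar>x - y n\<bar>"
    using d w by auto
  show "1000 * (\<eta> n * K n) \<le> int_weight n * \<bar>x - y n\<bar>" using d' eta_K(3,4)[of n] by linarith
  show "1000 * (\<eta> n * K (n - 1)) \<le> int_weight n * \<bar>x - y n\<bar>" using d' eta_K(5,6)[of n] by linarith
qed

lemma near_cell:
  assumes i: "y i \<le> x" "x < y (i + 1)" and j: "j \<in> {i - 1, i, i + 1}"
  shows "\<bar>x - y j\<bar> \<le> \<rho> j / 8" "\<bar>x - y (j + 1)\<bar> \<le> \<rho> j / 4"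
proof -
  consider "j = i - 1" | "j = i" | "j = i + 1" using j by auto
  hence "\<bar>x - y j\<bar> \<le> \<rho> j / 8 \<and> \<bar>x - y (j + 1)\<bar> \<le> \<rho> j / 4"
  proof cases
    case 1
    have "y (j + 1) = y i" "y (j + 2) = y (i + 1)"
      by (rule arg_cong[where f = y], use 1 in simp)+
    thus ?thesis using i right[of j] y_less[of j] rho_pos[of j]
      unfolding abs_le_iff by (intro conjI; linarith)
  next
    case 2
    thus ?thesis using i gap_le(1)[of j] rho_pos[of j] by auto
  next
    case 3
    hence "y (j - 1) = y i" "y j = y (i + 1)" by simp_all
    thus ?thesis using i gap_le[of j] y_less[of j] rho_pos[of j] by auto
  qed
  thus "\<bar>x - y j\<bar> \<le> \<rho> j / 8" "\<bar>x - y (j + 1)\<bar> \<le> \<rho> j / 4" by auto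
qed

lemma phi_0: "\<phi> j 0 x = smooth_step (\<eta> j) (x - y j) - smooth_step (\<eta> (j + 1)) (x - y (j + 1))"
  by (simp add: \<phi>_def smooth_cut_def)

lemma phi_0_le_1: "\<bar>\<phi> j 0 x\<bar> \<le> 1"
  using smooth_step_range[of "\<eta> j" "x - y j"] smooth_step_range[of "\<eta> (j + 1)" "x - y (j + 1)"]
  unfolding phi_0 by linarith

text \<open>
  The functions \<open>\<phi> j 0\<close> form a partition of the constant \<open>1\<close>, with tails that are small relative to the weights.
\<close>

lemma phi_0_far:
  assumes "y i \<le> x" "x < y (i + 1)" "j \<notin> {i - 1, i, i + 1}"
  shows "K j * \<bar>\<phi> j 0 x\<bar> \<le> int_weight j / 50"
proof -
  have ne: "j \<noteq> i" "j \<noteq> i + 1" "j + 1 \<noteq> i" "j + 1 \<noteq> i + 1" using assms(3) by auto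
  have small: "K k * \<bar>cut_error (\<eta> n) 0 (x - y n)\<bar> \<le> int_weight n / 250"
    if "n \<noteq> i" "n \<noteq> i + 1" "k = n \<or> k = n - 1" for n k
  proof -
    have pos: "1000 * \<eta> n \<le> \<bar>x - y n\<bar>" by (rule far_cut(4)[OF assms(1,2) that(1,2)])
    have "\<bar>cut_error (\<eta> n) 0 (x - y n)\<bar> \<le> 4 * \<eta> n / \<bar>x - y n\<bar>"
      using cut_error_small[of "\<eta> n" "x - y n" 0] pos eta_pos[of n] by simp
    hence "K k * \<bar>cut_error (\<eta> n) 0 (x - y n)\<bar> \<le> K k * (4 * \<eta> n / \<bar>x - y n\<bar>)"
      by (intro mult_left_mono K_nonneg)
    also have "\<dots> = 4 * (\<eta> n * K k) / \<bar>x - y n\<bar>" by simp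
    also have "\<dots> \<le> (int_weight n * \<bar>x - y n\<bar> / 250) / \<bar>x - y n\<bar>"
      using far_cut(5,6)[OF assms(1,2) that(1,2)] that(3) by (intro divide_right_mono) auto
    also have "\<dots> = int_weight n / 250" using pos eta_pos[of n] by simp
    finally show ?thesis .
  qed
  have "\<not> (y j \<le> x \<and> x < y (j + 1))"
    using y_mono[of "j + 1" i] y_mono[of "i + 1" j] ne assms by (cases "j < i") auto
  hence "\<phi> j 0 x = cut_error (\<eta> j) 0 (x - y j) - cut_error (\<eta> (j + 1)) 0 (x - y (j + 1))"
    by (simp add: phi_eq)
  hence "K j * \<bar>\<phi> j 0 x\<bar> \<le> K j * \<bar>cut_error (\<eta> j) 0 (x - y j)\<bar> + K j * \<bar>cut_error (\<eta> (j + 1)) 0 (x - y (j + 1))\<bar>"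
    using K_nonneg[of j] unfolding distrib_left[symmetric] by (intro mult_left_mono) auto
  also have "\<dots> \<le> int_weight j / 250 + int_weight (j + 1) / 250"
    using ne by (intro add_mono small) auto
  also have "\<dots> \<le> int_weight j / 50" using int_weight_succ[of j] int_weight_pos[of j] by simp
  finally show ?thesis .
qed

text \<open>
  The three functions belonging to cells near \<open>x\<close> are estimated by their definition, with unspecified
  constants. For all others the indicator function in \<open>phi_eq\<close> vanishes around \<open>x\<close>, and the errors at the cuts
  are small enough to be summed against the weights.
\<close>

lemma phi_bounds:
  assumes "x \<in> G"
  obtains r U W where "\<And>j m. ps_bound x r (\<phi> j m) (U j * \<rho> j ^ m)" "\<And>j. 0 \<le> U j"
    "l1_le (\<lambda>j. U j * K j) W"
proof -
  obtain i where i: "y i \<le> x" "x < y (i + 1)" using cover[OF assms] by blast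
  have "\<forall>j. \<exists>s u. 0 < s \<and> 1 \<le> u \<and> ps_bound x s (\<lambda>t. smooth_step (\<eta> j) (t - y j)) u"
    using smooth_step_analytic[of 1] by (metis zero_less_one)
  then obtain s u where su: "\<And>j. 0 < s j" "\<And>j. 1 \<le> u j"
    "\<And>j. ps_bound x (s j) (\<lambda>t. smooth_step (\<eta> j) (t - y j)) (u j)" by metis
  define d where "d = min (y i - y (i - 1)) (y (i + 2) - y (i + 1))"
  define D where "D = d / 2"
  have d: "0 < d" using y_less[of "i - 1"] y_less[of "i + 1"] by (simp add: d_def add.assoc)
  have D: "0 < D" "D < y i - y (i - 1)" "D < y (i + 2) - y (i + 1)" using d by (auto simp: D_def d_def)
  \<comment> \<open>The radius has to be admissible for the smooth steps at the four cuts of the near cells and must not reach any other cut.\<close>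
  define S where "S = {s (i - 1), s i, s (i + 1), s (i + 1 + 1), D, \<rho> (i - 1) / 8, \<rho> i / 8, \<rho> (i + 1) / 8}"
  define r where "r = Min S"
  have fin: "finite S" by (simp add: S_def)
  have rle: "r \<le> e" if "e \<in> S" for e unfolding r_def using Min_le[OF fin that] .
  have "r \<in> S" unfolding r_def by (rule Min_in[OF fin]) (simp add: S_def)
  moreover have "\<forall>e\<in>S. 0 < e" using su(1) D rho_pos by (simp add: S_def)
  ultimately have r: "0 < r" by blast
  have rD: "r \<le> D" by (rule rle) (simp add: S_def)
  define near where "near j \<longleftrightarrow> j = i - 1 \<or> j = i \<or> j = i + 1" for j
  define U where "U j = (if near j then u j + u (j + 1) + 4 else (2 * \<eta> j + 2 * \<eta> (j + 1)) / D)" for j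
  have U0: "0 \<le> U j" for j
    using su(2)[of j] su(2)[of "j + 1"] eta_pos[of j] eta_pos[of "j + 1"] D by (simp add: U_def)
  have rho1: "\<rho> j ^ m \<ge> 0" for j m using rho_pos[of j] by simp
  have ps: "ps_bound x r (\<phi> j m) (U j * \<rho> j ^ m)" for j m
  proof (cases "near j")
    case True
    have "r \<le> \<rho> j / 8" by (rule rle) (use True in \<open>auto simp: near_def S_def\<close>)
    moreover have "\<bar>x - y j\<bar> \<le> \<rho> j / 8" "\<bar>x - y (j + 1)\<bar> \<le> \<rho> j / 4"
      using near_cell[OF i] True by (auto simp: near_def)
    moreover note rho_pos[of j]
    ultimately have c: "r + \<bar>x - y j\<bar> \<le> \<rho> j / 2" "r + \<bar>x - y (j + 1)\<bar> \<le> \<rho> j / 2" by auto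
    have s: "r \<le> s j" "r \<le> s (j + 1)" by (rule rle; use True in \<open>auto simp: near_def S_def\<close>)+
    have e: "2 * \<eta> j \<le> \<rho> j / 2" "2 * \<eta> (j + 1) \<le> \<rho> j / 2"
      using eta_K(1)[of j] eta_K(2)[of "j + 1"] gap_le(1)[of j] eta_pos[of j] eta_pos[of "j + 1"] rho_pos[of j] by auto
    have h: "0 \<le> y (j + 1) - y j" "y (j + 1) - y j + \<rho> j / 2 \<le> \<rho> j"
      using y_less[of j] gap_le(1)[of j] rho_pos[of j] by auto
    have A: "ps_bound x r (\<lambda>t. smooth_cut (\<eta> j) m (t - y j)) ((u j + 2) * (\<rho> j / 2) ^ m)"
      by (rule ps_bound_smooth_cut[OF ps_bound_shrink[OF su(3) r s(1)] eta_pos e(1) c(1)])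
    have B: "ps_bound x r (\<lambda>t. smooth_cut (\<eta> (j + 1)) k (t - y (j + 1))) ((u (j + 1) + 2) * (\<rho> j / 2) ^ k)" for k
      by (rule ps_bound_smooth_cut[OF ps_bound_shrink[OF su(3) r s(2)] eta_pos e(2) c(2)])
    have "ps_bound x r (\<phi> j m) ((u j + 2) * (\<rho> j / 2) ^ m + (u (j + 1) + 2) * \<rho> j ^ m)"
      unfolding \<phi>_def
      by (intro ps_bound_diff A ps_bound_binomial_sum[OF B]) (use h rho_pos[of j] su(2)[of "j + 1"] in auto)
    thus ?thesis
    proof (rule ps_bound_mono)
      have "(u j + 2) * (\<rho> j / 2) ^ m \<le> (u j + 2) * \<rho> j ^ m"
        using su(2)[of j] rho_pos[of j] by (intro mult_left_mono power_mono) auto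
      thus "(u j + 2) * (\<rho> j / 2) ^ m + (u (j + 1) + 2) * \<rho> j ^ m \<le> U j * \<rho> j ^ m"
        using True by (simp add: U_def algebra_simps)
    qed
  next
    case False
    have ne: "j \<noteq> i" "j \<noteq> i + 1" "j + 1 \<noteq> i" "j + 1 \<noteq> i + 1" using False by (auto simp: near_def)
    have E: "ps_bound x r (\<lambda>t. cut_error (\<eta> n) k (t - y n)) ((2 * \<eta> n / D) * \<eta> n ^ k)"
      if n: "n \<noteq> i" "n \<noteq> i + 1" for n k
    proof -
      have dist: "d \<le> \<bar>x - y n\<bar>" using far_cut(3)[OF i n] by (auto simp: d_def)
      \<comment> \<open>Half the distance to the cut is used up by the radius \<open>r\<close>.\<close>
      have "ps_bound x r (\<lambda>t. cut_error (\<eta> n) k (t - y n)) (\<eta> n ^ k * (2 * \<eta> n / (\<bar>x - y n\<bar> / 2)))"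
        by (rule ps_bound_cut_error)
           (use dist d r rD eta_pos[of n] far_cut(4)[OF i n] in \<open>auto simp: D_def\<close>)
      thus ?thesis
      proof (rule ps_bound_mono)
        have "2 * \<eta> n / (\<bar>x - y n\<bar> / 2) \<le> 2 * \<eta> n / D"
          using dist d eta_pos[of n] by (intro divide_left_mono) (auto simp: D_def)
        hence "\<eta> n ^ k * (2 * \<eta> n / (\<bar>x - y n\<bar> / 2)) \<le> \<eta> n ^ k * (2 * \<eta> n / D)"
          using eta_pos[of n] by (intro mult_left_mono) auto
        thus "\<eta> n ^ k * (2 * \<eta> n / (\<bar>x - y n\<bar> / 2)) \<le> (2 * \<eta> n / D) * \<eta> n ^ k"
          by (simp only: mult.commute)
      qed
    qed
    have h: "0 \<le> y (j + 1) - y j" "y (j + 1) - y j + \<eta> (j + 1) \<le> \<rho> j" "\<eta> j \<le> \<rho> j"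
      using y_less[of j] gap_le(1)[of j] rho_pos[of j] eta_K(1)[of j] eta_K(2)[of "j + 1"]
        eta_pos[of j] eta_pos[of "j + 1"] by auto
    have "ps_bound x r (\<lambda>t. cut_error (\<eta> j) m (t - y j) - (\<Sum>k\<le>m. real (m choose k) *
        (y (j + 1) - y j) ^ (m - k) * cut_error (\<eta> (j + 1)) k (t - y (j + 1))))
        ((2 * \<eta> j / D) * \<eta> j ^ m + (2 * \<eta> (j + 1) / D) * \<rho> j ^ m)"
      by (intro ps_bound_diff E ps_bound_binomial_sum[OF E])
         (use ne h eta_pos[of j] eta_pos[of "j + 1"] D in auto)
    thus ?thesis
    proof (rule ps_bound_cong)
      fix t assume t: "\<bar>t - x\<bar> \<le> r"
      have "y (i - 1) < t" "t < y (i + 2)" using t rD D i by (auto simp: abs_le_iff)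
      hence n: "\<not> (y j \<le> t \<and> t < y (j + 1))"
        using y_mono[of "j + 1" "i - 1"] y_mono[of "i + 2" j] ne by (cases "j < i") auto
      show "\<phi> j m t = cut_error (\<eta> j) m (t - y j) - (\<Sum>k\<le>m. real (m choose k) *
        (y (j + 1) - y j) ^ (m - k) * cut_error (\<eta> (j + 1)) k (t - y (j + 1)))" by (simp only: phi_eq if_not_P[OF n] add_0_right)
    next
      have "(2 * \<eta> j / D) * \<eta> j ^ m \<le> (2 * \<eta> j / D) * \<rho> j ^ m"
        using h eta_pos[of j] D by (intro mult_left_mono power_mono) auto
      thus "(2 * \<eta> j / D) * \<eta> j ^ m + (2 * \<eta> (j + 1) / D) * \<rho> j ^ m \<le> U j * \<rho> j ^ m"
        using False by (simp add: U_def add_divide_distrib distrib_right)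
    qed
  qed
  have "l1_le (\<lambda>j. if near j then U j * K j else 0) (\<Sum>j\<in>{i - 1, i, i + 1}. norm (if near j then U j * K j else 0))"
    by (rule l1_le_finite_support[of "{i - 1, i, i + 1}"]) (auto simp: near_def)
  moreover have "l1_le (\<lambda>j. if near j then 0 else U j * K j) (1 / D * 4)"
  proof (rule l1_le_scale[OF int_weight_l1])
    fix j
    have "2 * (\<eta> j * K j) + 2 * (\<eta> (j + 1) * K j) \<le> int_weight j"
      using eta_K(7)[of j] eta_K(8)[of "j + 1"] int_weight_succ[of j] int_weight_pos[of j] by simp
    hence "(2 * (\<eta> j * K j) + 2 * (\<eta> (j + 1) * K j)) / D \<le> int_weight j / D"
      using D by (intro divide_right_mono) auto
    hence "(2 * \<eta> j + 2 * \<eta> (j + 1)) / D * K j \<le> 1 / D * int_weight j"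
      by (simp add: add_divide_distrib distrib_right)
    thus "norm (if near j then 0 else U j * K j) \<le> 1 / D * norm (int_weight j)"
      using K_nonneg[of j] int_weight_pos[of j] eta_pos[of j] eta_pos[of "j + 1"] D
      by (simp add: U_def abs_mult abs_of_pos)
  qed (use D in simp)
  ultimately have "l1_le (\<lambda>j. (if near j then U j * K j else 0) + (if near j then 0 else U j * K j))
    ((\<Sum>j\<in>{i - 1, i, i + 1}. norm (if near j then U j * K j else 0)) + 1 / D * 4)"
    by (rule l1_le_add)
  hence "l1_le (\<lambda>j. U j * K j) ((\<Sum>j\<in>{i - 1, i, i + 1}. norm (if near j then U j * K j else 0)) + 1 / D * 4)"
    by (rule l1_le_mono) auto
  from that[OF ps U0 this] show thesis .
qed

lemma phi_0_bounds:
  assumes "x \<in> G"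
  obtains r U W where "0 < r" "\<And>j. ps_bound x r (\<phi> j 0) (U j)" "\<And>j. 0 \<le> U j"
    "l1_le (\<lambda>j. U j * K j) W"
proof -
  obtain r U W where U: "\<And>j m. ps_bound x r (\<phi> j m) (U j * \<rho> j ^ m)" "\<And>j. 0 \<le> U j"
    "l1_le (\<lambda>j. U j * K j) W" by (rule phi_bounds[OF assms]) blast
  have "ps_bound x r (\<phi> j 0) (U j)" for j using U(1)[of j 0] by simp
  from that[OF ps_bound_radius[OF this] this U(2,3)] show thesis .
qed

text \<open>
  If \<open>V j\<close> is the error made by cutting the series at \<open>y j\<close>, the summand of cell \<open>j\<close> is \<open>V j - V (j + 1)\<close> plus the restriction
  of \<open>F\<close> to the cell. Here the error at the right end does not depend on the centre
  about which \<open>F\<close> is expanded, by \<open>recentre_sum\<close>. The errors are absolutely summable, so they cancel.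
\<close>

lemma phi_sum:
  fixes c :: "int \<Rightarrow> nat \<Rightarrow> 'a::banach"
  assumes c: "\<And>j. l1_le (\<lambda>m. \<rho> j ^ m *\<^sub>R c j m) (K j)"
    and F: "\<And>j t. \<bar>t - y j\<bar> \<le> \<rho> j \<Longrightarrow> F t = (\<Sum>\<^sub>\<infinity>m. (t - y j) ^ m *\<^sub>R c j m)"
    and x: "x \<in> G"
  shows "F x = (\<Sum>\<^sub>\<infinity>j. \<Sum>\<^sub>\<infinity>m. \<phi> j m x *\<^sub>R c j m)"
proof -
  obtain i where i: "y i \<le> x" "x < y (i + 1)" using cover[OF x] by blast
  define V where "V j = (\<Sum>\<^sub>\<infinity>k. cut_error (\<eta> j) k (x - y j) *\<^sub>R c j k)" for j
  have eta_rho: "2 * \<eta> j \<le> \<rho> j" "(y (j + 1) - y j) + 2 * \<eta> (j + 1) \<le> \<rho> j" for j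
    using y_less[of j] gap_le(1)[of j] rho_pos[of j] eta_K(1)[of j] eta_K(2)[of "j + 1"]
        eta_pos[of j] eta_pos[of "j + 1"] by auto
  have Vl1: "l1_le (\<lambda>k. cut_error (\<eta> j) k (x - y j) *\<^sub>R c j k) (B * K j)"
    if "\<And>k. \<bar>cut_error (\<eta> j) k (x - y j)\<bar> \<le> B * \<rho> j ^ k" for j B
  proof (rule l1_le_scale[OF c[of j]])
    show "0 \<le> B" using that[of 0] by simp
    fix k
    have "\<bar>cut_error (\<eta> j) k (x - y j)\<bar> * norm (c j k) \<le> B * \<rho> j ^ k * norm (c j k)"
      by (intro mult_right_mono that) auto
    thus "norm (cut_error (\<eta> j) k (x - y j) *\<^sub>R c j k) \<le> B * norm (\<rho> j ^ k *\<^sub>R c j k)"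
      using rho_pos[of j] by (simp add: mult.assoc)
  qed
  have near: "\<bar>cut_error (\<eta> j) k (x - y j)\<bar> \<le> 4 * \<rho> j ^ k" for j k
  proof -
    have "(2 * \<eta> j) ^ k \<le> \<rho> j ^ k" using eta_rho eta_pos[of j] by (intro power_mono) auto
    thus ?thesis using cut_error_bound[OF eta_pos, of j k "x - y j"] by simp
  qed
  have far: "\<bar>cut_error (\<eta> j) k (x - y j)\<bar> \<le> (4 * \<eta> j / \<bar>x - y j\<bar>) * \<rho> j ^ k"
    if "j \<noteq> i" "j \<noteq> i + 1" for j k
  proof -
    have dist: "1000 * \<eta> j \<le> \<bar>x - y j\<bar>" by (rule far_cut(4)[OF i that])
    hence "\<bar>cut_error (\<eta> j) k (x - y j)\<bar> \<le> 2 * \<eta> j ^ k * (2 * \<eta> j / \<bar>x - y j\<bar>)"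
      using eta_pos[of j] by (intro cut_error_small) auto
    also have "\<dots> \<le> 2 * \<rho> j ^ k * (2 * \<eta> j / \<bar>x - y j\<bar>)"
      using eta_rho(1)[of j] eta_pos[of j] by (intro mult_right_mono mult_left_mono power_mono) auto
    finally show ?thesis by (simp add: ac_simps)
  qed
  have Vfar: "norm (V j) \<le> int_weight j" if j: "j \<noteq> i" "j \<noteq> i + 1" for j
  proof -
    have dist: "1000 * \<eta> j \<le> \<bar>x - y j\<bar>" by (rule far_cut(4)[OF i j])
    have "norm (V j) \<le> (4 * \<eta> j / \<bar>x - y j\<bar>) * K j"
      unfolding V_def by (rule l1_le_infsum[OF Vl1[OF far[OF j]]])
    also have "\<dots> = 4 * (\<eta> j * K j) / \<bar>x - y j\<bar>" by simp
    also have "\<dots> \<le> (int_weight j * \<bar>x - y j\<bar>) / \<bar>x - y j\<bar>"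
      using far_cut(5)[OF i j] mult_nonneg_nonneg[OF less_imp_le[OF eta_pos] K_nonneg, of j j]
      by (intro divide_right_mono) auto
    also have "\<dots> = int_weight j" using dist eta_pos[of j] by simp
    finally show ?thesis .
  qed
  have "l1_le (\<lambda>j. if j \<in> {i, i + 1} then V j else 0)
      (\<Sum>j\<in>{i, i + 1}. norm (if j \<in> {i, i + 1} then V j else 0))"
    by (rule l1_le_finite_support[of "{i, i + 1}"]) auto
  moreover have "l1_le (\<lambda>j. if j \<in> {i, i + 1} then 0 else V j) 4"
    by (rule l1_le_mono[OF int_weight_l1]) (use Vfar int_weight_pos in \<open>auto simp: less_imp_le\<close>)
  ultimately have "l1_le (\<lambda>j. (if j \<in> {i, i + 1} then V j else 0) + (if j \<in> {i, i + 1} then 0 else V j))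
      ((\<Sum>j\<in>{i, i + 1}. norm (if j \<in> {i, i + 1} then V j else 0)) + 4)"
    by (rule l1_le_add)
  hence "l1_le V ((\<Sum>j\<in>{i, i + 1}. norm (if j \<in> {i, i + 1} then V j else 0)) + 4)"
    by (rule l1_le_mono) auto
  then obtain W where V: "l1_le V W" by blast
  have rec: "(\<Sum>\<^sub>\<infinity>m. (\<Sum>k\<le>m. real (m choose k) * (y (j + 1) - y j) ^ (m - k) *
      cut_error (\<eta> (j + 1)) k (x - y (j + 1))) *\<^sub>R c j m) = V (j + 1)" for j
  proof -
    let ?h = "y (j + 1) - y j" and ?s = "2 * \<eta> (j + 1)"
    let ?d = "\<lambda>k. \<Sum>\<^sub>\<infinity>m. (real (m choose k) * ?h ^ (m - k)) *\<^sub>R c j m"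
    have hs: "0 < ?s" "\<bar>?h\<bar> + ?s \<le> \<rho> j" using eta_rho(2)[of j] eta_pos[of "j + 1"] y_less[of j] by auto
    have "(\<Sum>\<^sub>\<infinity>m. (\<Sum>k\<le>m. real (m choose k) * ?h ^ (m - k) * cut_error (\<eta> (j + 1)) k (x - y (j + 1))) *\<^sub>R c j m)
       = (\<Sum>\<^sub>\<infinity>k. cut_error (\<eta> (j + 1)) k (x - y (j + 1)) *\<^sub>R ?d k)"
      by (rule recentre_sum(2)[OF c hs]) (rule cut_error_bound[OF eta_pos])
    moreover have "?d = c (j + 1)"
    proof (rule power_series_unique[OF hs(1)])
      show "l1_le (\<lambda>k. ?s ^ k *\<^sub>R ?d k) (K j)" by (rule recentre_sum(1)[OF c hs])
      show l: "l1_le (\<lambda>k. ?s ^ k *\<^sub>R c (j + 1) k) (K (j + 1))"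
        by (rule l1_le_smaller_radius[OF c]) (use eta_rho(1)[of "j + 1"] eta_pos[of "j + 1"] in simp)
      fix t assume t: "\<bar>t\<bar> \<le> ?s"
      have "\<bar>t ^ k\<bar> \<le> 1 * ?s ^ k" for k using power_mono[OF t abs_ge_zero, of k] by (simp only: power_abs mult_1)
      from recentre_sum(2)[OF c hs this]
      have "(\<Sum>\<^sub>\<infinity>k. t ^ k *\<^sub>R ?d k) = (\<Sum>\<^sub>\<infinity>m. (\<Sum>k\<le>m. real (m choose k) * ?h ^ (m - k) * t ^ k) *\<^sub>R c j m)" by simp
      also have "\<dots> = (\<Sum>\<^sub>\<infinity>m. (t + ?h) ^ m *\<^sub>R c j m)"
        unfolding binomial_ring by (simp add: ac_simps)
      also have "\<dots> = F (y (j + 1) + t)"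
        using F[of "y (j + 1) + t" j] t hs(2) y_less[of j] by (simp add: algebra_simps)
      also have "\<dots> = (\<Sum>\<^sub>\<infinity>k. t ^ k *\<^sub>R c (j + 1) k)"
        using F[of "y (j + 1) + t" "j + 1"] t eta_rho(1)[of "j + 1"] by simp
      finally show "(\<Sum>\<^sub>\<infinity>k. t ^ k *\<^sub>R ?d k) = (\<Sum>\<^sub>\<infinity>k. t ^ k *\<^sub>R c (j + 1) k)" .
    qed
    ultimately show ?thesis by (simp only: V_def fun_cong[of ?d "c (j + 1)"])
  qed
  have inner: "(\<Sum>\<^sub>\<infinity>m. \<phi> j m x *\<^sub>R c j m) = (V j - V (j + 1)) + (if j = i then F x else 0)" for j
  proof -
    let ?E = "\<lambda>m. \<Sum>k\<le>m. real (m choose k) * (y (j + 1) - y j) ^ (m - k) * cut_error (\<eta> (j + 1)) k (x - y (j + 1))"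
    let ?I = "\<lambda>m. (if y j \<le> x \<and> x < y (j + 1) then (x - y j) ^ m else 0)"
    have cell: "y j \<le> x \<and> x < y (j + 1) \<longleftrightarrow> j = i"
      using i y_mono[of "j + 1" i] y_mono[of "i + 1" j] by (cases j i rule: linorder_cases) auto
    have 1: "l1_le (\<lambda>m. cut_error (\<eta> j) m (x - y j) *\<^sub>R c j m) (4 * K j)" by (rule Vl1[OF near])
    have Eb: "\<bar>?E m\<bar> \<le> 4 * \<rho> j ^ m" for m
    proof -
      have "\<bar>?E m\<bar> \<le> (\<Sum>k\<le>m. real (m choose k) * (y (j + 1) - y j) ^ (m - k) * (4 * (2 * \<eta> (j + 1)) ^ k))"
        using y_less[of j] cut_error_bound[OF eta_pos, of "j + 1" _ "x - y (j + 1)"]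
        by (intro order_trans[OF sum_abs] sum_mono) (auto simp: abs_mult intro!: mult_left_mono)
      also have "\<dots> = 4 * (2 * \<eta> (j + 1) + (y (j + 1) - y j)) ^ m"
        unfolding binomial_ring sum_distrib_left by (intro sum.cong) auto
      also have "\<dots> \<le> 4 * \<rho> j ^ m"
        using eta_rho(2)[of j] y_less[of j] eta_pos[of "j + 1"] by (intro mult_left_mono power_mono) auto
      finally show ?thesis .
    qed
    have 2: "l1_le (\<lambda>m. ?E m *\<^sub>R c j m) (4 * K j)"
    proof (rule l1_le_scale[OF c[of j]])
      fix m
      have "\<bar>?E m\<bar> * norm (c j m) \<le> 4 * \<rho> j ^ m * norm (c j m)" by (intro mult_right_mono Eb) auto
      thus "norm (?E m *\<^sub>R c j m) \<le> 4 * norm (\<rho> j ^ m *\<^sub>R c j m)" using rho_pos[of j] by simp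
    qed simp
    have xr: "\<bar>x - y j\<bar> \<le> \<rho> j" if "j = i" using that i gap_le(1)[of j] rho_pos[of j] by simp
    have 3: "l1_le (\<lambda>m. ?I m *\<^sub>R c j m) (K j)"
    proof (cases "j = i")
      case True
      thus ?thesis using l1_le_smaller_radius[OF c xr] cell by simp
    next
      case False
      hence n: "\<not> (y j \<le> x \<and> x < y (j + 1))" using cell by blast
      have "l1_le (\<lambda>m::nat. 0::'a) (K j)" by (rule l1_le_mono[OF c[of j]]) auto
      thus ?thesis by (simp only: if_not_P[OF n] scaleR_zero_left)
    qed
    have "(\<Sum>\<^sub>\<infinity>m. \<phi> j m x *\<^sub>R c j m) = (\<Sum>\<^sub>\<infinity>m. (cut_error (\<eta> j) m (x - y j) *\<^sub>R c j m - ?E m *\<^sub>R c j m) + ?I m *\<^sub>R c j m)"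
      by (simp add: phi_eq scaleR_add_left scaleR_diff_left)
    also have "\<dots> = (\<Sum>\<^sub>\<infinity>m. cut_error (\<eta> j) m (x - y j) *\<^sub>R c j m - ?E m *\<^sub>R c j m) + (\<Sum>\<^sub>\<infinity>m. ?I m *\<^sub>R c j m)"
      by (rule infsum_add_l1[OF l1_le_diff[OF 1 2] 3])
    also have "(\<Sum>\<^sub>\<infinity>m. cut_error (\<eta> j) m (x - y j) *\<^sub>R c j m - ?E m *\<^sub>R c j m) = V j - V (j + 1)"
      using infsum_diff_l1[OF 1 2] rec[of j] by (simp add: V_def)
    also have "(\<Sum>\<^sub>\<infinity>m. ?I m *\<^sub>R c j m) = (if j = i then F x else 0)"
      using cell F[OF xr] by auto
    finally show ?thesis .
  qed
  have inj: "inj (\<lambda>j::int. j + 1)" by (simp add: inj_def)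
  have V': "l1_le (\<lambda>j. V (j + 1)) W" by (rule l1_le_reindex[OF V inj])
  \<comment> \<open>The shift of the index permutes the integers, so the telescoping sum vanishes.\<close>
  have shift: "(\<Sum>\<^sub>\<infinity>j. V (j + 1)) = (\<Sum>\<^sub>\<infinity>j. V j)"
    by (rule infsum_reindex_bij_betw[where g = "\<lambda>j. j + 1"])
       (rule bij_betwI[of _ _ _ "\<lambda>j. j - 1"], auto)
  have Vd: "l1_le (\<lambda>j. V j - V (j + 1)) (W + W)"
    by (rule l1_le_diff[OF V V'])
  have Fl: "l1_le (\<lambda>j. if j = i then F x else 0) (norm (F x))"
    by (rule l1_le_finite_support[of "{i}"]) auto
  have "(\<Sum>\<^sub>\<infinity>j. \<Sum>\<^sub>\<infinity>m. \<phi> j m x *\<^sub>R c j m) = (\<Sum>\<^sub>\<infinity>j. V j - V (j + 1)) + (\<Sum>\<^sub>\<infinity>j. if j = i then F x else 0)"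
    using infsum_add_l1[OF Vd Fl] by (simp add: inner)
  also have "(\<Sum>\<^sub>\<infinity>j. V j - V (j + 1)) = 0" using infsum_diff_l1[OF V V'] shift by simp
  also have "(\<Sum>\<^sub>\<infinity>j. if j = i then F x else 0) = F x" by (subst infsum_single[of i]) auto
  finally show ?thesis by simp
qed

end

section \<open>Expansion of an analytic function in scalar functions\<close>

lemma cell_system_exists:
  fixes y \<rho> K :: "int \<Rightarrow> real"
  assumes "\<And>j. y j < y (j + 1)" "\<And>j. 0 < \<rho> j" "\<And>j. y (j + 2) \<le> y j + \<rho> j / 8"
    "\<And>j. y j \<le> y (j - 1) + \<rho> j / 8" "\<And>x. x \<in> G \<Longrightarrow> \<exists>j. y j \<le> x \<and> x < y (j + 1)"
    "\<And>j. 0 \<le> K j"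
  obtains \<eta> where "cell_system G y \<rho> \<eta> K"
proof -
  define g where "g j = min 1 (min (y (j + 1) - y j) (y j - y (j - 1)))" for j
  define \<eta> where "\<eta> j = int_weight j * g j / (1000 * (1 + K j + K (j - 1)))" for j
  have D: "0 < 1 + K j + K (j - 1)" for j using assms(6)[of j] assms(6)[of "j - 1"] by linarith
  have g: "0 < g j" for j using assms(1)[of j] assms(1)[of "j - 1"] by (simp add: g_def)
  have e: "1000 * \<eta> j * (1 + K j + K (j - 1)) = int_weight j * g j" for j
  proof -
    have "1000 * (u / (1000 * d)) * d = u" if "0 < d" for u d :: real using that by simp
    from this[OF D] show ?thesis unfolding \<eta>_def .
  qed
  have "cell_system G y \<rho> \<eta> K"
  proof
    fix j
    show "0 < \<eta> j" unfolding \<eta>_def using D[of j] g[of j] int_weight_pos[of j] by simp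
    show "1000 * \<eta> j * (1 + K j + K (j - 1)) \<le> int_weight j * (y (j + 1) - y j)"
      unfolding e using int_weight_pos[of j] by (intro mult_left_mono) (auto simp: g_def)
    show "1000 * \<eta> j * (1 + K j + K (j - 1)) \<le> int_weight j * (y j - y (j - 1))"
      unfolding e using int_weight_pos[of j] by (intro mult_left_mono) (auto simp: g_def)
    have "int_weight j * g j \<le> int_weight j * 1"
      using int_weight_pos[of j] by (intro mult_left_mono) (auto simp: g_def)
    thus "1000 * \<eta> j * (1 + K j + K (j - 1)) \<le> int_weight j" unfolding e by simp
  qed (use assms in auto)
  from that[OF this] show thesis .
qed

text \<open>
  The radius may depend on the point but not on the member of the family.
\<close>

definition locally_l1 :: "real set \<Rightarrow> ('k \<Rightarrow> real \<Rightarrow> 'a::banach) \<Rightarrow> bool" where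
  "locally_l1 G f \<longleftrightarrow> (\<forall>x\<in>G. \<exists>r w W. 0 < r \<and> (\<forall>k. ps_bound x r (f k) (w k)) \<and> l1_le w W)"

lemma locally_l1E:
  assumes "locally_l1 G f" "x \<in> G"
  obtains r w W where "0 < r" "\<And>k. ps_bound x r (f k) (w k)" "l1_le w W"
  using assms unfolding locally_l1_def by blast

lemma locally_l1_witness:
  assumes "\<And>k. ps_bound x r (f k) (w k)" "l1_le w W"
  shows "\<exists>r w W. 0 < r \<and> (\<forall>k. ps_bound x r (f k) (w k)) \<and> l1_le w W"
  by (intro exI[of _ r] exI[of _ w] exI[of _ W] conjI allI assms ps_bound_radius[OF assms(1)])

lemma locally_l1_at:
  assumes "locally_l1 G f" "x \<in> G"
  obtains W where "l1_le (\<lambda>k. f k x) W"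
proof -
  obtain r w W where "0 < r" "\<And>k. ps_bound x r (f k) (w k)" "l1_le w W"
    by (rule locally_l1E[OF assms]) blast
  with ps_bound_infsum(2)[of x r f w W x] that show thesis by simp
qed

lemma locally_l1_mult:
  fixes f :: "'k \<Rightarrow> real \<Rightarrow> real" and h :: "real \<Rightarrow> real"
  assumes f: "locally_l1 G f" and h: "\<And>x. x \<in> G \<Longrightarrow> \<exists>r w. ps_bound x r h w"
  shows "locally_l1 G (\<lambda>k t. h t * f k t)"
  unfolding locally_l1_def
proof
  fix x assume x: "x \<in> G"
  obtain r w W where r: "0 < r" "\<And>k. ps_bound x r (f k) (w k)" "l1_le w W"
    by (rule locally_l1E[OF f x]) blast
  obtain q v where q: "ps_bound x q h v" using h[OF x] by blast
  define s where "s = min r q"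
  have s: "0 < s" "s \<le> r" "s \<le> q" using r(1) ps_bound_radius[OF q] by (auto simp: s_def)
  have "ps_bound x s (\<lambda>t. h t * f k t) (v * w k)" for k
    by (rule ps_bound_mult[OF ps_bound_shrink[OF q s(1,3)] ps_bound_shrink[OF r(2) s(1,2)]])
  moreover have "l1_le (\<lambda>k. v * w k) (v * W)"
    by (rule l1_le_scale[OF r(3)]) (use ps_bound_nonneg[OF q] in \<open>auto simp: abs_mult\<close>)
  ultimately show "\<exists>r w W. 0 < r \<and> (\<forall>k. ps_bound x r (\<lambda>t. h t * f k t) (w k)) \<and> l1_le w W"
      by (rule locally_l1_witness)
qed

text \<open>
  Apply \<open>phi_sum\<close> to the local power series of \<open>F\<close>, with the norms of the series as weights. The norms of the
  coefficients are moved into the scalar functions.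
\<close>

lemma global_expansion:
  fixes F :: "real \<Rightarrow> 'a::banach"
  assumes G: "open G" "connected G" "G \<noteq> {}" and F: "F real_analytic_on G"
  obtains f :: "int \<times> nat \<Rightarrow> real \<Rightarrow> real" and c :: "int \<times> nat \<Rightarrow> 'a"
  where "locally_l1 G f" "\<And>p. norm (c p) \<le> 1" "\<And>x. x \<in> G \<Longrightarrow> F x = (\<Sum>\<^sub>\<infinity>p. f p x *\<^sub>R c p)"
proof -
  define P where "P x r \<longleftrightarrow> (\<forall>t. \<bar>t - x\<bar> \<le> r \<longrightarrow> t \<in> G) \<and> (\<exists>w. ps_bound x r F w)" for x r
  obtain y \<rho> :: "int \<Rightarrow> real" where cells: "\<And>j. y j < y (j + 1)" "\<And>j. 0 < \<rho> j" "\<And>j. P (y j) (\<rho> j)"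
    "\<And>j. y (j + 2) \<le> y j + \<rho> j / 8" "\<And>j. y j \<le> y (j - 1) + \<rho> j / 8"
    "\<And>x. x \<in> G \<Longrightarrow> \<exists>j. y j \<le> x \<and> x < y (j + 1)"
  proof (rule subordinate_cells[OF G(2,3), of P])
    show "P z s" if "P x r" "\<bar>z - x\<bar> + s \<le> r" "0 < s" for x r z s
    proof -
      have "\<bar>t - x\<bar> \<le> r" if "\<bar>t - z\<bar> \<le> s" for t using that \<open>\<bar>z - x\<bar> + s \<le> r\<close> by linarith
      thus ?thesis using that ps_bound_recentre unfolding P_def by blast
    qed
    show "\<exists>r>0. P x r" if "x \<in> G" for x
    proof -
      obtain e where e: "0 < e" "cball x e \<subseteq> G" using G(1) \<open>x \<in> G\<close> open_contains_cball by blast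
      obtain r w where r: "ps_bound x r F w" using F \<open>x \<in> G\<close> unfolding real_analytic_on_iff by blast
      define s where "s = min r e"
      have s: "0 < s" "s \<le> r" "s \<le> e" using e ps_bound_radius[OF r] by (auto simp: s_def)
      have "t \<in> G" if "\<bar>t - x\<bar> \<le> s" for t
        using e(2) s(3) that by (auto simp: dist_norm abs_minus_commute)
      thus ?thesis using ps_bound_shrink[OF r s(1,2)] s(1) unfolding P_def by blast
    qed
    show "t \<in> G" if "P x r" "\<bar>t - x\<bar> \<le> r" for x r t using that unfolding P_def by blast
  qed blast
  have "\<forall>j. \<exists>c w. l1_le (\<lambda>m. \<rho> j ^ m *\<^sub>R c m) w \<and> (\<forall>t. \<bar>t - y j\<bar> \<le> \<rho> j \<longrightarrow> F t = (\<Sum>\<^sub>\<infinity>m. (t - y j) ^ m *\<^sub>R c m))"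
    using cells(3) unfolding P_def ps_bound_def by blast
  then obtain c K where c: "\<And>j. l1_le (\<lambda>m. \<rho> j ^ m *\<^sub>R c j m) (K j)"
    "\<And>j t. \<bar>t - y j\<bar> \<le> \<rho> j \<Longrightarrow> F t = (\<Sum>\<^sub>\<infinity>m. (t - y j) ^ m *\<^sub>R c j m)" by metis
  have K0: "0 \<le> K j" for j using l1_le_nonneg[OF c(1)] .
  obtain \<eta> where "cell_system G y \<rho> \<eta> K"
    by (rule cell_system_exists[OF cells(1,2,4,5,6) K0])
  then interpret cell_system G y \<rho> \<eta> K .
  define f where "f p t = norm (c (fst p) (snd p)) * \<phi> (fst p) (snd p) t" for p t
  define d where "d p = sgn (c (fst p) (snd p))" for p
  show thesis
  proof (rule that[of f d])
    show loc: "locally_l1 G f" unfolding locally_l1_def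
    proof
      fix x assume x: "x \<in> G"
      obtain r U W where U: "\<And>j m. ps_bound x r (\<phi> j m) (U j * \<rho> j ^ m)" "\<And>j. 0 \<le> U j"
        "l1_le (\<lambda>j. U j * K j) W" by (rule phi_bounds[OF x]) blast
      let ?w = "\<lambda>p. norm (c (fst p) (snd p)) * (U (fst p) * \<rho> (fst p) ^ snd p)"
      have "ps_bound x r (f p) (?w p)" for p
        using ps_bound_mult[OF ps_bound_const[OF ps_bound_radius[OF U(1)]] U(1), of "norm (c (fst p) (snd p))"]
        unfolding f_def by simp
      moreover have "l1_le ?w W"
      proof (rule l1_le_Sigma[OF _ U(3)])
        show "l1_le (\<lambda>m. ?w (j, m)) (U j * K j)" for j
          by (rule l1_le_scale[OF c(1)[of j]]) (use U(2)[of j] rho_pos[of j] in \<open>auto simp: abs_mult\<close>)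
      qed
      ultimately show "\<exists>r w W. 0 < r \<and> (\<forall>k. ps_bound x r (f k) (w k)) \<and> l1_le w W"
      by (rule locally_l1_witness)
    qed
    show d: "norm (d p) \<le> 1" for p by (simp add: d_def norm_sgn)
    fix x assume x: "x \<in> G"
    obtain W where W: "l1_le (\<lambda>p. f p x) W" using locally_l1_at[OF loc x] .
    have "l1_le (\<lambda>p. f p x *\<^sub>R d p) W"
      by (rule l1_le_mono[OF W]) (use d in \<open>auto intro: mult_right_le_one_le\<close>)
    from l1_fubini(3)[OF this]
    have "(\<Sum>\<^sub>\<infinity>p. f p x *\<^sub>R d p) = (\<Sum>\<^sub>\<infinity>j. \<Sum>\<^sub>\<infinity>m. f (j, m) x *\<^sub>R d (j, m))" ..
    also have "\<dots> = (\<Sum>\<^sub>\<infinity>j. \<Sum>\<^sub>\<infinity>m. \<phi> j m x *\<^sub>R c j m)"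
    proof -
      have nv: "norm v *\<^sub>R sgn v = v" for v :: 'a by (cases "v = 0") (simp_all add: sgn_div_norm)
      have "f (j, m) x *\<^sub>R d (j, m) = \<phi> j m x *\<^sub>R (norm (c j m) *\<^sub>R sgn (c j m))" for j m
        by (simp add: f_def d_def mult.commute)
      hence "f (j, m) x *\<^sub>R d (j, m) = \<phi> j m x *\<^sub>R c j m" for j m by (simp only: nv)
      thus ?thesis by simp
    qed
    also have "\<dots> = F x" by (rule phi_sum[OF c x, symmetric])
    finally show "F x = (\<Sum>\<^sub>\<infinity>p. f p x *\<^sub>R d p)" ..
  qed
qed

text \<open>
  By the inequality \<open>\<bar>u\<bar> \<le> l + u\<^sup>2 / l\<close> it suffices to find summable constants \<open>l k\<close> for which the functions
  \<open>(f k)\<^sup>2 / l k\<close> are still locally summable. A weighted sum, over countably many intervals that cover \<open>G\<close>, of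
  the bounds valid on these intervals does this.
\<close>

lemma analytic_majorant:
  fixes f :: "'k \<Rightarrow> real \<Rightarrow> real"
  assumes f: "locally_l1 G f" and ne: "G \<noteq> {}"
  obtains g where "\<And>x. x \<in> G \<Longrightarrow> \<exists>r w. ps_bound x r g w" "\<And>x. x \<in> G \<Longrightarrow> l1_le (\<lambda>k. f k x) (g x)"
    "\<And>x. x \<in> G \<Longrightarrow> 0 < g x"
proof -
  have "\<forall>x. \<exists>r w W. x \<in> G \<longrightarrow> 0 < r \<and> (\<forall>k. ps_bound x r (f k) (w k)) \<and> l1_le w W"
    using f unfolding locally_l1_def by blast
  then obtain r w W where rw: "\<And>x. x \<in> G \<Longrightarrow> 0 < r x" "\<And>x k. x \<in> G \<Longrightarrow> ps_bound x (r x) (f k) (w x k)"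
    "\<And>x. x \<in> G \<Longrightarrow> l1_le (w x) (W x)" by metis
  have W0: "0 \<le> W x" "0 \<le> w x k" if "x \<in> G" for x k
    using l1_le_nonneg[OF rw(3)[OF that]] ps_bound_nonneg[OF rw(2)[OF that]] by auto
  let ?B = "\<lambda>x. ball x (r x / 2)"
  obtain \<F> where \<F>: "\<F> \<subseteq> ?B ` G" "countable \<F>" "\<Union>\<F> = \<Union>(?B ` G)"
    using Lindelof[of "?B ` G"] by auto
  have "\<exists>C. countable C \<and> C \<subseteq> G \<and> \<F> = ?B ` C"
    using \<F>(1,2) countable_subset_image[of \<F> ?B G] by simp
  then obtain C where C: "countable C" "C \<subseteq> G" "\<F> = ?B ` C" by blast
  have cov: "\<exists>z\<in>C. x \<in> ?B z" if "x \<in> G" for x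
  proof -
    have "x \<in> \<Union>(?B ` G)" using rw(1)[OF that] that by force
    hence "x \<in> \<Union>\<F>" by (simp only: \<F>(3))
    thus ?thesis unfolding C(3) by blast
  qed
  have Cne: "C \<noteq> {}" using cov ne by blast
  define z where "z = from_nat_into C"
  have zG: "z n \<in> G" for n using from_nat_into[OF Cne] C(2) unfolding z_def by blast
  have z: "\<exists>n. x \<in> ?B (z n)" if x: "x \<in> G" for x
  proof -
    obtain u where "u \<in> C" "x \<in> ?B u" using cov[OF x] by blast
    moreover from this obtain n where "z n = u"
      using from_nat_into_surj[OF C(1)] unfolding z_def by blast
    ultimately show ?thesis by blast
  qed
  define b where "b p = (1 / 2) ^ fst p * (w (z (fst p)) (snd p) / (1 + W (z (fst p))))" for p
  have b: "l1_le b 2"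
  proof (rule l1_le_Sigma)
    show "l1_le (\<lambda>n. (1 / 2 :: real) ^ n) 2" using l1_le_geometric[of "1/2"] by simp
    fix n
    have "l1_le (\<lambda>k. b (n, k)) ((1 / 2) ^ n / (1 + W (z n)) * W (z n))"
      by (rule l1_le_scale[OF rw(3)[OF zG[of n]]]) (use W0[OF zG] in \<open>auto simp: b_def abs_mult\<close>)
    moreover have "W (z n) / (1 + W (z n)) \<le> 1" using W0(1)[OF zG[of n]] by simp
    hence "(1 / 2) ^ n * (W (z n) / (1 + W (z n))) \<le> (1 / 2) ^ n * 1" by (intro mult_left_mono) auto
    ultimately show "l1_le (\<lambda>k. b (n, k)) ((1 / 2) ^ n)" by (auto intro: l1_le_mono)
  qed
  have b0: "0 \<le> b p" for p using W0[OF zG] by (auto simp: b_def)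
  define l where "l k = (\<Sum>\<^sub>\<infinity>n. b (n, k))" for k
  have l1: "l1_le l 2" using l1_fubini(2)[OF l1_le_swap[OF b]] unfolding l_def by simp
  have bl: "b (n, k) \<le> l k" for n k
  proof -
    have "l1_le (\<lambda>n. b (n, k)) 2" using l1_le_section[OF l1_le_swap[OF b], of k] by simp
    hence "(\<lambda>n. b (n, k)) summable_on UNIV" by (rule l1_le_summable)
    from finite_sum_le_infsum[OF this, of "{n}"] show ?thesis using b0 by (simp add: l_def)
  qed
  have l0: "0 \<le> l k" for k using b0 bl order_trans by blast
  have lw: "w (z n) k * w (z n) k / l k \<le> 2 ^ n * (1 + W (z n)) * w (z n) k" for n k
  proof (cases "l k = 0")
    case False
    have "w (z n) k = 2 ^ n * (1 + W (z n)) * b (n, k)"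
      using W0(1)[OF zG[of n]] by (simp add: b_def power_divide)
    also have "\<dots> \<le> 2 ^ n * (1 + W (z n)) * l k"
      using W0(1)[OF zG[of n]] by (intro mult_left_mono bl) auto
    finally have "w (z n) k * w (z n) k \<le> (2 ^ n * (1 + W (z n)) * l k) * w (z n) k"
      by (rule mult_right_mono) (rule W0(2)[OF zG])
    thus ?thesis using False l0[of k] by (simp add: divide_le_eq ac_simps)
  qed (use W0[OF zG[of n]] in simp)
  have loc: "ps_bound x (r (z n) / 2) (f k) (w (z n) k)" if "x \<in> ?B (z n)" for x n k
    by (rule ps_bound_recentre[OF rw(2)[OF zG]])
       (use that rw(1)[OF zG] in \<open>auto simp: dist_norm abs_minus_commute\<close>)
  have sq: "locally_l1 G (\<lambda>k t. 1 / l k * (f k t * f k t))"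
    unfolding locally_l1_def
  proof
    fix x assume "x \<in> G"
    then obtain n where n: "x \<in> ?B (z n)" using z by blast
    have r: "0 < r (z n) / 2" using rw(1)[OF zG] by simp
    have "ps_bound x (r (z n) / 2) (\<lambda>t. 1 / l k * (f k t * f k t)) (norm (1 / l k) * (w (z n) k * w (z n) k))" for k
      by (intro ps_bound_mult ps_bound_const loc n r)
    moreover have "l1_le (\<lambda>k. norm (1 / l k) * (w (z n) k * w (z n) k)) (2 ^ n * (1 + W (z n)) * W (z n))"
      by (rule l1_le_scale[OF rw(3)[OF zG[of n]]]) (use lw[of n] l0 W0[OF zG[of n]] in \<open>auto simp: abs_mult\<close>)
    ultimately show "\<exists>r v W. 0 < r \<and> (\<forall>k. ps_bound x r (\<lambda>t. 1 / l k * (f k t * f k t)) (v k)) \<and> l1_le v W"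
      by (rule locally_l1_witness)
  qed
  define g where "g t = 3 + (\<Sum>\<^sub>\<infinity>k. 1 / l k * (f k t * f k t))" for t
  have gpos: "3 \<le> g t" for t unfolding g_def using l0 by (simp add: infsum_nonneg)
  show thesis
  proof (rule that[of g])
    fix x assume x: "x \<in> G"
    obtain r v W where v: "0 < r" "\<And>k. ps_bound x r (\<lambda>t. 1 / l k * (f k t * f k t)) (v k)" "l1_le v W"
      by (rule locally_l1E[OF sq x]) blast
    have "ps_bound x r g (norm (3::real) + W)"
      unfolding g_def by (intro ps_bound_add ps_bound_const ps_bound_infsum(1)[OF v(2,3)] v(1))
    thus "\<exists>r w. ps_bound x r g w" by blast
    show "0 < g x" using gpos[of x] by simp
    obtain n where n: "x \<in> ?B (z n)" using z[OF x] by blast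
    have le: "\<bar>f k x\<bar> \<le> l k + 1 / l k * (f k x * f k x)" for k
    proof (cases "l k = 0")
      case True
      hence "b (n, k) = 0" using bl[of n k] b0[of "(n, k)"] by simp
      hence "w (z n) k = 0" using W0(1)[OF zG[of n]] by (auto simp: b_def)
      hence "f k x = 0" using ps_bound_norm[OF loc[OF n], of x k] rw(1)[OF zG[of n]] by simp
      thus ?thesis using True by simp
    next
      case False
      hence lk: "0 < l k" using l0[of k] by simp
      have "\<bar>f k x\<bar> * l k \<le> l k * l k + f k x * f k x"
      proof -
        have "2 * (\<bar>f k x\<bar> * l k) \<le> f k x * f k x + l k * l k"
          using sum_squares_bound[of "\<bar>f k x\<bar>" "l k"] by (simp add: power2_eq_square mult.assoc)
        moreover have "0 \<le> \<bar>f k x\<bar> * l k" using lk by simp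
        ultimately show ?thesis by linarith
      qed
      hence "\<bar>f k x\<bar> \<le> (l k * l k + f k x * f k x) / l k" by (simp only: pos_le_divide_eq[OF lk])
      thus ?thesis using lk by (simp add: add_divide_distrib)
    qed
    have "l1_le (\<lambda>k. 1 / l k * (f k x * f k x)) (\<Sum>\<^sub>\<infinity>k. norm (1 / l k * (f k x * f k x)))"
      using ps_bound_infsum(2)[OF v(2,3), of x] v(1) l1_le_abs_summable unfolding l1_le_iff by auto
    from l1_le_add[OF l1 this]
    have "l1_le (\<lambda>k. f k x) (2 + (\<Sum>\<^sub>\<infinity>k. norm (1 / l k * (f k x * f k x))))"
      by (rule l1_le_mono) (use le in \<open>auto intro: order_trans[OF _ abs_ge_self]\<close>)
    thus "l1_le (\<lambda>k. f k x) (g x)"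
      by (rule l1_le_mono) (use l0 in \<open>auto simp: g_def abs_mult\<close>)
  qed
qed

section \<open>Solving equations with approximate solutions\<close>

text \<open>
  Solve for the remaining error again and again; it is halved each time.
\<close>

lemma approximately_onto_imp_onto:
  fixes L :: "'a::banach \<Rightarrow> 'b::real_normed_vector"
  assumes L: "bounded_linear L" and C: "0 \<le> C"
    and ap: "\<And>e. \<exists>s. norm s \<le> C * norm e \<and> norm (e - L s) \<le> norm e / 2"
  shows "\<exists>s. L s = e \<and> norm s \<le> 2 * C * norm e"
proof -
  interpret L: bounded_linear L by fact
  obtain S where S: "\<And>e. norm (S e) \<le> C * norm e" "\<And>e. norm (e - L (S e)) \<le> norm e / 2"
    using ap by metis
  define r where "r = rec_nat e (\<lambda>_ v. v - L (S v))"
  have r0: "r 0 = e" and rS: "\<And>n. r (Suc n) = r n - L (S (r n))" by (simp_all add: r_def)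
  have rn: "norm (r n) \<le> norm e * (1 / 2) ^ n" for n
  proof (induction n)
    case (Suc n)
    thus ?case using S(2)[of "r n"] by (simp add: rS)
  qed (simp add: r0)
  have l1: "l1_le (\<lambda>n. S (r n)) ((C * norm e) * (1 / (1 - 1 / 2)))"
  proof (rule l1_le_scale[OF l1_le_geometric])
    fix n
    have "norm (S (r n)) \<le> C * (norm e * (1 / 2) ^ n)"
      using S(1)[of "r n"] mult_left_mono[OF rn C] by (rule order_trans)
    thus "norm (S (r n)) \<le> (C * norm e) * norm ((1 / 2 :: real) ^ n)" by (simp add: mult.assoc)
  qed (use C in auto)
  define s where "s = (\<Sum>\<^sub>\<infinity>n. S (r n))"
  have part: "L (\<Sum>n<N. S (r n)) = e - r N" for N
    by (induction N) (simp_all add: r0 rS L.zero L.add)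
  have "(\<lambda>N. \<Sum>n<N. S (r n)) \<longlonglongrightarrow> s" using l1_le_sums(1)[OF l1] by (simp add: sums_def s_def)
  hence "(\<lambda>N. e - r N) \<longlonglongrightarrow> L s" using L.tendsto by (simp flip: part)
  moreover have "r \<longlonglongrightarrow> 0"
  proof (rule Lim_null_comparison)
    show "\<forall>\<^sub>F n in sequentially. norm (r n) \<le> norm e * (1 / 2) ^ n" using rn by simp
    show "(\<lambda>n. norm e * (1 / 2) ^ n) \<longlonglongrightarrow> 0" by (intro tendsto_mult_right_zero LIMSEQ_power_zero) auto
  qed
  hence "(\<lambda>N. e - r N) \<longlonglongrightarrow> e - 0" by (intro tendsto_diff tendsto_const)
  ultimately have "L s = e" using LIMSEQ_unique by fastforce
  moreover have "norm s \<le> 2 * C * norm e" using l1_le_infsum[OF l1] by (simp add: s_def ac_simps)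
  ultimately show ?thesis by blast
qed

text \<open>
  The open mapping theorem in quantitative form, from the Baire category theorem.
\<close>

lemma open_mapping_constant:
  fixes L :: "'a::banach \<Rightarrow> 'b::banach"
  assumes L: "bounded_linear L" and surj: "surj L"
  obtains C where "1 \<le> C" "\<And>e. \<exists>s. L s = e \<and> norm s \<le> C * norm e"
proof -
  interpret L: bounded_linear L by fact
  define D where "D n = closure (L ` ball 0 (real n))" for n
  have "\<exists>n. interior (D n) \<noteq> {}"
  proof (rule ccontr)
    assume "\<not> ?thesis"
    hence e: "interior (D n) = {}" for n by simp
    have "Met_TC.mtopology interior_of \<Union>(range D) = ({} :: 'b set)"
    proof (rule Met_TC.metric_Baire_category_alt)
      show "Met_TC.mcomplete TYPE('b)" by (simp add: complete_UNIV)
      show "countable (range D)" by simp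
      fix U assume "U \<in> range D"
      then obtain n where "U = D n" by blast
      thus "closedin Met_TC.mtopology U \<and> Met_TC.mtopology interior_of U = {}"
        using e[of n] by (simp add: D_def)
    qed
    moreover have "\<Union>(range D) = UNIV"
    proof -
      have "v \<in> \<Union>(range D)" for v
      proof -
        obtain s where s: "v = L s" using surj by blast
        obtain n where "norm s < real n" using reals_Archimedean2 by blast
        hence "v \<in> L ` ball 0 (real n)" unfolding s by (intro imageI) simp
        hence "v \<in> D n" unfolding D_def by (rule subsetD[OF closure_subset])
        thus ?thesis by blast
      qed
      thus ?thesis by blast
    qed
    ultimately show False by simp
  qed
  then obtain n z where "z \<in> interior (D n)" by blast
  then obtain \<epsilon> where \<epsilon>: "0 < \<epsilon>" "ball z \<epsilon> \<subseteq> D n" unfolding mem_interior by blast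
  have near: "\<exists>s. norm s < real n \<and> norm (L s - v) < \<epsilon> / 8" if "v \<in> ball z \<epsilon>" for v
  proof -
    have "v \<in> closure (L ` ball 0 (real n))" using \<epsilon>(2) that D_def by blast
    then obtain u where "u \<in> L ` ball 0 (real n)" "dist u v < \<epsilon> / 8"
      using \<epsilon>(1) unfolding closure_approachable by (metis divide_pos_pos zero_less_numeral)
    thus ?thesis by (auto simp: dist_norm)
  qed
  define C where "C = 4 * real n / \<epsilon>"
  have C: "0 \<le> C" using \<epsilon> by (simp add: C_def)
  have "\<exists>s. norm s \<le> C * norm e \<and> norm (e - L s) \<le> norm e / 2" for e
  proof (cases "e = 0")
    case True
    thus ?thesis by (intro exI[of _ 0]) (simp add: L.zero)
  next
    case False
    \<comment> \<open>The scaling by \<open>1 / k\<close> brings \<open>e\<close> to norm \<open>\<epsilon> / 2\<close>, inside the ball.\<close>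
    define k where "k = 2 * norm e / \<epsilon>"
    have k: "0 < k" using False \<epsilon> by (simp add: k_def)
    define u where "u = (1 / k) *\<^sub>R e"
    have nu: "norm u = \<epsilon> / 2" using False \<epsilon> by (simp add: u_def k_def)
    have "z + u \<in> ball z \<epsilon>" "z \<in> ball z \<epsilon>" using nu \<epsilon> by (auto simp: dist_norm)
    then obtain s1 s2 where s: "norm s1 < real n" "norm (L s1 - (z + u)) < \<epsilon> / 8"
      "norm s2 < real n" "norm (L s2 - z) < \<epsilon> / 8" using near by metis
    define s where "s = k *\<^sub>R (s1 - s2)"
    have "norm (s1 - s2) \<le> 2 * real n" using norm_triangle_ineq4[of s1 s2] s by simp
    hence "norm s \<le> k * (2 * real n)" using k by (simp add: s_def)
    also have "\<dots> = C * norm e" by (simp add: C_def k_def)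
    finally have 1: "norm s \<le> C * norm e" .
    have "norm ((L s2 - z) - (L s1 - (z + u))) \<le> \<epsilon> / 4"
      using norm_triangle_ineq4[of "L s2 - z" "L s1 - (z + u)"] s by simp
    moreover have "e - L s = k *\<^sub>R ((L s2 - z) - (L s1 - (z + u)))"
      using k by (simp add: s_def u_def L.scaleR L.diff algebra_simps)
    ultimately have "norm (e - L s) \<le> k * (\<epsilon> / 4)" using k by simp
    also have "\<dots> = norm e / 2" using \<epsilon> by (simp add: k_def)
    finally show ?thesis using 1 by blast
  qed
  from approximately_onto_imp_onto[OF L C this]
  have on: "\<exists>s. L s = e \<and> norm s \<le> 2 * C * norm e" for e .
  have "\<exists>s. L s = e \<and> norm s \<le> (2 * C + 1) * norm e" for e
  proof -
    obtain s where "L s = e" "norm s \<le> 2 * C * norm e" using on by blast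
    moreover have "2 * C * norm e \<le> (2 * C + 1) * norm e" by (intro mult_right_mono) auto
    ultimately show ?thesis by (metis order_trans)
  qed
  with that[of "2 * C + 1"] C show thesis by simp
qed

text \<open>
  A preimage under \<open>L\<close> is an approximate preimage under \<open>L'\<close>.
\<close>

lemma lifting_constant_perturb:
  fixes L L' :: "'a::banach \<Rightarrow>\<^sub>L 'b::real_normed_vector"
  assumes L: "\<And>e. \<exists>s. L s = e \<and> norm s \<le> C * norm e" and C: "0 \<le> C" and close: "norm (L - L') * C \<le> 1 / 2"
  shows "\<exists>s. L' s = e \<and> norm s \<le> 2 * C * norm e"
proof (rule approximately_onto_imp_onto[OF blinfun.bounded_linear_right C])
  fix e
  obtain s where s: "L s = e" "norm s \<le> C * norm e" using L by blast
  have "norm (e - L' s) = norm ((L - L') s)" using s by (simp add: blinfun.diff_left)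
  also have "\<dots> \<le> norm (L - L') * norm s" by (rule norm_blinfun)
  also have "\<dots> \<le> norm (L - L') * (C * norm e)" by (intro mult_left_mono s) auto
  also have "\<dots> \<le> (1 / 2) * norm e" unfolding mult.assoc[symmetric] by (intro mult_right_mono close) auto
  finally show "\<exists>s. norm s \<le> C * norm e \<and> norm (e - L' s) \<le> norm e / 2" using s by auto
qed

text \<open>
  The approximate lifts \<open>a e\<close> have an error that is a combination of elements \<open>E n e\<close> of the unit ball, with
  coefficients \<open>g n\<close> independent of \<open>e\<close>. Lifting these elements by the lift that is being constructed leads to the fixed point
  equation \<open>T e = a e + (\<Sum>n. g n T (E n e))\<close>. Its iteration \<open>S\<close> converges in a power
  series norm at every point, and the error of \<open>S N\<close> is at most \<open>(1/2) ^ N\<close>.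
\<close>

lemma uniform_lift_of_contraction:
  fixes g :: "'n \<Rightarrow> real \<Rightarrow> real" and E :: "'n \<Rightarrow> 'b::real_normed_vector \<Rightarrow> 'b"
    and a :: "'b \<Rightarrow> real \<Rightarrow> 'a::banach" and \<pi> :: "real \<Rightarrow> 'a \<Rightarrow>\<^sub>L 'b"
  assumes g: "locally_l1 G g" and half: "\<And>x. x \<in> G \<Longrightarrow> l1_le (\<lambda>n. g n x) (1 / 2)"
    and E: "\<And>n e. norm e \<le> 1 \<Longrightarrow> norm (E n e) \<le> 1"
    and a: "\<And>x. x \<in> G \<Longrightarrow> \<exists>r w. \<forall>e. norm e \<le> 1 \<longrightarrow> ps_bound x r (a e) w"
    and \<pi>a: "\<And>x e. x \<in> G \<Longrightarrow> norm e \<le> 1 \<Longrightarrow>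
        ((\<lambda>n. g n x *\<^sub>R E n e) has_sum (e - \<pi> x (a e x))) UNIV"
  obtains T :: "'b \<Rightarrow> real \<Rightarrow> 'a"
  where "\<And>x. x \<in> G \<Longrightarrow> \<exists>r w. \<forall>e. norm e \<le> 1 \<longrightarrow> ps_bound x r (T e) w"
    "\<And>x e. x \<in> G \<Longrightarrow> norm e \<le> 1 \<Longrightarrow> \<pi> x (T e x) = e"
proof -
  define S where "S = rec_nat (\<lambda>e t. 0) (\<lambda>_ S e t. a e t + (\<Sum>\<^sub>\<infinity>n. g n t *\<^sub>R S (E n e) t))"
  have S0: "S 0 e t = 0" and SS: "S (Suc N) e t = a e t + (\<Sum>\<^sub>\<infinity>n. g n t *\<^sub>R S N (E n e) t)" for N e t
    by (simp_all add: S_def)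
  define T where "T e t = (\<Sum>\<^sub>\<infinity>N. S (Suc N) e t - S N e t)" for e t
  have main: "\<exists>s w. 0 < s \<and> (\<forall>N e. norm e \<le> 1 \<longrightarrow> ps_bound x s (S N e) w) \<and>
      (\<forall>N e. norm e \<le> 1 \<longrightarrow> ps_bound x s (\<lambda>t. S (Suc N) e t - S N e t) ((3 / 4) ^ N * w))"
    if x: "x \<in> G" for x
  proof -
    obtain r w W where r: "0 < r" "\<And>n. ps_bound x r (g n) (w n)" "l1_le w W"
      by (rule locally_l1E[OF g x]) blast
    obtain q A where q: "\<And>e. norm e \<le> 1 \<Longrightarrow> ps_bound x q (a e) A" using a[OF x] by blast
    have A0: "0 \<le> A" and q0: "0 < q" using ps_bound_nonneg[OF q[of 0]] ps_bound_radius[OF q[of 0]] by auto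
    have W0: "0 \<le> W" using l1_le_nonneg[OF r(3)] .
    \<comment> \<open>On this radius the functions \<open>g n\<close> have norms with sum at most \<open>3/4\<close>, since their values at \<open>x\<close> have sum at most \<open>1/2\<close>.\<close>
    define s where "s = min q (min r (r / (4 * (W + 1))))"
    have s: "0 < s" "s \<le> q" "s \<le> r" using r(1) q0 W0 by (auto simp: s_def)
    have "s / r \<le> (r / (4 * (W + 1))) / r" using r(1) by (intro divide_right_mono) (auto simp: s_def)
    hence "s / r * W \<le> 1 / (4 * (W + 1)) * W" using W0 r(1) by (intro mult_right_mono) auto
    also have "\<dots> \<le> 1 / 4" using W0 by (simp add: field_simps)
    finally have sW: "s / r * W \<le> 1 / 4" .
    define v where "v n = norm (g n x) + s / r * w n" for n
    have gv: "ps_bound x s (g n) (v n)" for n unfolding v_def by (rule ps_bound_shrink'[OF r(2) s(1,3)])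
    have "l1_le (\<lambda>n. s / r * w n) (s / r * W)"
      by (rule l1_le_scale[OF r(3)]) (use s r(1) in \<open>auto simp: abs_mult\<close>)
    from l1_le_add[OF _ this] half[OF x, folded l1_le_norm[of "\<lambda>n. g n x"]]
    have "l1_le v (1 / 2 + s / r * W)" unfolding v_def by blast
    hence v: "l1_le v (3 / 4)" by (rule l1_le_mono) (use sW in auto)
    have step: "ps_bound x s (\<lambda>t. \<Sum>\<^sub>\<infinity>n. g n t *\<^sub>R h n t) (B * (3 / 4))"
      "\<And>t. \<bar>t - x\<bar> \<le> s \<Longrightarrow> l1_le (\<lambda>n. g n t *\<^sub>R h n t) (B * (3 / 4))"
      if h: "\<And>n. ps_bound x s (h n) B" for h :: "'n \<Rightarrow> real \<Rightarrow> 'a" and B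
    proof -
      have B: "0 \<le> B" using ps_bound_nonneg[OF h] .
      have l: "l1_le (\<lambda>n. v n * B) (B * (3 / 4))"
        by (rule l1_le_scale[OF v]) (use B in \<open>auto simp: abs_mult\<close>)
      show "ps_bound x s (\<lambda>t. \<Sum>\<^sub>\<infinity>n. g n t *\<^sub>R h n t) (B * (3 / 4))"
        by (rule ps_bound_infsum(1)[OF ps_bound_scaleR[OF gv h] l])
      show "l1_le (\<lambda>n. g n t *\<^sub>R h n t) (B * (3 / 4))" if "\<bar>t - x\<bar> \<le> s" for t
        by (rule ps_bound_infsum(2)[OF ps_bound_scaleR[OF gv h] l that])
    qed
    have SN: "ps_bound x s (S N e) (4 * A)" if "norm e \<le> 1" for N e
      using that
    proof (induction N arbitrary: e)
      case 0
      have "S 0 e = (\<lambda>_. 0)" by (simp add: S0 fun_eq_iff)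
      thus ?case using ps_bound_const[OF s(1), of x "0::'a"] A0 by (auto intro: ps_bound_mono)
    next
      case (Suc N)
      have "ps_bound x s (\<lambda>t. a e t + (\<Sum>\<^sub>\<infinity>n. g n t *\<^sub>R S N (E n e) t)) (A + (4 * A) * (3 / 4))"
        by (intro ps_bound_add ps_bound_shrink[OF q s(1,2)] step(1) Suc.IH E Suc.prems)
      thus ?case by (rule ps_bound_cong) (simp_all add: SS)
    qed
    have "ps_bound x s (\<lambda>t. S (Suc N) e t - S N e t) ((3 / 4) ^ N * (4 * A))" if "norm e \<le> 1" for N e
      using that
    proof (induction N arbitrary: e)
      case 0
      thus ?case using SN[of e "Suc 0"] by (simp add: S0)
    next
      case (Suc N)
      have "ps_bound x s (\<lambda>t. \<Sum>\<^sub>\<infinity>n. g n t *\<^sub>R (S (Suc N) (E n e) t - S N (E n e) t)) (((3 / 4) ^ N * (4 * A)) * (3 / 4))"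
        by (intro step(1) Suc.IH E Suc.prems)
      thus ?case
      proof (rule ps_bound_cong)
        fix t assume t: "\<bar>t - x\<bar> \<le> s"
        have "l1_le (\<lambda>n. g n t *\<^sub>R S M (E n e) t) ((4 * A) * (3 / 4))" for M
          by (intro step(2) SN E Suc.prems t)
        from infsum_diff_l1[OF this this, of "Suc N" N]
        show "S (Suc (Suc N)) e t - S (Suc N) e t = (\<Sum>\<^sub>\<infinity>n. g n t *\<^sub>R (S (Suc N) (E n e) t - S N (E n e) t))"
          by (simp add: SS[of "Suc N"] SS[of N] scaleR_diff_right)
      qed simp
    qed
    with SN s(1) show ?thesis by blast
  qed
  show thesis
  proof (rule that[of T])
    fix x assume x: "x \<in> G"
    obtain s w where s: "0 < s" "\<And>N e. norm e \<le> 1 \<Longrightarrow> ps_bound x s (S N e) w"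
      "\<And>N e. norm e \<le> 1 \<Longrightarrow> ps_bound x s (\<lambda>t. S (Suc N) e t - S N e t) ((3 / 4) ^ N * w)"
      using main[OF x] by blast
    have w0: "0 \<le> w" using ps_bound_nonneg[OF s(2)[of 0]] by simp
    have l: "l1_le (\<lambda>N. (3 / 4) ^ N * w) (w * (1 / (1 - 3 / 4)))"
      by (rule l1_le_scale[OF l1_le_geometric]) (use w0 in \<open>auto simp: abs_mult\<close>)
    have "ps_bound x s (T e) (w * (1 / (1 - 3 / 4)))" if "norm e \<le> 1" for e
      unfolding T_def by (rule ps_bound_infsum(1)[OF s(3)[OF that] l])
    thus "\<exists>r w. \<forall>e. norm e \<le> 1 \<longrightarrow> ps_bound x r (T e) w" by blast
    fix e :: 'b assume e: "norm e \<le> 1"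
    have "l1_le (\<lambda>N. S (Suc N) e x - S N e x) (w * (1 / (1 - 3 / 4)))"
      by (rule ps_bound_infsum(2)[OF s(3)[OF e] l]) (use s(1) in simp)
    hence "(\<lambda>N. \<Sum>k<N. S (Suc k) e x - S k e x) \<longlonglongrightarrow> T e x"
      using l1_le_sums(1) unfolding T_def sums_def by blast
    moreover have "(\<Sum>k<N. S (Suc k) e x - S k e x) = S N e x" for N
      using sum_lessThan_telescope[of "\<lambda>k. S k e x" N] by (simp add: S0)
    ultimately have "(\<lambda>N. S N e x) \<longlonglongrightarrow> T e x" by simp
    hence lim: "(\<lambda>N. \<pi> x (S N e x)) \<longlonglongrightarrow> \<pi> x (T e x)" by (intro tendsto_intros)
    have err: "norm (e - \<pi> x (S N e x)) \<le> (1 / 2) ^ N" if "norm e \<le> 1" for N e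
      using that
    proof (induction N arbitrary: e)
      case 0
      thus ?case by (simp add: S0 blinfun.zero_right)
    next
      case (Suc N)
      have bd: "l1_le (\<lambda>n. g n x *\<^sub>R S N (E n e) x) (w * (1 / 2))"
      proof (rule l1_le_scale[OF half[OF x]])
        fix n
        have "norm (S N (E n e) x) \<le> w" using ps_bound_norm[OF s(2)[OF E[OF Suc.prems]]] s(1) by simp
        from mult_left_mono[OF this, of "\<bar>g n x\<bar>"]
        show "norm (g n x *\<^sub>R S N (E n e) x) \<le> w * norm (g n x)" by (simp add: mult.commute)
      qed (rule w0)
      have "((\<lambda>n. \<pi> x (g n x *\<^sub>R S N (E n e) x)) has_sum \<pi> x (\<Sum>\<^sub>\<infinity>n. g n x *\<^sub>R S N (E n e) x)) UNIV"
        by (rule has_sum_bounded_linear[OF blinfun.bounded_linear_right has_sum_infsum[OF l1_le_summable[OF bd]]])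
      from has_sum_add[OF \<pi>a[OF x Suc.prems] has_sum_bounded_linear[OF bounded_linear_minus[OF bounded_linear_ident] this]]
      have hs: "((\<lambda>n. g n x *\<^sub>R (E n e - \<pi> x (S N (E n e) x))) has_sum (e - \<pi> x (S (Suc N) e x))) UNIV"
        by (simp add: SS blinfun.add_right blinfun.scaleR_right scaleR_diff_right algebra_simps)
      have l: "l1_le (\<lambda>n. g n x *\<^sub>R (E n e - \<pi> x (S N (E n e) x))) ((1 / 2) ^ N * (1 / 2))"
      proof (rule l1_le_scale[OF half[OF x]])
        show "norm (g n x *\<^sub>R (E n e - \<pi> x (S N (E n e) x))) \<le> (1 / 2) ^ N * norm (g n x)" for n
          using mult_left_mono[OF Suc.IH[OF E[OF Suc.prems]], of "\<bar>g n x\<bar>"] by (simp add: mult.commute)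
      qed simp
      have "norm (e - \<pi> x (S (Suc N) e x)) \<le> (1 / 2) ^ N * (1 / 2)"
        by (rule order_trans[OF norm_has_sum_bound[OF has_sum_infsum[OF l1_le_abs_summable[OF l]] hs]
              l1_le_infsum_norm[OF l]])
      thus ?case by simp
    qed
    have "(\<lambda>N. e - \<pi> x (S N e x)) \<longlonglongrightarrow> 0"
    proof (rule Lim_null_comparison)
      show "\<forall>\<^sub>F N in sequentially. norm (e - \<pi> x (S N e x)) \<le> (1 / 2) ^ N" using err[OF e] by simp
      show "(\<lambda>n. (1 / 2 :: real) ^ n) \<longlonglongrightarrow> 0" by (intro LIMSEQ_power_zero) auto
    qed
    moreover have "(\<lambda>N. e - \<pi> x (S N e x)) \<longlonglongrightarrow> e - \<pi> x (T e x)" by (intro tendsto_diff tendsto_const lim)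
    ultimately have "e - \<pi> x (T e x) = 0" using LIMSEQ_unique by blast
    thus "\<pi> x (T e x) = e" by simp
  qed
qed

section \<open>Analytic lifting through surjections\<close>

text \<open>
  A partition of unity into the functions \<open>\<phi> j 0\<close> for cells on which \<open>\<pi>\<close> varies little compared with the lifting
  constant \<open>C j\<close> yields approximate lifts. In the error
  \<open>\<Sum>j. \<phi> j 0 x (\<pi> (y j) - \<pi> x) (S j e)\<close> the expansion of \<open>\<pi>\<close> separates scalar functions from values. The hypothesis
  \<open>l1_le (\<lambda>k. f k x) 1\<close> makes the contributions of far cells small uniformly in \<open>x\<close>.
\<close>

lemma uniform_lift:
  fixes f :: "'k \<Rightarrow> real \<Rightarrow> real" and P :: "'k \<Rightarrow> 'a::banach \<Rightarrow>\<^sub>L 'b::banach"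
    and \<pi> :: "real \<Rightarrow> 'a \<Rightarrow>\<^sub>L 'b"
  assumes G: "open G" "connected G" "G \<noteq> {}"
    and f: "locally_l1 G f" "\<And>x. x \<in> G \<Longrightarrow> l1_le (\<lambda>k. f k x) 1" and P: "\<And>k. norm (P k) \<le> 1"
    and \<pi>: "\<And>x. x \<in> G \<Longrightarrow> \<pi> x = (\<Sum>\<^sub>\<infinity>k. f k x *\<^sub>R P k)" and surj: "\<And>x. x \<in> G \<Longrightarrow> surj (\<pi> x)"
  obtains T :: "'b \<Rightarrow> real \<Rightarrow> 'a"
  where "\<And>x. x \<in> G \<Longrightarrow> \<exists>r w. \<forall>e. norm e \<le> 1 \<longrightarrow> ps_bound x r (T e) w"
    "\<And>x e. x \<in> G \<Longrightarrow> norm e \<le> 1 \<Longrightarrow> \<pi> x (T e x) = e"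
proof -
  have fP: "l1_le (\<lambda>k. u k *\<^sub>R P k) B" if "l1_le u B" for u :: "'k \<Rightarrow> real" and B
    by (rule l1_le_mono[OF that _ order_refl]) (use P in \<open>simp add: mult_left_le\<close>)
  have \<pi>_diff: "\<pi> t - \<pi> u = (\<Sum>\<^sub>\<infinity>k. (f k t - f k u) *\<^sub>R P k)" if "t \<in> G" "u \<in> G" for t u
    using infsum_diff_l1[OF fP[OF f(2)[OF that(1)]] fP[OF f(2)[OF that(2)]]] \<pi> that
    by (simp add: scaleR_diff_left)
  define R where "R x r c \<longleftrightarrow> 1 \<le> c \<and>
      (\<forall>t. \<bar>t - x\<bar> \<le> r \<longrightarrow> (\<forall>e. \<exists>s. \<pi> t s = e \<and> norm s \<le> c * norm e)) \<and>
      (\<forall>t u. \<bar>t - x\<bar> \<le> r \<longrightarrow> \<bar>u - x\<bar> \<le> r \<longrightarrow> l1_le (\<lambda>k. f k t - f k u) (1 / (20 * c)))" for x r c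
  define Q where "Q x r \<longleftrightarrow> (\<forall>t. \<bar>t - x\<bar> \<le> r \<longrightarrow> t \<in> G) \<and> (\<exists>c. R x r c)" for x r
  obtain y \<rho> :: "int \<Rightarrow> real" where cells: "\<And>j. y j < y (j + 1)" "\<And>j. 0 < \<rho> j" "\<And>j. Q (y j) (\<rho> j)"
    "\<And>j. y (j + 2) \<le> y j + \<rho> j / 8" "\<And>j. y j \<le> y (j - 1) + \<rho> j / 8"
    "\<And>x. x \<in> G \<Longrightarrow> \<exists>j. y j \<le> x \<and> x < y (j + 1)"
  proof (rule subordinate_cells[OF G(2,3), of Q])
    show "Q z s" if "Q x r" "\<bar>z - x\<bar> + s \<le> r" "0 < s" for x r z s
    proof -
      have "\<bar>t - x\<bar> \<le> r" if "\<bar>t - z\<bar> \<le> s" for t using that \<open>\<bar>z - x\<bar> + s \<le> r\<close> by linarith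
      moreover from this have "R z s c" if "R x r c" for c using that unfolding R_def by simp
      ultimately show ?thesis using that(1) unfolding Q_def by blast
    qed
    show "\<exists>r>0. Q x r" if x: "x \<in> G" for x
    proof -
      obtain D where D: "1 \<le> D" "\<And>e. \<exists>s. \<pi> x s = e \<and> norm s \<le> D * norm e"
        by (rule open_mapping_constant[OF blinfun.bounded_linear_right surj[OF x]]) blast
      obtain e where e: "0 < e" "cball x e \<subseteq> G" using G(1) x open_contains_cball by blast
      obtain r w W where r: "0 < r" "\<And>k. ps_bound x r (f k) (w k)" "l1_le w W"
        by (rule locally_l1E[OF f(1) x]) blast
      have W: "0 \<le> W" using l1_le_nonneg[OF r(3)] .
      \<comment> \<open>Then \<open>\<pi>\<close> changes by at most \<open>1 / (80 D)\<close> and the lifting constant at most doubles to \<open>2 D\<close>.\<close>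
      define s where "s = min e (min r (r / (160 * D * (W + 1))))"
      have s: "0 < s" "s \<le> e" "s \<le> r" using e(1) r(1) W D(1) by (auto simp: s_def)
      have tG: "t \<in> G" if "\<bar>t - x\<bar> \<le> s" for t
        using e(2) s(2) that by (auto simp: dist_norm abs_minus_commute)
      have dx: "l1_le (\<lambda>k. f k t - f k x) (1 / (80 * D))" if t: "\<bar>t - x\<bar> \<le> s" for t
      proof -
        have "norm (f k t - f k x) \<le> (2 * s / r) * norm (w k)" for k
        proof -
          have "ps_bound x s (\<lambda>t. f k t - f k x) (norm (f k x - f k x) + s / r * (2 * w k))"
            by (rule ps_bound_shrink'[OF ps_bound_diff_const[OF r(2)] s(1,3)])
          from ps_bound_norm[OF this t] have "norm (f k t - f k x) \<le> (2 * s / r) * w k" by (simp add: ac_simps)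
          also have "\<dots> \<le> (2 * s / r) * norm (w k)" using s(1) r(1) by (intro mult_left_mono) auto
          finally show ?thesis .
        qed
        from l1_le_scale[OF r(3) this] s(1) r(1)
        have "l1_le (\<lambda>k. f k t - f k x) (2 * s / r * W)" by simp
        moreover have "2 * s / r * W \<le> 1 / (80 * D)"
        proof -
          have "s / r \<le> (r / (160 * D * (W + 1))) / r" using r(1) by (intro divide_right_mono) (auto simp: s_def)
          hence "s / r * (W + 1) \<le> (1 / (160 * D * (W + 1))) * (W + 1)"
            using W r(1) by (intro mult_right_mono) auto
          also have "\<dots> = 1 / (160 * D)" using W by simp
          finally have "s / r * (W + 1) \<le> 1 / (160 * D)" .
          moreover have "s / r * W \<le> s / r * (W + 1)" using s(1) r(1) by (intro mult_left_mono) auto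
          ultimately show ?thesis by simp
        qed
        ultimately show ?thesis by (auto intro: l1_le_mono)
      qed
      have "\<exists>v. \<pi> t v = e' \<and> norm v \<le> 2 * D * norm e'" if t: "\<bar>t - x\<bar> \<le> s" for t e'
      proof (rule lifting_constant_perturb[OF D(2)])
        have "norm (\<pi> t - \<pi> x) \<le> 1 / (80 * D)"
          unfolding \<pi>_diff[OF tG[OF t] x] by (rule l1_le_infsum[OF fP[OF dx[OF t]]])
        hence "norm (\<pi> x - \<pi> t) * D \<le> 1 / (80 * D) * D"
          using D(1) by (intro mult_right_mono) (auto simp: norm_minus_commute)
        thus "norm (\<pi> x - \<pi> t) * D \<le> 1 / 2" using D(1) by simp
      qed (use D(1) in simp)
      moreover have "l1_le (\<lambda>k. f k t - f k u) (1 / (20 * (2 * D)))" if "\<bar>t - x\<bar> \<le> s" "\<bar>u - x\<bar> \<le> s" for t u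
        using l1_le_diff[OF dx[OF that(1)] dx[OF that(2)]] D(1) by simp
      ultimately have "R x s (2 * D)" unfolding R_def using D(1) by simp
      hence "Q x s" unfolding Q_def using tG by blast
      with s(1) show ?thesis by blast
    qed
    show "t \<in> G" if "Q x r" "\<bar>t - x\<bar> \<le> r" for x r t using that unfolding Q_def by blast
  qed blast
  have yG: "y j \<in> G" for j using cells(2)[of j] cells(3)[of j] unfolding Q_def by simp
  have "\<forall>j. \<exists>c. R (y j) (\<rho> j) c" using cells(3) unfolding Q_def by blast
  then obtain C where R: "\<And>j. R (y j) (\<rho> j) (C j)" by metis
  have C: "1 \<le> C j" "\<bar>t - y j\<bar> \<le> \<rho> j \<Longrightarrow> \<exists>s. \<pi> t s = e \<and> norm s \<le> C j * norm e"
    "\<bar>t - y j\<bar> \<le> \<rho> j \<Longrightarrow> \<bar>u - y j\<bar> \<le> \<rho> j \<Longrightarrow> l1_le (\<lambda>k. f k t - f k u) (1 / (20 * C j))"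
    for j t u e using R[of j] unfolding R_def by auto
  have C0: "0 \<le> C j" "0 < C j" for j using C(1)[of j] by auto
  have "\<exists>s. \<pi> (y j) s = e \<and> norm s \<le> C j * norm e" for j e
    by (rule C(2)) (use cells(2)[of j] in simp)
  then obtain S where S: "\<And>j e. \<pi> (y j) (S j e) = e" "\<And>j e. norm (S j e) \<le> C j * norm e" by metis
  obtain \<eta> where "cell_system G y \<rho> \<eta> C" by (rule cell_system_exists[OF cells(1,2,4,5,6) C0(1)])
  then interpret cell_system G y \<rho> \<eta> C .
  have \<chi>1: "(\<Sum>\<^sub>\<infinity>j. \<phi> j 0 x) = 1" if x: "x \<in> G" for x
  proof -
    let ?c = "\<lambda>(j::int) m. if m = 0 then 1 else 0 :: real"
    have one: "(1::real) = (\<Sum>\<^sub>\<infinity>j. \<Sum>\<^sub>\<infinity>m. \<phi> j m x *\<^sub>R ?c j m)"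
    proof (rule phi_sum[where F = "\<lambda>_. 1", OF _ _ x])
      show "l1_le (\<lambda>m. \<rho> j ^ m *\<^sub>R ?c j m) (C j)" for j
        by (rule l1_le_finite_support[of "{0}"]) (use C(1) in auto)
      show "1 = (\<Sum>\<^sub>\<infinity>m. (t - y j) ^ m *\<^sub>R ?c j m)" for j t by (subst infsum_single[of 0]) auto
    qed
    have "(\<Sum>\<^sub>\<infinity>m. \<phi> j m x *\<^sub>R ?c j m) = \<phi> j 0 x" for j by (subst infsum_single[of 0]) auto
    with one show ?thesis by simp
  qed
  define a where "a e x = (\<Sum>\<^sub>\<infinity>j. \<phi> j 0 x *\<^sub>R S j e)" for e x
  define g where "g n x = C (fst n) * \<phi> (fst n) 0 x * (f (snd n) (y (fst n)) - f (snd n) x)" for n x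
  define E where "E n e = (1 / C (fst n)) *\<^sub>R P (snd n) (S (fst n) e)" for n e
  show thesis
  proof (rule uniform_lift_of_contraction[of G g E a \<pi>])
    show "locally_l1 G g" unfolding locally_l1_def
    proof
      fix x assume x: "x \<in> G"
      obtain r U W where U: "0 < r" "\<And>j. ps_bound x r (\<phi> j 0) (U j)" "\<And>j. 0 \<le> U j" "l1_le (\<lambda>j. U j * C j) W"
        by (rule phi_0_bounds[OF x]) blast
      obtain q w V where w: "0 < q" "\<And>k. ps_bound x q (f k) (w k)" "l1_le w V"
        by (rule locally_l1E[OF f(1) x]) blast
      have V: "0 \<le> V" using l1_le_nonneg[OF w(3)] .
      define s where "s = min r q"
      have s: "0 < s" "s \<le> r" "s \<le> q" using U(1) w(1) by (auto simp: s_def)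
      let ?w = "\<lambda>n. C (fst n) * U (fst n) * (norm (f (snd n) (y (fst n))) + w (snd n))"
      have "ps_bound x s (g n) (norm (C (fst n)) * U (fst n) * (norm (f (snd n) (y (fst n))) + w (snd n)))" for n
        unfolding g_def
        by (intro ps_bound_mult ps_bound_diff ps_bound_const ps_bound_shrink[OF U(2) s(1,2)]
            ps_bound_shrink[OF w(2) s(1,3)] s(1))
      hence "ps_bound x s (g n) (?w n)" for n using C0(1) by simp
      moreover have "l1_le ?w ((1 + V) * W)"
      proof (rule l1_le_Sigma)
        show "l1_le (\<lambda>j. (1 + V) * (U j * C j)) ((1 + V) * W)"
          by (rule l1_le_scale[OF U(4)]) (use V in \<open>auto simp: abs_mult\<close>)
        fix j
        have "l1_le (\<lambda>k. norm (f k (y j)) + w k) (1 + V)"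
          by (rule l1_le_add[OF _ w(3)]) (simp only: l1_le_norm f(2)[OF yG])
        from l1_le_scale[OF this, of "\<lambda>k. ?w (j, k)" "C j * U j"] U(3)[of j] C0[of j]
        have "l1_le (\<lambda>k. ?w (j, k)) (C j * U j * (1 + V))" by (simp add: abs_mult)
        thus "l1_le (\<lambda>k. ?w (j, k)) ((1 + V) * (U j * C j))" by (simp only: ac_simps)
      qed
      ultimately show "\<exists>r w W. 0 < r \<and> (\<forall>k. ps_bound x r (g k) (w k)) \<and> l1_le w W"
        by (rule locally_l1_witness)
    qed
    show half: "l1_le (\<lambda>n. g n x) (1 / 2)" if x: "x \<in> G" for x
    proof -
      obtain i where i: "y i \<le> x" "x < y (i + 1)" using cover[OF x] by blast
      let ?N = "{i - 1, i, i + 1}"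
      \<comment> \<open>Near cells contribute through the small variation of the \<open>f k\<close>, far ones through the small tails of \<open>\<phi> j 0\<close>.\<close>
      define v where "v j = (if j \<in> ?N then 1 / 20 else 0) + int_weight j / 25" for j
      have "l1_le v ((\<Sum>j\<in>?N. norm (1 / 20 :: real)) + 1 / 25 * 4)"
        unfolding v_def
      proof (rule l1_le_add)
        show "l1_le (\<lambda>j. if j \<in> ?N then 1 / 20 else 0 :: real) (\<Sum>j\<in>?N. norm (1 / 20 :: real))"
          by (rule l1_le_finite_support[of ?N]) auto
        show "l1_le (\<lambda>j. int_weight j / 25) (1 / 25 * 4)"
          by (rule l1_le_scale[OF int_weight_l1]) auto
      qed
      hence v: "l1_le v (1 / 2)" by (rule l1_le_mono) auto
      show ?thesis
      proof (rule l1_le_Sigma[OF _ v])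
        fix j
        show "l1_le (\<lambda>k. g (j, k) x) (v j)"
        proof (cases "j \<in> ?N")
          case True
          have "\<bar>x - y j\<bar> \<le> \<rho> j" using near_cell(1)[OF i True] rho_pos[of j] by simp
          hence "l1_le (\<lambda>k. f k (y j) - f k x) (1 / (20 * C j))" using C(3) rho_pos[of j] by simp
          from l1_le_scale[OF this, of "\<lambda>k. g (j, k) x" "C j"]
          have "l1_le (\<lambda>k. g (j, k) x) (C j * (1 / (20 * C j)))"
            using C0[of j] phi_0_le_1[of j x]
            by (simp add: g_def abs_mult mult_left_le_one_le mult.assoc)
          thus ?thesis by (rule l1_le_mono) (use True C0(2)[of j] int_weight_pos[of j] in \<open>auto simp: v_def\<close>)
        next
          case False
          have "l1_le (\<lambda>k. f k (y j) - f k x) (1 + 1)" by (rule l1_le_diff[OF f(2)[OF yG] f(2)[OF x]])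
          from l1_le_scale[OF this, of "\<lambda>k. g (j, k) x" "C j * \<bar>\<phi> j 0 x\<bar>"]
          have "l1_le (\<lambda>k. g (j, k) x) (C j * \<bar>\<phi> j 0 x\<bar> * (1 + 1))"
            using C0[of j] by (simp add: g_def abs_mult)
          thus ?thesis
            by (rule l1_le_mono) (use phi_0_far[OF i False] False in \<open>auto simp: v_def\<close>)
        qed
      qed
    qed
    show E: "norm (E n e) \<le> 1" if e: "norm e \<le> 1" for n e
    proof -
      have "norm (P (snd n) (S (fst n) e)) \<le> norm (P (snd n)) * norm (S (fst n) e)" by (rule norm_blinfun)
      also have "\<dots> \<le> 1 * (C (fst n) * norm e)" by (intro mult_mono P S) auto
      also have "\<dots> \<le> C (fst n)" using e C0(1) by (simp add: mult_left_le)
      finally show ?thesis using C0(2)[of "fst n"] by (simp add: E_def)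
    qed
    show "\<exists>r w. \<forall>e. norm e \<le> 1 \<longrightarrow> ps_bound x r (a e) w" if x: "x \<in> G" for x
    proof -
      obtain r U W where U: "0 < r" "\<And>j. ps_bound x r (\<phi> j 0) (U j)" "\<And>j. 0 \<le> U j" "l1_le (\<lambda>j. U j * C j) W"
        by (rule phi_0_bounds[OF x]) blast
      have "ps_bound x r (a e) W" if e: "norm e \<le> 1" for e
      proof -
        have "ps_bound x r (\<lambda>t. \<phi> j 0 t *\<^sub>R S j e) (U j * C j)" for j
        proof (rule ps_bound_mono[OF ps_bound_scaleR[OF U(2) ps_bound_const[OF U(1)]]])
          have "norm (S j e) \<le> C j * norm e" by (rule S)
          also have "\<dots> \<le> C j" using e C0(1) by (simp add: mult_left_le)
          finally show "U j * norm (S j e) \<le> U j * C j" using U(3) by (intro mult_left_mono)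
        qed
        from ps_bound_infsum(1)[OF this U(4)] show ?thesis unfolding a_def .
      qed
      thus ?thesis by blast
    qed
    show "((\<lambda>n. g n x *\<^sub>R E n e) has_sum (e - \<pi> x (a e x))) UNIV" if x: "x \<in> G" and e: "norm e \<le> 1" for x e
    proof -
      obtain r U W where U: "0 < r" "\<And>j. ps_bound x r (\<phi> j 0) (U j)" "\<And>j. 0 \<le> U j" "l1_le (\<lambda>j. U j * C j) W"
        by (rule phi_0_bounds[OF x]) blast
      have \<phi>U: "\<bar>\<phi> j 0 x\<bar> \<le> U j" for j using ps_bound_norm[OF U(2), of x] U(1) by simp
      have lS: "l1_le (\<lambda>j. \<phi> j 0 x *\<^sub>R S j e) W"
      proof (rule l1_le_mono[OF U(4) _ order_refl])
        fix j
        have "norm (S j e) \<le> C j * norm e" by (rule S)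
        also have "\<dots> \<le> C j" using e C0(1) by (simp add: mult_left_le)
        finally have "\<bar>\<phi> j 0 x\<bar> * norm (S j e) \<le> U j * C j" using \<phi>U U(3) C0(1) by (intro mult_mono) auto
        thus "norm (\<phi> j 0 x *\<^sub>R S j e) \<le> norm (U j * C j)" by simp
      qed
      have le: "l1_le (\<lambda>j. \<phi> j 0 x *\<^sub>R e) W"
      proof (rule l1_le_mono[OF U(4) _ order_refl])
        fix j
        have "\<bar>\<phi> j 0 x\<bar> * norm e \<le> U j * C j" using \<phi>U U(3) C(1)[of j] e by (intro mult_mono) auto
        thus "norm (\<phi> j 0 x *\<^sub>R e) \<le> norm (U j * C j)" by simp
      qed
      have lg: "l1_le (\<lambda>n. g n x *\<^sub>R E n e) (1 / 2)"
        by (rule l1_le_mono[OF half[OF x] _ order_refl]) (use E[OF e] in \<open>simp add: mult_left_le\<close>)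
      have inner: "(\<Sum>\<^sub>\<infinity>k. g (j, k) x *\<^sub>R E (j, k) e) = \<phi> j 0 x *\<^sub>R e - \<pi> x (\<phi> j 0 x *\<^sub>R S j e)" for j
      proof -
        have l: "l1_le (\<lambda>k. (f k (y j) - f k x) *\<^sub>R P k) (1 + 1)"
          by (rule fP[OF l1_le_diff[OF f(2)[OF yG] f(2)[OF x]]])
        have "bounded_linear (\<lambda>p. \<phi> j 0 x *\<^sub>R blinfun_apply p (S j e))"
          by (intro bounded_linear_intros)
        from infsum_bounded_linear_l1[OF this l]
        have "\<phi> j 0 x *\<^sub>R (\<pi> (y j) - \<pi> x) (S j e)
            = (\<Sum>\<^sub>\<infinity>k. \<phi> j 0 x *\<^sub>R ((f k (y j) - f k x) *\<^sub>R P k) (S j e))"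
          unfolding \<pi>_diff[OF yG x, symmetric] .
        also have "\<dots> = (\<Sum>\<^sub>\<infinity>k. g (j, k) x *\<^sub>R E (j, k) e)"
          using C0(2)[of j] by (simp add: g_def E_def blinfun.scaleR_left)
        finally show ?thesis by (simp add: blinfun.diff_left blinfun.scaleR_right S scaleR_diff_right)
      qed
      have "(\<Sum>\<^sub>\<infinity>n. g n x *\<^sub>R E n e) = (\<Sum>\<^sub>\<infinity>j. \<phi> j 0 x *\<^sub>R e - \<pi> x (\<phi> j 0 x *\<^sub>R S j e))"
        using l1_fubini(3)[OF lg] by (simp add: inner)
      also have "\<dots> = (\<Sum>\<^sub>\<infinity>j. \<phi> j 0 x *\<^sub>R e) - (\<Sum>\<^sub>\<infinity>j. \<pi> x (\<phi> j 0 x *\<^sub>R S j e))"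
      proof (rule infsum_diff_l1[OF le])
        show "l1_le (\<lambda>j. \<pi> x (\<phi> j 0 x *\<^sub>R S j e)) (norm (\<pi> x) * W)"
          by (rule l1_le_scale[OF lS norm_blinfun]) simp
      qed
      also have "(\<Sum>\<^sub>\<infinity>j. \<pi> x (\<phi> j 0 x *\<^sub>R S j e)) = \<pi> x (a e x)"
        unfolding a_def by (rule infsum_bounded_linear_l1[OF blinfun.bounded_linear_right lS, symmetric])
      also have "(\<Sum>\<^sub>\<infinity>j. \<phi> j 0 x *\<^sub>R e) = e"
      proof -
        have "l1_le (\<lambda>j. \<phi> j 0 x) W"
        proof (rule l1_le_mono[OF U(4) _ order_refl])
          fix j
          have "\<bar>\<phi> j 0 x\<bar> * 1 \<le> U j * C j" using \<phi>U U(3) C(1)[of j] by (intro mult_mono) auto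
          thus "norm (\<phi> j 0 x) \<le> norm (U j * C j)" by simp
        qed
        from infsum_bounded_linear_l1[OF bounded_linear_scaleR_left this, of e] show ?thesis by (simp add: \<chi>1[OF x])
      qed
      finally show ?thesis using has_sum_infsum[OF l1_le_summable[OF lg]] by simp
    qed
  qed (rule that)
qed

lemma ps_bound_Pair:
  assumes "ps_bound x r f w" "ps_bound x r g v"
  shows "ps_bound x r (\<lambda>t. (f t, g t)) (w + v)"
proof -
  have "ps_bound x r (\<lambda>t. (f t, 0)) (1 * w)"
    by (rule ps_bound_linear[OF assms(1)]) (auto intro!: bounded_linear_intros simp: norm_Pair)
  moreover have "ps_bound x r (\<lambda>t. (0, g t)) (1 * v)"
    by (rule ps_bound_linear[OF assms(2)]) (auto intro!: bounded_linear_intros simp: norm_Pair)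
  ultimately have "ps_bound x r (\<lambda>t. (f t, 0) + (0, g t)) (1 * w + 1 * v)" by (rule ps_bound_add)
  thus ?thesis by simp
qed

text \<open>
  The pair \<open>(\<pi>, b)\<close> is expanded at once, which gives the same scalar functions for both. Dividing by an analytic majorant
  makes these functions bounded and does not change the equation.
\<close>

lemma analytic_lift_connected:
  fixes \<pi> :: "real \<Rightarrow> 'a::banach \<Rightarrow>\<^sub>L 'b::banach" and b :: "real \<Rightarrow> 'b"
  assumes G: "open G" "connected G" "G \<noteq> {}"
    and \<pi>: "\<pi> real_analytic_on G" and b: "b real_analytic_on G"
    and surj: "\<And>x. x \<in> G \<Longrightarrow> surj (\<pi> x)"
  shows "\<exists>a. a real_analytic_on G \<and> (\<forall>x\<in>G. \<pi> x (a x) = b x)"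
proof -
  have "(\<lambda>t. (\<pi> t, b t)) real_analytic_on G"
    unfolding real_analytic_on_iff
  proof
    fix x assume x: "x \<in> G"
    obtain r w where r: "ps_bound x r \<pi> w" using \<pi> x unfolding real_analytic_on_iff by blast
    obtain q v where q: "ps_bound x q b v" using b x unfolding real_analytic_on_iff by blast
    have m: "0 < min r q" using ps_bound_radius[OF r] ps_bound_radius[OF q] by simp
    have "ps_bound x (min r q) (\<lambda>t. (\<pi> t, b t)) (w + v)"
      by (intro ps_bound_Pair ps_bound_shrink[OF r m] ps_bound_shrink[OF q m]) auto
    thus "\<exists>r w. ps_bound x r (\<lambda>t. (\<pi> t, b t)) w" by blast
  qed
  then obtain f :: "int \<times> nat \<Rightarrow> real \<Rightarrow> real" and c :: "int \<times> nat \<Rightarrow> ('a \<Rightarrow>\<^sub>L 'b) \<times> 'b"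
    where f: "locally_l1 G f" and c: "\<And>p. norm (c p) \<le> 1"
      and F: "\<And>x. x \<in> G \<Longrightarrow> (\<pi> x, b x) = (\<Sum>\<^sub>\<infinity>p. f p x *\<^sub>R c p)"
    by (rule global_expansion[OF G]) blast
  have nP: "norm (fst (c p)) \<le> 1" "norm (snd (c p)) \<le> 1" for p
    using c[of p] norm_fst_le[of "fst (c p)" "snd (c p)"] norm_snd_le[of "snd (c p)" "fst (c p)"] by auto
  obtain g where g: "\<And>x. x \<in> G \<Longrightarrow> \<exists>r w. ps_bound x r g w" "\<And>x. x \<in> G \<Longrightarrow> l1_le (\<lambda>k. f k x) (g x)"
    "\<And>x. x \<in> G \<Longrightarrow> 0 < g x" by (rule analytic_majorant[OF f G(3)]) blast
  define h where "h x = 1 / g x" for x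
  have h: "\<exists>r w. ps_bound x r h w" if x: "x \<in> G" for x
  proof -
    obtain r w where r: "ps_bound x r g w" using g(1)[OF x] by blast
    obtain s u where "ps_bound x s (\<lambda>t. 1 / g t) u"
      by (rule ps_bound_inverse[OF r]) (use g(3)[OF x] in auto)
    thus ?thesis unfolding h_def by blast
  qed
  have hpos: "0 < h x" if "x \<in> G" for x using g(3)[OF that] by (simp add: h_def)
  define f' where "f' k x = h x * f k x" for k x
  have f': "locally_l1 G f'" unfolding f'_def by (rule locally_l1_mult[OF f h])
  have f'1: "l1_le (\<lambda>k. f' k x) 1" if x: "x \<in> G" for x
  proof -
    have "l1_le (\<lambda>k. f' k x) (h x * g x)"
      by (rule l1_le_scale[OF g(2)[OF x]]) (use hpos[OF x] in \<open>auto simp: f'_def abs_mult\<close>)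
    thus ?thesis using g(3)[OF x] by (simp add: h_def)
  qed
  define \<pi>' where "\<pi>' x = h x *\<^sub>R \<pi> x" for x
  have l: "l1_le (\<lambda>p. f' p x *\<^sub>R c p) 1" if x: "x \<in> G" for x
    by (rule l1_le_mono[OF f'1[OF x] _ order_refl]) (use c in \<open>simp add: mult_left_le\<close>)
  have F': "(\<pi>' x, h x *\<^sub>R b x) = (\<Sum>\<^sub>\<infinity>p. f' p x *\<^sub>R c p)" if x: "x \<in> G" for x
  proof -
    have l': "l1_le (\<lambda>p. f p x *\<^sub>R c p) (g x)"
      by (rule l1_le_mono[OF g(2)[OF x] _ order_refl]) (use c in \<open>simp add: mult_left_le\<close>)
    have "(\<pi>' x, h x *\<^sub>R b x) = h x *\<^sub>R (\<pi> x, b x)" by (simp add: \<pi>'_def)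
    also have "\<dots> = (\<Sum>\<^sub>\<infinity>p. h x *\<^sub>R (f p x *\<^sub>R c p))"
      unfolding F[OF x] by (rule infsum_bounded_linear_l1[OF bounded_linear_scaleR_right l'])
    finally show ?thesis by (simp add: f'_def)
  qed
  have \<pi>'_eq: "\<pi>' x = (\<Sum>\<^sub>\<infinity>p. f' p x *\<^sub>R fst (c p))" if x: "x \<in> G" for x
    using infsum_bounded_linear_l1[OF bounded_linear_fst l[OF x]] by (simp flip: F'[OF x])
  have b'_eq: "h x *\<^sub>R b x = (\<Sum>\<^sub>\<infinity>p. f' p x *\<^sub>R snd (c p))" if x: "x \<in> G" for x
    using infsum_bounded_linear_l1[OF bounded_linear_snd l[OF x]] by (simp flip: F'[OF x])
  have surj': "surj (\<pi>' x)" if x: "x \<in> G" for x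
  proof (rule surjI)
    fix v
    show "\<pi>' x (inv (\<pi> x) ((1 / h x) *\<^sub>R v)) = v"
      using hpos[OF x] surj_f_inv_f[OF surj[OF x]] by (simp add: \<pi>'_def blinfun.scaleR_left)
  qed
  obtain T where T: "\<And>x. x \<in> G \<Longrightarrow> \<exists>r w. \<forall>e. norm e \<le> 1 \<longrightarrow> ps_bound x r (T e) w"
    "\<And>x e. x \<in> G \<Longrightarrow> norm e \<le> 1 \<Longrightarrow> \<pi>' x (T e x) = e"
  proof (rule uniform_lift[OF G f', of "\<lambda>p. fst (c p)" \<pi>'])
    show "l1_le (\<lambda>k. f' k x) 1" if "x \<in> G" for x by (rule f'1[OF that])
    show "\<pi>' x = (\<Sum>\<^sub>\<infinity>p. f' p x *\<^sub>R fst (c p))" if "x \<in> G" for x by (rule \<pi>'_eq[OF that])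
    show "surj (\<pi>' x)" if "x \<in> G" for x by (rule surj'[OF that])
  qed (rule nP(1), rule that)
  define a where "a x = (\<Sum>\<^sub>\<infinity>p. f' p x *\<^sub>R T (snd (c p)) x)" for x
  have tm: "\<exists>r W v. (\<forall>p. ps_bound x r (\<lambda>t. f' p t *\<^sub>R T (snd (c p)) t) (v p)) \<and> l1_le v W" if x: "x \<in> G" for x
  proof -
    obtain r w W where r: "0 < r" "\<And>k. ps_bound x r (f' k) (w k)" "l1_le w W"
      by (rule locally_l1E[OF f' x]) blast
    obtain q v where q: "\<And>e. norm e \<le> 1 \<Longrightarrow> ps_bound x q (T e) v" using T(1)[OF x] by blast
    have q0: "0 < q" "0 \<le> v" using ps_bound_radius[OF q[of 0]] ps_bound_nonneg[OF q[of 0]] by auto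
    define s where "s = min r q"
    have s: "0 < s" "s \<le> r" "s \<le> q" using r(1) q0 by (auto simp: s_def)
    have "ps_bound x s (\<lambda>t. f' p t *\<^sub>R T (snd (c p)) t) (w p * v)" for p
      by (intro ps_bound_scaleR ps_bound_shrink[OF r(2) s(1,2)] ps_bound_shrink[OF q s(1,3)] nP)
    moreover have "l1_le (\<lambda>p. w p * v) (v * W)"
      by (rule l1_le_scale[OF r(3)]) (use q0 in \<open>auto simp: abs_mult\<close>)
    ultimately show ?thesis by (intro exI[of _ s] exI[of _ "v * W"] exI[of _ "\<lambda>p. w p * v"]) blast
  qed
  have "a real_analytic_on G" unfolding real_analytic_on_iff
  proof
    fix x assume "x \<in> G"
    then obtain r W v where "\<And>p. ps_bound x r (\<lambda>t. f' p t *\<^sub>R T (snd (c p)) t) (v p)" "l1_le v W"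
      using tm by blast
    from ps_bound_infsum(1)[OF this] show "\<exists>r w. ps_bound x r a w" unfolding a_def by blast
  qed
  moreover have "\<pi> x (a x) = b x" if x: "x \<in> G" for x
  proof -
    obtain r W v where rv: "\<And>p. ps_bound x r (\<lambda>t. f' p t *\<^sub>R T (snd (c p)) t) (v p)" "l1_le v W"
      using tm[OF x] by blast
    have la: "l1_le (\<lambda>p. f' p x *\<^sub>R T (snd (c p)) x) W"
      by (rule ps_bound_infsum(2)[OF rv]) (use ps_bound_radius[OF rv(1)] in simp)
    have "\<pi>' x (a x) = (\<Sum>\<^sub>\<infinity>p. \<pi>' x (f' p x *\<^sub>R T (snd (c p)) x))"
      unfolding a_def by (rule infsum_bounded_linear_l1[OF blinfun.bounded_linear_right la])
    also have "\<dots> = (\<Sum>\<^sub>\<infinity>p. f' p x *\<^sub>R snd (c p))"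
      by (simp add: blinfun.scaleR_right T(2)[OF x nP(2)])
    also have "\<dots> = h x *\<^sub>R b x" by (rule b'_eq[OF x, symmetric])
    finally show ?thesis using hpos[OF x] by (simp add: \<pi>'_def blinfun.scaleR_left)
  qed
  ultimately show ?thesis by blast
qed

text \<open>
  The components of \<open>G\<close> are open, so lifts chosen independently on them fit together.
\<close>

theorem analytic_lift:
  fixes \<pi> :: "real \<Rightarrow> 'a::banach \<Rightarrow>\<^sub>L 'b::banach" and b :: "real \<Rightarrow> 'b"
  assumes G: "open G" and \<pi>: "\<pi> real_analytic_on G" and b: "b real_analytic_on G"
    and surj: "\<And>x. x \<in> G \<Longrightarrow> surj (\<pi> x)"
  shows "\<exists>a. a real_analytic_on G \<and> (\<forall>x\<in>G. \<pi> x (a x) = b x)"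
proof -
  let ?C = "connected_component_set G"
  have "\<exists>a. a real_analytic_on (?C x) \<and> (\<forall>t\<in>?C x. \<pi> t (a t) = b t)" if x: "x \<in> G" for x
  proof (rule analytic_lift_connected)
    have sub: "?C x \<subseteq> G" by (rule connected_component_subset)
    show "open (?C x)" using G by (rule open_connected_component)
    show "connected (?C x)" by simp
    show "?C x \<noteq> {}" using connected_component_refl[OF x] by blast
    show "\<pi> real_analytic_on ?C x" "b real_analytic_on ?C x"
      using \<pi> b sub unfolding real_analytic_on_def by blast+
    show "surj (\<pi> t)" if "t \<in> ?C x" for t using surj sub that by blast
  qed
  hence "\<forall>K\<in>?C ` G. \<exists>a. a real_analytic_on K \<and> (\<forall>t\<in>K. \<pi> t (a t) = b t)" by blast
  then obtain A where A: "\<And>K. K \<in> ?C ` G \<Longrightarrow> A K real_analytic_on K \<and> (\<forall>t\<in>K. \<pi> t (A K t) = b t)" by metis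
  define a where "a t = A (?C t) t" for t
  have self: "x \<in> ?C x" if "x \<in> G" for x using that by simp
  have "a real_analytic_on G" unfolding real_analytic_on_iff
  proof
    fix x assume x: "x \<in> G"
    have "A (?C x) real_analytic_on ?C x" using A x by blast
    then obtain r w where r: "ps_bound x r (A (?C x)) w" using self[OF x] unfolding real_analytic_on_iff by blast
    have "open (?C x)" using G by (rule open_connected_component)
    then obtain e where e: "0 < e" "cball x e \<subseteq> ?C x" using self[OF x] open_contains_cball by blast
    define s where "s = min r e"
    have s: "0 < s" "s \<le> r" "s \<le> e" using ps_bound_radius[OF r] e(1) by (auto simp: s_def)
    have "ps_bound x s a w"
    proof (rule ps_bound_cong[OF ps_bound_shrink[OF r s(1,2)]])
      fix t assume "\<bar>t - x\<bar> \<le> s"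
      hence "t \<in> cball x e" using s(3) by (simp add: dist_norm abs_minus_commute)
      hence "t \<in> ?C x" using e(2) by blast
      hence "?C t = ?C x" by (metis connected_component_eq)
      thus "a t = A (?C x) t" by (simp add: a_def)
    qed simp
    thus "\<exists>r w. ps_bound x r a w" by blast
  qed
  moreover have "\<pi> x (a x) = b x" if "x \<in> G" for x using A[of "?C x"] self[OF that] that by (simp add: a_def)
  ultimately show ?thesis by blast
qed

section \<open>Quasinilpotent elements\<close>

interpretation scaleC: module "scaleC :: complex \<Rightarrow> 'a::complex_banach_algebra_1 \<Rightarrow> 'a"
proof
  fix x :: 'a
  have "(1::real) *\<^sub>R x = complex_of_real 1 *\<^sub>C x" by (rule scaleR_scaleC)
  thus "(1::complex) *\<^sub>C x = x" by simp
qed (simp_all add: scaleC_add_right scaleC_add_left scaleC_scaleC)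

lemma power_scaleC:
  fixes q :: "'a::complex_banach_algebra_1"
  shows "(z *\<^sub>C q) ^ n = (z ^ n) *\<^sub>C (q ^ n)"
  by (induction n) (simp_all add: mult_scaleC_left mult_scaleC_right scaleC_scaleC power_commutes)

lemma geometric_sum_times:
  fixes u :: "'a::ring_1"
  shows "(\<Sum>i<n. u ^ i) * (1 - u) = 1 - u ^ n"
proof (induction n)
  case (Suc n)
  have "(\<Sum>i<Suc n. u ^ i) * (1 - u) = (\<Sum>i<n. u ^ i) * (1 - u) + (u ^ n - u ^ n * u)"
    by (simp add: distrib_right right_diff_distrib)
  thus ?case by (simp add: Suc.IH power_Suc2 del: power_Suc)
qed simp

text \<open>
  Averaging a power series over the roots of unity removes all powers strictly between \<open>0\<close> and \<open>n\<close>; this is how the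
  powers of an element are recovered from its resolvent below.
\<close>

lemma sum_roots_of_unity_power:
  fixes n i :: nat
  assumes "i < n"
  defines "\<omega> \<equiv> exp (2 * of_real pi * \<i> * of_nat 1 / of_nat n) :: complex"
  shows "(\<Sum>k<n. (\<omega> ^ k) ^ i) = (if i = 0 then of_nat n else 0)"
proof (cases "i = 0")
  case False
  have n: "1 \<le> n" using assms by simp
  have "\<omega> ^ i = exp (2 * of_real pi * \<i> * of_nat i / of_nat n)"
    unfolding \<omega>_def exp_of_nat_mult[symmetric] by (simp add: field_simps)
  hence "\<omega> ^ i = 1 \<longleftrightarrow> n dvd i" using complex_root_unity_eq_1[OF n, of i] by simp
  hence ne: "\<omega> ^ i \<noteq> 1" using False assms(1) by (auto dest: dvd_imp_le)
  have "\<omega> ^ n = 1" unfolding \<omega>_def using n by (intro complex_root_unity) simp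
  hence one: "(\<omega> ^ i) ^ n = 1" by (metis mult.commute power_mult power_one)
  have "(\<Sum>k<n. (\<omega> ^ k) ^ i) = (\<Sum>k<n. (\<omega> ^ i) ^ k)"
    by (simp add: mult.commute flip: power_mult)
  also have "\<dots> * (1 - \<omega> ^ i) = 0" using geometric_sum_times[of "\<omega> ^ i" n] one by simp
  hence "(\<Sum>k<n. (\<omega> ^ i) ^ k) = 0" using ne by simp
  finally show ?thesis using False by simp
qed simp

text \<open>
  If one of two mutually inverse elements is close to \<open>1\<close>, the other one is under control.
\<close>

lemma norm_right_inverse_le:
  fixes X M :: "'a::real_normed_algebra_1"
  assumes "X * M = 1"
  shows "norm (1 - M) \<le> 1 / 2 \<Longrightarrow> norm X \<le> 2"
    and "norm (1 - X) \<le> 1 / 2 \<Longrightarrow> norm (1 - M) \<le> 2 * norm (1 - X)"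
proof -
  assume h: "norm (1 - M) \<le> 1 / 2"
  have "X = X * (1 - M) + 1" using assms by (simp add: algebra_simps)
  hence "norm X \<le> norm (X * (1 - M)) + 1" by (metis norm_one norm_triangle_ineq)
  also have "norm (X * (1 - M)) \<le> norm X * (1 / 2)"
    by (rule order_trans[OF norm_mult_ineq mult_left_mono[OF h]]) simp
  finally show "norm X \<le> 2" by simp
next
  assume h: "norm (1 - X) \<le> 1 / 2"
  have e: "M - 1 = (1 - X) * M" using assms by (simp add: algebra_simps)
  have "norm M \<le> norm (M - 1) + 1" using norm_triangle_ineq[of "M - 1" 1] by simp
  also have "norm (M - 1) \<le> 1 / 2 * norm M"
    unfolding e by (rule order_trans[OF norm_mult_ineq mult_right_mono[OF h]]) simp
  finally have "norm M \<le> 2" by simp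
  hence "norm ((1 - X) * M) \<le> norm (1 - X) * 2"
    by (intro order_trans[OF norm_mult_ineq] mult_left_mono) auto
  thus "norm (1 - M) \<le> 2 * norm (1 - X)" unfolding e[symmetric] by (simp add: norm_minus_commute)
qed

text \<open>
  By the resolvent identity; for \<open>z\<close> near \<open>w\<close> it also bounds \<open>norm (R z)\<close> by \<open>2 * norm (R w)\<close>.
\<close>

lemma resolvent_continuous:
  fixes R :: "complex \<Rightarrow> 'a::complex_banach_algebra_1"
  assumes R: "\<And>z. R z * (1 - z *\<^sub>C q) = 1" "\<And>z. (1 - z *\<^sub>C q) * R z = 1"
  shows "continuous_on UNIV R"
  unfolding continuous_on_iff
proof (intro ballI allI impI)
  fix w :: complex and e :: real assume e: "0 < e"
  have eq: "R z - R w = (z - w) *\<^sub>C (R z * q * R w)" for z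
  proof -
    have "R z - R w = R z * ((1 - w *\<^sub>C q) * R w) - (R z * (1 - z *\<^sub>C q)) * R w" by (simp only: R mult_1_left mult_1_right)
    also have "\<dots> = R z * ((1 - w *\<^sub>C q) - (1 - z *\<^sub>C q)) * R w" by (simp add: algebra_simps)
    also have "(1 - w *\<^sub>C q) - (1 - z *\<^sub>C q) = (z - w) *\<^sub>C q" by (simp add: scaleC.scale_left_diff_distrib)
    finally show ?thesis by (simp add: mult_scaleC_left mult_scaleC_right)
  qed
  define K where "K = norm q * norm (R w)"
  have K: "0 \<le> K" by (simp add: K_def)
  have le: "norm (R z - R w) \<le> cmod (z - w) * (norm (R z) * K)" for z
    unfolding eq norm_scaleC K_def
    by (intro mult_left_mono order_trans[OF norm_mult_ineq])
       (auto simp: mult.assoc intro!: order_trans[OF mult_right_mono[OF norm_mult_ineq]])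
  define d where "d = min (1 / (2 * (K + 1))) (e / (2 * (norm (R w) + 1) * (K + 1)))"
  have d: "0 < d" using K e by (auto simp: d_def intro!: divide_pos_pos mult_pos_pos add_nonneg_pos)
  show "\<exists>d>0. \<forall>z\<in>UNIV. dist z w < d \<longrightarrow> dist (R z) (R w) < e"
  proof (intro exI[of _ d] conjI ballI impI d)
    fix z assume "dist z w < d"
    hence z: "cmod (z - w) < d" by (simp add: dist_norm)
    have "cmod (z - w) * K \<le> 1 / (2 * (K + 1)) * (K + 1)"
      using z K by (intro mult_mono) (auto simp: d_def)
    also have "\<dots> = 1 / 2" using K by (simp add: divide_simps)
    finally have h: "cmod (z - w) * K \<le> 1 / 2" .
    have "norm (R z) \<le> norm (R w) + norm (R z - R w)" by (metis add.commute diff_add_cancel norm_triangle_ineq)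
    also have "norm (R z - R w) \<le> (cmod (z - w) * K) * norm (R z)" using le[of z] by (simp add: ac_simps)
    also have "\<dots> \<le> 1 / 2 * norm (R z)" by (intro mult_right_mono h) simp
    finally have Rz: "norm (R z) \<le> 2 * norm (R w)" by simp
    have "norm (R z - R w) \<le> cmod (z - w) * (2 * norm (R w) * K)"
      by (rule order_trans[OF le]) (intro mult_left_mono mult_right_mono Rz K, simp)
    also have "\<dots> \<le> cmod (z - w) * (2 * (norm (R w) + 1) * (K + 1))"
      using K by (intro mult_left_mono mult_mono) auto
    also have "\<dots> < d * (2 * (norm (R w) + 1) * (K + 1))"
      using z K by (intro mult_strict_right_mono mult_pos_pos) (auto intro: add_nonneg_pos)
    also have "\<dots> \<le> (e / (2 * (norm (R w) + 1) * (K + 1))) * (2 * (norm (R w) + 1) * (K + 1))"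
      using K by (intro mult_right_mono) (auto simp: d_def)
    also have "\<dots> = e"
    proof -
      have "0 < 2 * (norm (R w) + 1) * (K + 1)" using K by (intro mult_pos_pos add_nonneg_pos) auto
      moreover have "e / c * c = e" if "0 < c" for c using that by simp
      ultimately show ?thesis by blast
    qed
    finally show "dist (R z) (R w) < e" by (simp add: dist_norm)
  qed
qed

lemma resolvent_exists:
  fixes q :: "'a::complex_banach_algebra_1"
  assumes "spectrum q = {0}"
  shows "\<exists>R. R * (1 - z *\<^sub>C q) = 1 \<and> (1 - z *\<^sub>C q) * R = 1"
proof (cases "z = 0")
  case True
  thus ?thesis by (intro exI[of _ 1]) simp
next
  case False
  hence "1 / z \<notin> spectrum q" using assms by simp
  then obtain y where y: "(q - (1 / z) *\<^sub>C 1) * y = 1" "y * (q - (1 / z) *\<^sub>C 1) = 1"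
    unfolding spectrum_def by blast
  have e: "1 - z *\<^sub>C q = (- z) *\<^sub>C (q - (1 / z) *\<^sub>C 1)"
    using False by (simp add: scaleC.scale_right_diff_distrib)
  show ?thesis
    using y False by (intro exI[of _ "(- (1 / z)) *\<^sub>C y"]) (simp add: e mult_scaleC_left mult_scaleC_right)
qed

text \<open>
  Rickart's proof of the spectral radius formula. The average \<open>M n z\<close> of the resolvent \<open>R = (1 - z q)\<^sup>-\<^sup>1\<close> over the points
  \<open>\<omega> z\<close>, \<open>\<omega> ^ n = 1\<close>, is inverse to \<open>X n z = 1 - z ^ n q ^ n\<close>. If \<open>t ^ n q ^ n\<close> tends to \<open>0\<close>, then \<open>M n t\<close> tends to \<open>1\<close>. By the uniform
  continuity of \<open>R\<close>, \<open>M n t'\<close> stays near \<open>1\<close> for \<open>t'\<close> slightly larger than \<open>t\<close>, so \<open>t' ^ n q ^ n\<close> stays bounded. Thus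
  the set of good \<open>t\<close> can be enlarged by steps of a fixed length.
\<close>

lemma quasinilpotent_powers:
  fixes q :: "'a::complex_banach_algebra_1"
  assumes q: "spectrum q = {0}" and t0: "0 \<le> t0"
  shows "(\<lambda>n. t0 ^ n * norm (q ^ n)) \<longlonglongrightarrow> 0"
proof -
  obtain R where R: "\<And>z. R z * (1 - z *\<^sub>C q) = 1" "\<And>z. (1 - z *\<^sub>C q) * R z = 1"
    using resolvent_exists[OF q] by metis
  define s where "s = t0 + 1"
  have "uniformly_continuous_on (cball 0 s) R"
    by (intro compact_uniformly_continuous continuous_on_subset[OF resolvent_continuous[of R q]] R) auto
  then obtain d where d: "0 < d" "\<And>z w. z \<in> cball 0 s \<Longrightarrow> w \<in> cball 0 s \<Longrightarrow> dist w z < d \<Longrightarrow> dist (R w) (R z) < 1 / 3"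
    unfolding uniformly_continuous_on_def by (metis zero_less_divide_iff zero_less_numeral zero_less_one)
  \<comment> \<open>The bound \<open>1\<close> keeps \<open>t + \<delta>\<close> inside the disc of radius \<open>s\<close>.\<close>
  define \<delta> where "\<delta> = min (d / 2) 1"
  have \<delta>: "0 < \<delta>" "\<delta> < d" "\<delta> \<le> 1" using d(1) by (auto simp: \<delta>_def)
  define \<omega> where "\<omega> n = exp (2 * of_real pi * \<i> * of_nat 1 / of_nat n)" for n :: nat
  define M where "M n z = (1 / real n) *\<^sub>R (\<Sum>k<n. R (\<omega> n ^ k * z))" for n z
  define X where "X n z = 1 - (z ^ n) *\<^sub>C (q ^ n)" for n z
  have XM: "X n z * M n z = 1" if n: "0 < n" for n z
  proof -
    have "X n z * R (\<omega> n ^ k * z) = (\<Sum>i<n. ((\<omega> n ^ k) ^ i * z ^ i) *\<^sub>C q ^ i)" for k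
    proof -
      let ?u = "(\<omega> n ^ k * z) *\<^sub>C q"
      have "\<omega> n ^ n = 1" unfolding \<omega>_def using n by (intro complex_root_unity) simp
      hence "(\<omega> n ^ k) ^ n = 1" by (metis mult.commute power_mult power_one)
      hence "X n z = 1 - ?u ^ n" by (simp add: X_def power_scaleC power_mult_distrib)
      also have "\<dots> = (\<Sum>i<n. ?u ^ i) * (1 - ?u)" by (rule geometric_sum_times[symmetric])
      finally have "X n z * R (\<omega> n ^ k * z) = (\<Sum>i<n. ?u ^ i) * ((1 - ?u) * R (\<omega> n ^ k * z))"
        by (simp add: mult.assoc)
      thus ?thesis by (simp add: R power_scaleC power_mult_distrib)
    qed
    hence "X n z * (\<Sum>k<n. R (\<omega> n ^ k * z)) = (\<Sum>k<n. \<Sum>i<n. ((\<omega> n ^ k) ^ i * z ^ i) *\<^sub>C q ^ i)"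
      by (simp add: sum_distrib_left)
    also have "\<dots> = (\<Sum>i<n. \<Sum>k<n. ((\<omega> n ^ k) ^ i * z ^ i) *\<^sub>C q ^ i)" by (rule sum.swap)
    also have "\<dots> = (\<Sum>i<n. ((\<Sum>k<n. (\<omega> n ^ k) ^ i) * z ^ i) *\<^sub>C q ^ i)"
      by (simp add: scaleC.scale_sum_left sum_distrib_right)
    also have "\<dots> = (\<Sum>i<n. (if i = 0 then of_nat n else 0) *\<^sub>C q ^ i)"
      using sum_roots_of_unity_power[of _ n, folded \<omega>_def] by (intro sum.cong) auto
    also have "\<dots> = (\<Sum>i<n. if i = 0 then of_nat n *\<^sub>C 1 else 0)" by (intro sum.cong) auto
    also have "\<dots> = of_nat n *\<^sub>C 1" using n by simp
    also have "\<dots> = real n *\<^sub>R 1" by (simp add: scaleR_scaleC)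
    finally show ?thesis using n by (simp add: M_def)
  qed
  have nX: "norm (1 - X n (of_real t)) = t ^ n * norm (q ^ n)" if "0 \<le> t" for n t
    using that by (simp add: X_def norm_scaleC norm_power)
  define good where "good t \<longleftrightarrow> (\<lambda>n. t ^ n * norm (q ^ n)) \<longlonglongrightarrow> 0" for t :: real
  have step: "good t''" if t: "good t" "0 \<le> t" "t \<le> t0" "0 \<le> t''" "t'' < t + \<delta>" for t t''
  proof -
    define t' where "t' = t + \<delta>"
    have t': "0 < t'" "t'' < t'" "t' \<le> s" using t \<delta> by (auto simp: t'_def s_def)
    have "\<forall>\<^sub>F n in sequentially. t ^ n * norm (q ^ n) < 1 / 12"
      using t(1) unfolding good_def by (rule order_tendstoD) simp
    hence ev: "\<forall>\<^sub>F n in sequentially. t' ^ n * norm (q ^ n) \<le> 3"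
      using eventually_gt_at_top[of 0]
    proof eventually_elim
      case (elim n)
      have a: "norm (1 - X n (of_real t)) \<le> 1 / 12" using elim(1) nX[OF t(2)] by simp
      hence a': "norm (1 - M n (of_real t)) \<le> 1 / 6"
        using norm_right_inverse_le(2)[OF XM[OF elim(2)], of "of_real t"] by simp
      have "norm (M n (of_real t') - M n (of_real t)) \<le> 1 / 3"
      proof -
        have one: "norm (R (\<omega> n ^ k * of_real t') - R (\<omega> n ^ k * of_real t)) \<le> 1 / 3" for k
        proof -
          have "cmod (\<omega> n) = 1" by (simp add: \<omega>_def norm_exp_eq_Re)
          hence nk: "cmod (\<omega> n ^ k) = 1" by (simp add: norm_power)
          have nt: "cmod (\<omega> n ^ k * of_real t') = t'" "cmod (\<omega> n ^ k * of_real t) = t"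
            using t(2) t'(1) by (simp_all add: norm_mult nk)
          have "cmod (\<omega> n ^ k * of_real t' - \<omega> n ^ k * of_real t) = \<delta>"
            using \<delta> by (simp add: norm_mult nk t'_def flip: right_diff_distrib of_real_diff)
          hence "dist (\<omega> n ^ k * of_real t') (\<omega> n ^ k * of_real t) < d" using \<delta> by (simp add: dist_norm)
          moreover have "\<omega> n ^ k * of_real t' \<in> cball 0 s" "\<omega> n ^ k * of_real t \<in> cball 0 s"
            using t t' \<delta> nt by (auto simp: s_def)
          ultimately have "dist (R (\<omega> n ^ k * of_real t')) (R (\<omega> n ^ k * of_real t)) < 1 / 3"
            by (intro d(2))
          thus ?thesis by (simp add: dist_norm)
        qed
        have "norm (\<Sum>k<n. R (\<omega> n ^ k * of_real t') - R (\<omega> n ^ k * of_real t)) \<le> (\<Sum>k<n. 1 / 3)"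
          by (rule order_trans[OF norm_sum sum_mono[OF one]])
        thus ?thesis using elim(2)
          by (simp add: M_def field_simps flip: scaleR_right_diff_distrib sum_subtractf)
      qed
      hence "norm (1 - M n (of_real t')) \<le> 1 / 2"
        using norm_triangle_ineq[of "1 - M n (of_real t)" "M n (of_real t) - M n (of_real t')"] a'
        by (simp add: norm_minus_commute)
      hence "norm (X n (of_real t')) \<le> 2" by (rule norm_right_inverse_le(1)[OF XM[OF elim(2)]])
      hence "norm (1 - X n (of_real t')) \<le> 3" using norm_triangle_ineq4[of 1 "X n (of_real t')"] by simp
      thus ?case using nX[of t'] t'(1) by simp
    qed
    show ?thesis unfolding good_def
    proof (rule Lim_null_comparison)
      show "\<forall>\<^sub>F n in sequentially. norm (t'' ^ n * norm (q ^ n)) \<le> 3 * (t'' / t') ^ n"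
        using ev
      proof eventually_elim
        case (elim n)
        have "t'' ^ n * norm (q ^ n) = (t'' / t') ^ n * (t' ^ n * norm (q ^ n))"
          using t' by (simp add: power_divide)
        also have "\<dots> \<le> (t'' / t') ^ n * 3" using t t' elim by (intro mult_left_mono) auto
        finally show ?case using t by simp
      qed
      show "(\<lambda>n. 3 * (t'' / t') ^ n) \<longlonglongrightarrow> 0"
        using t t' by (intro tendsto_mult_right_zero LIMSEQ_power_zero) auto
    qed
  qed
  have "good 0" unfolding good_def
    by (rule tendsto_eventually) (auto intro!: eventually_sequentiallyI[of 1] simp: power_0_left)
  \<comment> \<open>The minimum avoids leaving the interval on which \<open>R\<close> is uniformly continuous.\<close>
  hence "good (min t0 (real k * (\<delta> / 2)))" for k
  proof (induction k)
    case 0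
    thus ?case using t0 by simp
  next
    case (Suc k)
    show ?case by (rule step[OF Suc.IH[OF Suc.prems]]) (use t0 \<delta> in \<open>auto simp: min_def field_simps\<close>)
  qed
  moreover obtain k where "t0 / (\<delta> / 2) < real k" using reals_Archimedean2 by blast
  hence "min t0 (real k * (\<delta> / 2)) = t0" using \<delta> by (simp add: field_simps min_def)
  ultimately have "good t0" by metis
  thus ?thesis by (simp add: good_def)
qed

section \<open>Polynomials and the inverse square root in a Banach algebra\<close>

lemma poly_at_eq_sum:
  assumes "degree p \<le> n"
  shows "poly_at p x = (\<Sum>i\<le>n. coeff p i *\<^sub>R x ^ i)"
  unfolding poly_at_def using assms
  by (intro sum.mono_neutral_left) (auto simp: coeff_eq_0)

lemma poly_at_0 [simp]: "poly_at 0 x = 0"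
  by (simp add: poly_at_def)

lemma poly_at_pCons: "poly_at (pCons c p) x = c *\<^sub>R 1 + x * poly_at p x"
proof -
  have "poly_at (pCons c p) x = (\<Sum>i\<le>Suc (degree p). coeff (pCons c p) i *\<^sub>R x ^ i)"
    by (rule poly_at_eq_sum) (simp add: degree_pCons_le)
  also have "\<dots> = c *\<^sub>R 1 + (\<Sum>i\<le>degree p. coeff p i *\<^sub>R x ^ Suc i)"
    by (subst sum.atMost_Suc_shift) simp
  also have "(\<Sum>i\<le>degree p. coeff p i *\<^sub>R x ^ Suc i) = x * poly_at p x"
    by (simp add: poly_at_def sum_distrib_left)
  finally show ?thesis .
qed

lemma poly_at_1 [simp]: "poly_at 1 x = 1"
  by (simp add: one_pCons poly_at_pCons)

lemma poly_at_add: "poly_at (p + q) x = poly_at p x + poly_at q x"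
proof -
  let ?n = "max (degree p) (degree q)"
  have "poly_at (p + q) x = (\<Sum>i\<le>?n. coeff (p + q) i *\<^sub>R x ^ i)"
    by (rule poly_at_eq_sum) (rule degree_add_le_max)
  also have "\<dots> = poly_at p x + poly_at q x"
    by (subst (1 2) poly_at_eq_sum[where n = ?n]) (auto simp: scaleR_add_left sum.distrib)
  finally show ?thesis .
qed

lemma poly_at_smult: "poly_at (smult c p) x = c *\<^sub>R poly_at p x"
  by (subst poly_at_eq_sum[where n = "degree p"]) (auto simp: degree_smult_le poly_at_def scaleR_sum_right)

lemma poly_at_diff: "poly_at (p - q) x = poly_at p x - poly_at q x"
  using poly_at_add[of p "- q" x] poly_at_smult[of "- 1" q x] by simp

lemma poly_at_sum: "poly_at (\<Sum>i\<in>I. p i) x = (\<Sum>i\<in>I. poly_at (p i) x)"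
  by (induction I rule: infinite_finite_induct) (simp_all add: poly_at_add)

lemma poly_at_mult: "poly_at (p * q) x = poly_at p x * poly_at q x"
proof (induction p)
  case (pCons c p)
  thus ?case by (simp add: poly_at_add poly_at_smult poly_at_pCons distrib_right mult.assoc)
qed simp

lemma poly_at_commute: "poly_at p x * poly_at q x = poly_at q x * poly_at p x"
  by (metis mult.commute poly_at_mult)

lemma poly_at_dvd: "p dvd r \<Longrightarrow> poly_at p x = 0 \<Longrightarrow> poly_at r x = 0"
  by (auto simp: dvd_def poly_at_mult)

lemma poly_at_hom:
  assumes "linear h" "\<And>x y. h (x * y) = h x * h y" "h 1 = 1"
  shows "h (poly_at p x) = poly_at p (h x)"
proof -
  interpret linear h by fact
  show ?thesis by (induction p) (simp_all add: zero poly_at_pCons add scale assms)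
qed

text \<open>
  Reversing products is harmless because all factors are polynomials in one element.
\<close>

lemma poly_at_antihom:
  assumes "linear h" "\<And>x y. h (x * y) = h y * h x" "h 1 = 1"
  shows "h (poly_at p x) = poly_at p (h x)"
proof -
  interpret linear h by fact
  have c: "poly_at p y * y = y * poly_at p y" for p and y :: 'b
    using poly_at_commute[of p y "[:0, 1:]"] by (simp add: poly_at_pCons)
  show ?thesis by (induction p) (simp_all add: zero poly_at_pCons add scale assms c)
qed

lemma ps_bound_poly_at:
  fixes f :: "real \<Rightarrow> 'a::{real_normed_algebra_1, banach}"
  assumes "ps_bound x r f w"
  shows "\<exists>v. ps_bound x r (\<lambda>t. poly_at p (f t)) v"
proof (induction p)
  case 0
  show ?case using ps_bound_const[OF ps_bound_radius[OF assms], of x "0::'a"] by auto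
next
  case (pCons c p)
  then obtain v where v: "ps_bound x r (\<lambda>t. poly_at p (f t)) v" by blast
  show ?case unfolding poly_at_pCons
    using ps_bound_add[OF ps_bound_const[OF ps_bound_radius[OF assms]] ps_bound_mult[OF assms v]] by blast
qed

lemma prod_linear_dvd:
  fixes lam :: "'i \<Rightarrow> 'a::field"
  assumes "finite I" "inj_on lam I" "\<And>i. i \<in> I \<Longrightarrow> poly r (lam i) = 0"
  shows "(\<Prod>i\<in>I. [:- lam i, 1:]) dvd r"
  using assms
proof (induction I rule: finite_induct)
  case (insert k I)
  let ?P = "\<Prod>i\<in>I. [:- lam i, 1:]"
  have "?P dvd r" using insert by auto
  then obtain s where s: "r = ?P * s" by (auto simp: dvd_def)
  have "poly ?P (lam k) \<noteq> 0" using insert.hyps insert.prems(1) by (auto simp: poly_prod)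
  moreover have "poly ?P (lam k) * poly s (lam k) = 0" using insert.prems(2)[of k] s by simp
  ultimately have "[:- lam k, 1:] dvd s" by (simp add: poly_eq_0_iff_dvd)
  hence "[:- lam k, 1:] * ?P dvd s * ?P" by (intro mult_dvd_mono) simp_all
  thus ?case unfolding prod.insert[OF insert.hyps(1,2)] s by (simp only: mult.commute[of ?P s])
qed simp

definition lagrange :: "('i \<Rightarrow> real) \<Rightarrow> 'i set \<Rightarrow> 'i \<Rightarrow> real poly" where
  "lagrange lam I i = smult (1 / (\<Prod>j\<in>I - {i}. lam i - lam j)) (\<Prod>j\<in>I - {i}. [:- lam j, 1:])"

lemma poly_lagrange:
  assumes "finite I" "inj_on lam I" "i \<in> I" "k \<in> I"
  shows "poly (lagrange lam I i) (lam k) = (if i = k then 1 else 0)"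
proof (cases "i = k")
  case True
  have "(\<Prod>j\<in>I - {k}. lam k - lam j) \<noteq> 0"
    using assms by (auto dest: inj_onD)
  thus ?thesis using True by (simp add: lagrange_def poly_prod)
next
  case False
  have "(\<Prod>j\<in>I - {i}. lam k - lam j) = 0" using False assms by (auto intro!: prod_zero)
  thus ?thesis using False by (simp add: lagrange_def poly_prod)
qed

text \<open>
  The coefficients of the binomial series of \<open>(1 + 4 q)\<^sup>-\<^sup>1\<^sup>/\<^sup>2\<close>.
\<close>

definition isqrt_coeff :: "nat \<Rightarrow> real" where
  "isqrt_coeff n = ((- 1 / 2) gchoose n) * 4 ^ n"

definition inverse_sqrt :: "'a::{real_normed_algebra_1, banach} \<Rightarrow> 'a" where
  "inverse_sqrt q = (\<Sum>\<^sub>\<infinity>n. isqrt_coeff n *\<^sub>R q ^ n)"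

lemma isqrt_coeff_bound: "\<bar>isqrt_coeff n\<bar> \<le> 4 ^ n"
proof -
  have "\<bar>(- 1 / 2 :: real) gchoose n\<bar> \<le> 1"
  proof (induction n)
    case (Suc n)
    let ?g = "\<lambda>k. (- 1 / 2 :: real) gchoose k"
    have "real (Suc n) * ?g (Suc n) = (- 1 / 2 - real n) * ?g n"
      using gbinomial_mult_1[of "- 1 / 2 :: real" n] by (simp add: algebra_simps)
    hence "\<bar>real (Suc n) * ?g (Suc n)\<bar> = \<bar>(- 1 / 2 - real n) * ?g n\<bar>" by (rule arg_cong)
    hence "real (Suc n) * \<bar>?g (Suc n)\<bar> = \<bar>- 1 / 2 - real n\<bar> * \<bar>?g n\<bar>" by (simp only: abs_mult abs_of_nat)
    also have "\<bar>- 1 / 2 - real n\<bar> = 1 / 2 + real n" by simp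
    also have "(1 / 2 + real n) * \<bar>?g n\<bar> \<le> (1 / 2 + real n) * 1" by (intro mult_left_mono Suc.IH) auto
    also have "\<dots> \<le> real (Suc n) * 1" by simp
    finally show ?case by (simp only: mult_le_cancel_left_pos of_nat_0_less_iff zero_less_Suc)
  qed simp
  hence "\<bar>(- 1 / 2 :: real) gchoose n\<bar> * 4 ^ n \<le> 1 * 4 ^ n" by (intro mult_right_mono) auto
  thus ?thesis by (simp add: isqrt_coeff_def abs_mult)
qed

text \<open>
  Vandermonde's identity: the square of the binomial series with exponent \<open>-1/2\<close> is the one with exponent \<open>-1\<close>.
\<close>

lemma isqrt_coeff_convolution: "(\<Sum>i\<le>n. isqrt_coeff i * isqrt_coeff (n - i)) = (- 4) ^ n"
proof -
  have "(\<Sum>i\<le>n. isqrt_coeff i * isqrt_coeff (n - i))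
      = (\<Sum>i\<le>n. ((- 1 / 2) gchoose i) * ((- 1 / 2) gchoose (n - i)) * 4 ^ n)"
    by (intro sum.cong) (auto simp: isqrt_coeff_def mult.assoc mult.left_commute simp flip: power_add)
  also have "\<dots> = ((- 1 / 2 + - 1 / 2) gchoose n) * 4 ^ n"
    using gbinomial_Vandermonde[of "- 1 / 2 :: real" "- 1 / 2" n]
    by (simp add: atMost_atLeast0 flip: sum_distrib_right)
  also have "(- 1 / 2 + - 1 / 2 :: real) gchoose n = (- 1) ^ n"
    using gbinomial_negated_upper[of "- 1 :: real" n] by (simp add: gbinomial_of_nat_symmetric flip: binomial_gbinomial)
  finally show ?thesis by (simp flip: power_mult_distrib)
qed

text \<open>
  The number \<open>4\<close> bounds the growth of the coefficients \<open>isqrt_coeff\<close>.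
\<close>

definition summable_powers :: "'a::{real_normed_algebra_1, banach} \<Rightarrow> bool" where
  "summable_powers q \<longleftrightarrow> (\<exists>W. l1_le (\<lambda>n. 4 ^ n *\<^sub>R q ^ n) W)"

lemma inverse_sqrt_l1:
  assumes "summable_powers q"
  obtains W where "l1_le (\<lambda>n. isqrt_coeff n *\<^sub>R q ^ n) W"
proof -
  obtain W where "l1_le (\<lambda>n. 4 ^ n *\<^sub>R q ^ n) W" using assms unfolding summable_powers_def by blast
  hence "l1_le (\<lambda>n. isqrt_coeff n *\<^sub>R q ^ n) W"
    by (rule l1_le_mono) (auto intro: mult_right_mono isqrt_coeff_bound)
  with that show thesis .
qed

lemma inverse_sqrt_square:
  assumes "summable_powers q"
  shows "(inverse_sqrt q * inverse_sqrt q) * (1 + 4 *\<^sub>R q) = 1"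
proof -
  let ?c = "\<lambda>n. isqrt_coeff n *\<^sub>R q ^ n"
  obtain W where W: "l1_le ?c W" by (rule inverse_sqrt_l1[OF assms])
  have s: "inverse_sqrt q = (\<Sum>n. ?c n)"
    using l1_le_sums(1)[OF W] by (simp add: inverse_sqrt_def sums_iff)
  have "(\<lambda>k. \<Sum>i\<le>k. ?c i * ?c (k - i)) sums (inverse_sqrt q * inverse_sqrt q)"
    unfolding s by (rule Cauchy_product_sums) (rule l1_le_sums(2)[OF W])+
  moreover have "(\<Sum>i\<le>k. ?c i * ?c (k - i)) = (- 4 *\<^sub>R q) ^ k" for k
  proof -
    have "(\<Sum>i\<le>k. ?c i * ?c (k - i)) = (\<Sum>i\<le>k. (isqrt_coeff i * isqrt_coeff (k - i)) *\<^sub>R q ^ k)"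
      by (intro sum.cong) (auto simp flip: power_add)
    also have "\<dots> = (- 4) ^ k *\<^sub>R q ^ k" by (simp flip: scaleR_left.sum add: isqrt_coeff_convolution)
    also have "\<dots> = ((- 4) *\<^sub>R q) ^ k" by (rule scaleR_power[symmetric])
    finally show ?thesis by simp
  qed
  ultimately have g: "(\<lambda>k. (- 4 *\<^sub>R q) ^ k) sums (inverse_sqrt q * inverse_sqrt q)" by simp
  from sums_mult2[OF g, of "1 + 4 *\<^sub>R q"]
  have "(\<lambda>k. (- 4 *\<^sub>R q) ^ k - (- 4 *\<^sub>R q) ^ Suc k) sums ((inverse_sqrt q * inverse_sqrt q) * (1 + 4 *\<^sub>R q))"
    by (simp add: distrib_left power_Suc2 del: power_Suc)
  moreover have "(\<lambda>k. (- 4 *\<^sub>R q) ^ k - (- 4 *\<^sub>R q) ^ Suc k) sums ((- 4 *\<^sub>R q) ^ 0 - 0)"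
    by (rule telescope_sums') (rule summable_LIMSEQ_zero[OF sums_summable[OF g]])
  ultimately show ?thesis by (metis diff_zero power_0 sums_unique2)
qed

lemma inverse_sqrt_commute:
  assumes "summable_powers q" "y * q = q * y"
  shows "y * inverse_sqrt q = inverse_sqrt q * y"
proof -
  obtain W where W: "l1_le (\<lambda>n. isqrt_coeff n *\<^sub>R q ^ n) W" by (rule inverse_sqrt_l1[OF assms(1)])
  have "y * q ^ n = q ^ n * y" for n by (metis assms(2) power_commuting_commutes)
  thus ?thesis
    using infsum_bounded_linear_l1[OF bounded_linear_mult_right W, of y]
      infsum_bounded_linear_l1[OF bounded_linear_mult_left W, of y] by (simp add: inverse_sqrt_def)
qed

lemma inverse_sqrt_0 [simp]: "inverse_sqrt 0 = 1"
  unfolding inverse_sqrt_def by (subst infsum_single[of 0]) (auto simp: isqrt_coeff_def power_0_left)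

lemma inverse_sqrt_map:
  assumes "summable_powers q" "bounded_linear h" "\<And>n. h (q ^ n) = r ^ n"
  shows "h (inverse_sqrt q) = inverse_sqrt r"
proof -
  interpret bounded_linear h by fact
  obtain W where W: "l1_le (\<lambda>n. isqrt_coeff n *\<^sub>R q ^ n) W" by (rule inverse_sqrt_l1[OF assms(1)])
  show ?thesis using infsum_bounded_linear_l1[OF assms(2) W] by (simp add: inverse_sqrt_def scaleR assms(3))
qed

section \<open>Idempotents near almost idempotent elements\<close>

text \<open>
  If \<open>u = 2 e - 1\<close> and \<open>q = e\<^sup>2 - e\<close>, then \<open>u\<^sup>2 = 1 + 4 q\<close>, so that \<open>w = u (1 + 4 q)\<^sup>-\<^sup>1\<^sup>/\<^sup>2\<close> has square \<open>1\<close> and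
  \<open>(1 + w) / 2\<close> is idempotent. It equals \<open>e\<close> if \<open>q = 0\<close>.
\<close>

definition idempotent_near :: "'a::{real_normed_algebra_1, banach} \<Rightarrow> 'a" where
  "idempotent_near e = (1 / 2) *\<^sub>R (1 + (2 *\<^sub>R e - 1) * inverse_sqrt (e * e - e))"

context
  fixes e :: "'a::{real_normed_algebra_1, banach}"
  assumes e: "summable_powers (e * e - e)"
begin

lemma idempotent_near_idem: "idempotent_near e * idempotent_near e = idempotent_near e"
proof -
  let ?q = "e * e - e" and ?s = "inverse_sqrt (e * e - e)"
  define w where "w = (2 *\<^sub>R e - 1) * ?s"
  have c: "(2 *\<^sub>R e - 1) * ?s = ?s * (2 *\<^sub>R e - 1)"
    by (rule inverse_sqrt_commute[OF e]) (simp add: algebra_simps)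
  have "(- 2) *\<^sub>R e + (- 2) *\<^sub>R e = (- 4) *\<^sub>R e" unfolding scaleR_add_left[symmetric] by simp
  hence u: "(2 *\<^sub>R e - 1) * (2 *\<^sub>R e - 1) = 1 + 4 *\<^sub>R ?q"
    by (simp add: left_diff_distrib right_diff_distrib scaleR_diff_right)
  have "w * w = (?s * (2 *\<^sub>R e - 1)) * ((2 *\<^sub>R e - 1) * ?s)" unfolding w_def by (simp add: c)
  also have "\<dots> = ?s * (1 + 4 *\<^sub>R ?q) * ?s" unfolding u[symmetric] by (simp only: mult.assoc)
  also have "(1 + 4 *\<^sub>R ?q) * ?s = ?s * (1 + 4 *\<^sub>R ?q)"
    by (rule inverse_sqrt_commute[OF e]) (simp add: algebra_simps)
  hence "?s * (1 + 4 *\<^sub>R ?q) * ?s = 1" using inverse_sqrt_square[OF e] by (simp add: mult.assoc)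
  finally have "w * w = 1" .
  moreover have "idempotent_near e = (1 / 2) *\<^sub>R (1 + w)" by (simp add: idempotent_near_def w_def)
  ultimately show ?thesis by (simp add: algebra_simps flip: scaleR_2)
qed

lemma idempotent_near_commute:
  assumes "y * e = e * y"
  shows "y * idempotent_near e = idempotent_near e * y"
proof -
  have "y * (e * e) = (e * e) * y" using assms by (metis mult.assoc)
  hence "y * (e * e - e) = (e * e - e) * y" using assms by (simp add: algebra_simps)
  from inverse_sqrt_commute[OF e this]
  have s: "y * inverse_sqrt (e * e - e) = inverse_sqrt (e * e - e) * y" .
  have "y * (2 *\<^sub>R e - 1) = (2 *\<^sub>R e - 1) * y" using assms by (simp add: left_diff_distrib right_diff_distrib)
  hence "y * ((2 *\<^sub>R e - 1) * inverse_sqrt (e * e - e)) = ((2 *\<^sub>R e - 1) * inverse_sqrt (e * e - e)) * y"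
    using s by (metis mult.assoc)
  thus ?thesis by (simp add: idempotent_near_def distrib_left distrib_right)
qed

lemma idempotent_near_hom:
  fixes h :: "'a \<Rightarrow> 'b::{real_normed_algebra_1, banach}"
  assumes h: "bounded_linear h" "\<And>x y. h (x * y) = h x * h y" "h 1 = 1" and z: "h (e * e - e) = 0"
  shows "h (idempotent_near e) = h e"
proof -
  interpret bounded_linear h by fact
  have "h (inverse_sqrt (e * e - e)) = inverse_sqrt 0"
  proof (rule inverse_sqrt_map[OF e h(1)])
    show "h ((e * e - e) ^ n) = 0 ^ n" for n by (cases n) (simp_all add: h z)
  qed
  thus ?thesis by (simp add: idempotent_near_def h scaleR add diff flip: scaleR_2)
qed

lemma idempotent_near_antihom:
  assumes h: "bounded_linear h" "\<And>x y. h (x * y) = h y * h x" "h 1 = 1" and fixed: "h e = e"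
  shows "h (idempotent_near e) = idempotent_near e"
proof -
  interpret bounded_linear h by fact
  let ?q = "e * e - e"
  have q: "h ?q = ?q" by (simp add: diff h fixed)
  have s: "h (inverse_sqrt ?q) = inverse_sqrt ?q"
  proof (rule inverse_sqrt_map[OF e h(1)])
    show "h (?q ^ n) = ?q ^ n" for n
    proof (induction n)
      case (Suc n)
      thus ?case by (simp add: h q power_commutes)
    qed (simp add: h)
  qed
  have "(2 *\<^sub>R e - 1) * inverse_sqrt ?q = inverse_sqrt ?q * (2 *\<^sub>R e - 1)"
    by (rule inverse_sqrt_commute[OF e]) (simp add: algebra_simps)
  thus ?thesis by (simp add: idempotent_near_def h scaleR add diff s fixed)
qed

end

lemma quasinilpotent_summable_powers:
  fixes q :: "'a::complex_banach_algebra_1"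
  assumes "spectrum q = {0}"
  shows "summable_powers q"
proof -
  have "(\<lambda>n. 8 ^ n * norm (q ^ n)) \<longlonglongrightarrow> 0" by (rule quasinilpotent_powers[OF assms]) simp
  hence "Bseq (\<lambda>n. 8 ^ n * norm (q ^ n))" by (intro convergent_imp_Bseq convergentI)
  then obtain K where K: "\<And>n. norm (8 ^ n * norm (q ^ n)) \<le> K" by (rule BseqE) blast
  have "l1_le (\<lambda>n. 4 ^ n *\<^sub>R q ^ n) (K * (1 / (1 - 1 / 2)))"
  proof (rule l1_le_scale[OF l1_le_geometric])
    fix n
    have "norm (4 ^ n *\<^sub>R q ^ n) = (8 ^ n * norm (q ^ n)) * (1 / 2) ^ n"
      by (simp flip: power_mult_distrib add: mult.commute mult.left_commute)
    also have "\<dots> \<le> K * (1 / 2) ^ n" using K[of n] by (intro mult_right_mono) auto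
    finally show "norm (4 ^ n *\<^sub>R q ^ n) \<le> K * norm ((1 / 2 :: real) ^ n)" by simp
  qed (use order_trans[OF norm_ge_zero K] in auto)
  thus ?thesis unfolding summable_powers_def by blast
qed

text \<open>
  Choose \<open>N\<close> with \<open>8 ^ N * norm (g x ^ N) < 1/2\<close>. Shrinking the radius makes the power series norm of \<open>g ^ N\<close> at most
  \<open>(1/8) ^ N\<close>, and the other powers follow by division of the exponent by \<open>N\<close>.
\<close>

lemma ps_bound_powers:
  fixes g :: "real \<Rightarrow> 'a::complex_banach_algebra_1"
  assumes g: "ps_bound x r g w" and sp: "spectrum (g x) = {0}"
  obtains s B where "0 < s" "s \<le> r" "\<And>n. ps_bound x s (\<lambda>t. g t ^ n) (B * (1 / 8) ^ n)"
proof -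
  have r: "0 < r" using ps_bound_radius[OF g] .
  have w: "0 \<le> w" using ps_bound_nonneg[OF g] .
  have "(\<lambda>n. 8 ^ n * norm (g x ^ n)) \<longlonglongrightarrow> 0" by (rule quasinilpotent_powers[OF sp]) simp
  hence "\<forall>\<^sub>F n in sequentially. 8 ^ n * norm (g x ^ n) < 1 / 2" by (rule order_tendstoD) simp
  then obtain N0 where N0: "\<And>n. N0 \<le> n \<Longrightarrow> 8 ^ n * norm (g x ^ n) < 1 / 2"
    unfolding eventually_sequentially by blast
  define N where "N = Suc N0"
  have N: "0 < N" "8 ^ N * norm (g x ^ N) < 1 / 2" using N0[of N] by (simp_all add: N_def)
  define s where "s = min r (r / (2 * 8 ^ N * (w ^ N + 1)))"
  have wN: "0 \<le> w ^ N" using w by simp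
  have s: "0 < s" "s \<le> r" using r wN by (auto simp: s_def)
  have "s / r \<le> (r / (2 * 8 ^ N * (w ^ N + 1))) / r" using r by (intro divide_right_mono) (auto simp: s_def)
  hence "s / r * w ^ N \<le> 1 / (2 * 8 ^ N * (w ^ N + 1)) * (w ^ N + 1)"
    using r wN s(1) by (intro mult_mono) auto
  also have "\<dots> = 1 / (2 * 8 ^ N)"
  proof -
    have "1 / (a * b) * b = 1 / a" if "0 < b" for a b :: real using that by simp
    thus ?thesis using wN by simp
  qed
  finally have sw: "s / r * w ^ N \<le> 1 / (2 * 8 ^ N)" .
  have gx: "norm (g x ^ N) \<le> 1 / (2 * 8 ^ N)" using N(2) by (simp add: field_simps)
  have gN: "ps_bound x s (\<lambda>t. g t ^ N) ((1 / 8) ^ N)"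
    by (rule ps_bound_mono[OF ps_bound_shrink'[OF ps_bound_power[OF g] s]])
       (use add_mono[OF gx sw] in \<open>simp add: power_divide\<close>)
  define u where "u = max 1 w"
  have u: "1 \<le> u" "w \<le> u" by (auto simp: u_def)
  have gs: "ps_bound x s g u" by (rule ps_bound_mono[OF ps_bound_shrink[OF g s] u(2)])
  have "ps_bound x s (\<lambda>t. g t ^ n) (u ^ N * 8 ^ N * (1 / 8) ^ n)" for n
  proof (rule ps_bound_cong[OF ps_bound_mult[OF ps_bound_power[OF gN, of "n div N"] ps_bound_power[OF gs, of "n mod N"]]])
    show "g t ^ n = (g t ^ N) ^ (n div N) * g t ^ (n mod N)" for t
      by (simp flip: power_mult power_add)
    have l: "n mod N \<le> N" using N(1) by (simp add: less_imp_le)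
    have e: "N * (n div N) + n mod N = n" by simp
    have "((1 / 8) ^ N) ^ (n div N) * u ^ (n mod N) \<le> ((1 / 8 :: real) ^ N) ^ (n div N) * u ^ N"
      by (intro mult_left_mono power_increasing l u) auto
    also have "\<dots> = (1 / 8) ^ (N * (n div N)) * u ^ N" by (simp add: power_mult)
    also have "(1 / 8 :: real) ^ (N * (n div N)) = 8 ^ (n mod N) * (1 / 8) ^ n"
    proof -
      have "(1 / 8 :: real) ^ n = (1 / 8) ^ (N * (n div N)) * (1 / 8) ^ (n mod N)"
        unfolding power_add[symmetric] e ..
      thus ?thesis by (simp add: power_divide)
    qed
    also have "\<dots> * u ^ N \<le> (8 ^ N * (1 / 8) ^ n) * u ^ N"
      using u l by (intro mult_right_mono power_increasing) auto
    finally show "((1 / 8) ^ N) ^ (n div N) * u ^ (n mod N) \<le> u ^ N * 8 ^ N * (1 / 8) ^ n"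
      by (simp only: ac_simps)
  qed
  with s that show thesis by blast
qed

lemma ps_bound_idempotent_near:
  fixes f :: "real \<Rightarrow> 'a::complex_banach_algebra_1"
  assumes f: "ps_bound x r f w" and sp: "spectrum (f x * f x - f x) = {0}"
  shows "\<exists>s v. ps_bound x s (\<lambda>t. idempotent_near (f t)) v"
proof -
  have q: "ps_bound x r (\<lambda>t. f t * f t - f t) (w * w + w)"
    by (intro ps_bound_diff ps_bound_mult f)
  obtain s B where s: "0 < s" "s \<le> r" "\<And>n. ps_bound x s (\<lambda>t. (f t * f t - f t) ^ n) (B * (1 / 8) ^ n)"
    by (rule ps_bound_powers[OF q sp]) blast
  have B: "0 \<le> B" using ps_bound_nonneg[OF s(3)[of 0]] by simp
  have "ps_bound x s (\<lambda>t. isqrt_coeff n *\<^sub>R (f t * f t - f t) ^ n) (B * (1 / 2) ^ n)" for n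
  proof (rule ps_bound_mono[OF ps_bound_scaleR[OF ps_bound_const[OF s(1)] s(3)]])
    have "norm (isqrt_coeff n) * (B * (1 / 8) ^ n) \<le> 4 ^ n * (B * (1 / 8) ^ n)"
      using isqrt_coeff_bound[of n] B by (intro mult_right_mono) auto
    also have "\<dots> = B * (4 * (1 / 8)) ^ n" unfolding power_mult_distrib by simp
    finally show "norm (isqrt_coeff n) * (B * (1 / 8) ^ n) \<le> B * (1 / 2) ^ n" by simp
  qed
  moreover have "l1_le (\<lambda>n. B * (1 / 2) ^ n) (B * (1 / (1 - 1 / 2)))"
    by (rule l1_le_scale[OF l1_le_geometric]) (use B in \<open>auto simp: abs_mult\<close>)
  ultimately have i: "ps_bound x s (\<lambda>t. inverse_sqrt (f t * f t - f t)) (B * (1 / (1 - 1 / 2)))"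
    unfolding inverse_sqrt_def by (rule ps_bound_infsum(1))
  have fs: "ps_bound x s f w" by (rule ps_bound_shrink[OF f s(1,2)])
  show ?thesis unfolding idempotent_near_def
    by (intro exI) (rule ps_bound_scaleR[OF ps_bound_const[OF s(1)] ps_bound_add[OF ps_bound_const[OF s(1)]
        ps_bound_mult[OF ps_bound_diff[OF ps_bound_scaleR[OF ps_bound_const[OF s(1)] fs] ps_bound_const[OF s(1)]] i]]])
qed

text \<open>
  Here \<open>x - 1\<close> is invertible and annihilates \<open>x\<close>.
\<close>

lemma idempotent_spectrum_0:
  fixes x :: "'a::complex_banach_algebra_1"
  assumes "spectrum x = {0}" "x * x = x"
  shows "x = 0"
proof -
  have "1 \<notin> spectrum x" using assms by simp
  then obtain y where "y * (x - 1) = 1" unfolding spectrum_def by auto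
  hence "x = (y * (x - 1)) * x" by simp
  also have "\<dots> = y * (x * x - x)" by (simp add: algebra_simps)
  finally show ?thesis using assms(2) by simp
qed

section \<open>Lifting algebraic elements\<close>

text \<open>
  A continuous involution is real linear, hence bounded.
\<close>

lemma bounded_linear_involution:
  assumes "continuous_involution star"
  shows "bounded_linear star" and "star 1 = 1" and "\<And>x y. star (x * y) = star y * star x"
    and "\<And>x. star (star x) = x"
proof -
  have add: "\<And>x y. star (x + y) = star x + star y" and sc: "\<And>z x. star (z *\<^sub>C x) = cnj z *\<^sub>C star x"
    and mult: "\<And>x y. star (x * y) = star y * star x" and inv: "\<And>x. star (star x) = x"
    and cont: "continuous_on UNIV star"
    using assms unfolding continuous_involution_def by blast+
  show "star (x * y) = star y * star x" for x y by (rule mult)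
  show "star (star x) = x" for x by (rule inv)
  have "star 1 * star (star 1) = star (star 1)" using mult[of "star 1" 1] by simp
  thus "star 1 = 1" by (simp add: inv)
  have scR: "star (r *\<^sub>R x) = r *\<^sub>R star x" for r x by (simp add: scaleR_scaleC sc)
  have s0: "star 0 = 0" using scR[of 0 0] by simp
  obtain d where d: "0 < d" "\<And>x. dist x 0 < d \<Longrightarrow> dist (star x) (star 0) < 1"
    using cont unfolding continuous_on_iff by (metis UNIV_I zero_less_one)
  have "norm (star x) \<le> norm x * (2 / d)" for x
  proof (cases "x = 0")
    case False
    define c where "c = d / (2 * norm x)"
    have c: "0 < c" using d False by (simp add: c_def)
    have "norm (c *\<^sub>R x) = d / 2" using False d by (simp add: c_def)
    hence "norm (star (c *\<^sub>R x)) < 1" using d(2)[of "c *\<^sub>R x"] d(1) s0 by (simp add: dist_norm)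
    hence "c * norm (star x) < 1" using c by (simp add: scR)
    hence "norm (star x) < 1 / c" using c by (simp add: field_simps)
    also have "1 / c = norm x * (2 / d)" by (simp add: c_def)
    finally show ?thesis by simp
  qed (simp add: s0)
  thus "bounded_linear star" by (intro bounded_linear_intro add scR)
qed

theorem theorem20:
  fixes n :: nat and lam :: "nat \<Rightarrow> real" and p :: "real poly"
    and G :: "real set"
    and starA :: "'a::complex_banach_algebra_1 \<Rightarrow> 'a"
    and starB :: "'b::complex_banach_algebra_1 \<Rightarrow> 'b"
    and \<pi> :: "real \<Rightarrow> 'a \<Rightarrow>\<^sub>L 'b"
    and b :: "real \<Rightarrow> 'b"
  assumes "n \<ge> 2"
    and "inj_on lam {1..n}"
    and "p = (\<Prod>i=1..n. [:- lam i, 1:])"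
    and "open G"
    and "continuous_involution starA"
    and "continuous_involution starB"
    and "\<pi> real_analytic_on G"
    and "\<And>t. t \<in> G \<Longrightarrow> unital_star_hom starA starB (blinfun_apply (\<pi> t))"
    and "\<And>t. t \<in> G \<Longrightarrow> surj (blinfun_apply (\<pi> t))"
    and "\<And>t x. t \<in> G \<Longrightarrow> blinfun_apply (\<pi> t) x = 0 \<Longrightarrow> spectrum x = {0}"
    and "b real_analytic_on G"
    and "\<And>t. t \<in> G \<Longrightarrow> b t \<in> S_set p starB"
  shows "\<exists>a :: real \<Rightarrow> 'a. a real_analytic_on G \<and>
           (\<forall>t\<in>G. a t \<in> S_set p starA) \<and>
           (\<forall>t\<in>G. blinfun_apply (\<pi> t) (a t) = b t)"
proof -
  let ?I = "{1..n}"
  note star = bounded_linear_involution[OF assms(5)]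
  interpret star: bounded_linear starA by (rule star(1))
  have hom: "\<pi> t (x * y) = \<pi> t x * \<pi> t y" "\<pi> t 1 = 1" "\<pi> t (starA x) = starB (\<pi> t x)" if "t \<in> G" for t x y
    using assms(8)[OF that] unfolding unital_star_hom_def by blast+
  have b: "b t = starB (b t)" "poly_at p (b t) = 0" if "t \<in> G" for t
    using assms(12)[OF that] unfolding S_set_def by auto
  obtain a0 where a0: "a0 real_analytic_on G" "\<And>t. t \<in> G \<Longrightarrow> \<pi> t (a0 t) = b t"
    using analytic_lift[OF assms(4,7,11,9)] by blast
  \<comment> \<open>Since \<open>b\<close> is self-adjoint, the self-adjoint part of a lift is again a lift.\<close>
  define a1 where "a1 t = (1 / 2) *\<^sub>R (a0 t + starA (a0 t))" for t
  have a1_star: "starA (a1 t) = a1 t" for t by (simp add: a1_def star.scaleR star.add star(4) add.commute)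
  have a1_lift: "\<pi> t (a1 t) = b t" if t: "t \<in> G" for t
    using b(1)[OF t] by (simp add: a1_def blinfun.scaleR_right blinfun.add_right hom(3)[OF t] a0(2)[OF t] flip: scaleR_2)
  have a1_ps: "\<exists>r w. ps_bound t r a1 w" if t: "t \<in> G" for t
  proof -
    obtain r w where r: "ps_bound t r a0 w" using a0(1) t unfolding real_analytic_on_iff by blast
    have r0: "0 < r" using ps_bound_radius[OF r] .
    obtain K where K: "0 \<le> K" "\<And>x. norm (starA x) \<le> norm x * K" using star.nonneg_bounded by blast
    have "ps_bound t r (\<lambda>t. starA (a0 t)) (K * w)"
      by (rule ps_bound_linear[OF r star(1) _ K(1)]) (use K(2) in \<open>simp add: mult.commute\<close>)
    from ps_bound_scaleR[OF ps_bound_const[OF r0] ps_bound_add[OF r this]]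
    show ?thesis unfolding a1_def by blast
  qed
  let ?l = "lagrange lam ?I"
  have lag: "poly (?l i) (lam k) = (if i = k then 1 else 0)" if "i \<in> ?I" "k \<in> ?I" for i k
    by (rule poly_lagrange) (use assms(2) that in auto)
  have dvd: "p dvd r" if "\<And>i. i \<in> ?I \<Longrightarrow> poly r (lam i) = 0" for r
    unfolding assms(3) by (rule prod_linear_dvd) (use assms(2) that in auto)
  define \<beta> where "\<beta> i t = poly_at (?l i) (b t)" for i t
  have \<beta>_mult: "\<beta> i t * \<beta> j t = (if i = j then \<beta> i t else 0)" if t: "t \<in> G" and ij: "i \<in> ?I" "j \<in> ?I" for i j t
  proof -
    have "p dvd ?l i * ?l j - (if i = j then ?l i else 0)" by (rule dvd) (use ij lag in auto)
    from poly_at_dvd[OF this b(2)[OF t]] show ?thesis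
      by (auto simp: poly_at_diff poly_at_mult \<beta>_def split: if_splits)
  qed
  have \<beta>_sum: "(\<Sum>i\<in>?I. \<beta> i t) = 1" if t: "t \<in> G" for t
  proof -
    have "p dvd (\<Sum>i\<in>?I. ?l i) - 1" by (rule dvd) (use lag in \<open>simp add: poly_sum\<close>)
    from poly_at_dvd[OF this b(2)[OF t]] show ?thesis by (simp add: poly_at_diff poly_at_sum \<beta>_def)
  qed
  have \<beta>_b: "(\<Sum>i\<in>?I. lam i *\<^sub>R \<beta> i t) = b t" if t: "t \<in> G" for t
  proof -
    have "p dvd (\<Sum>i\<in>?I. smult (lam i) (?l i)) - [:0, 1:]"
    proof (rule dvd)
      fix k assume k: "k \<in> ?I"
      have "(\<Sum>i\<in>?I. lam i * poly (?l i) (lam k)) = (\<Sum>i\<in>?I. if i = k then lam k else 0)"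
        by (intro sum.cong refl) (use lag k in auto)
      also have "\<dots> = lam k" using k by simp
      finally show "poly ((\<Sum>i\<in>?I. smult (lam i) (?l i)) - [:0, 1:]) (lam k) = 0" by (simp add: poly_sum)
    qed
    from poly_at_dvd[OF this b(2)[OF t]] show ?thesis
      by (simp add: poly_at_diff poly_at_sum poly_at_smult poly_at_pCons \<beta>_def)
  qed
  \<comment> \<open>The \<open>\<beta> i t\<close> are the spectral idempotents of \<open>b t\<close>. The elements \<open>e i t\<close> lift them, but are idempotent only modulo the kernel.\<close>
  define e where "e i t = poly_at (?l i) (a1 t)" for i t
  have e_lift: "\<pi> t (e i t) = \<beta> i t" if t: "t \<in> G" for i t
    unfolding e_def \<beta>_def a1_lift[OF t, symmetric]
    by (rule poly_at_hom[OF bounded_linear.linear[OF blinfun.bounded_linear_right] hom(1,2)[OF t]])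
  have ker: "\<pi> t (e i t * e i t - e i t) = 0" if "t \<in> G" "i \<in> ?I" for i t
    using \<beta>_mult[OF that(1,2,2)] that by (simp add: blinfun.diff_right hom e_lift)
  have sp: "spectrum (e i t * e i t - e i t) = {0}" if "t \<in> G" "i \<in> ?I" for i t
    by (rule assms(10)[OF that(1) ker[OF that]])
  have sm: "summable_powers (e i t * e i t - e i t)" if "t \<in> G" "i \<in> ?I" for i t
    by (rule quasinilpotent_summable_powers[OF sp[OF that]])
  define E where "E i t = idempotent_near (e i t)" for i t
  have E_lift: "\<pi> t (E i t) = \<beta> i t" if "t \<in> G" "i \<in> ?I" for i t
    unfolding E_def e_lift[OF that(1), symmetric]
    by (rule idempotent_near_hom[OF sm[OF that] blinfun.bounded_linear_right _ _ ker[OF that]])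
       (use hom[OF that(1)] in auto)
  have E_idem: "E i t * E i t = E i t" if "t \<in> G" "i \<in> ?I" for i t
    unfolding E_def by (rule idempotent_near_idem[OF sm[OF that]])
  have E_comm: "E i t * E j t = E j t * E i t" if "t \<in> G" "i \<in> ?I" "j \<in> ?I" for i j t
  proof -
    have "e i t * e j t = e j t * e i t" unfolding e_def by (rule poly_at_commute)
    from idempotent_near_commute[OF sm[OF that(1,3)] this]
    have "E j t * e i t = e i t * E j t" unfolding E_def by simp
    from idempotent_near_commute[OF sm[OF that(1,2)] this] show ?thesis unfolding E_def by simp
  qed
  have E_zero: "x = 0" if "t \<in> G" "\<pi> t x = 0" "x * x = x" for t x
    by (rule idempotent_spectrum_0[OF assms(10)[OF that(1,2)] that(3)])
  have E_orth: "E i t * E j t = 0" if "t \<in> G" "i \<in> ?I" "j \<in> ?I" "i \<noteq> j" for i j t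
  proof (rule E_zero[OF that(1)])
    show "\<pi> t (E i t * E j t) = 0" using \<beta>_mult[OF that(1-3)] that by (simp add: hom E_lift)
    have "(E i t * E j t) * (E i t * E j t) = E i t * (E j t * E i t) * E j t" by (simp only: mult.assoc)
    also have "\<dots> = (E i t * E i t) * (E j t * E j t)"
      unfolding E_comm[OF that(1,3,2)] by (simp only: mult.assoc)
    finally show "(E i t * E j t) * (E i t * E j t) = E i t * E j t" using E_idem that by simp
  qed
  have E_mult: "E i t * E j t = (if i = j then E i t else 0)" if "t \<in> G" "i \<in> ?I" "j \<in> ?I" for i j t
    using E_orth E_idem that by auto
  have E_sum: "(\<Sum>i\<in>?I. E i t) = 1" if t: "t \<in> G" for t
  proof -
    let ?s = "\<Sum>i\<in>?I. E i t"
    have "?s * ?s = (\<Sum>i\<in>?I. \<Sum>j\<in>?I. if i = j then E i t else 0)"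
      unfolding sum_product by (intro sum.cong refl) (use E_mult t in auto)
    also have "\<dots> = ?s" by (intro sum.cong refl) simp
    finally have s: "?s * ?s = ?s" .
    have "1 - ?s = 0"
    proof (rule E_zero[OF t])
      show "\<pi> t (1 - ?s) = 0"
        using \<beta>_sum[OF t] by (simp add: blinfun.diff_right blinfun.sum_right hom[OF t] E_lift[OF t])
      have "(1 - u) * (1 - u) = 1 - u" if "u * u = u" for u :: 'a using that by (simp add: algebra_simps)
      from this[OF s] show "(1 - ?s) * (1 - ?s) = 1 - ?s" .
    qed
    thus ?thesis by simp
  qed
  define a where "a t = (\<Sum>i\<in>?I. lam i *\<^sub>R E i t)" for t
  have aE: "a t * E i t = lam i *\<^sub>R E i t" if "t \<in> G" "i \<in> ?I" for i t
  proof -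
    have "a t * E i t = (\<Sum>j\<in>?I. lam j *\<^sub>R (E j t * E i t))" by (simp add: a_def sum_distrib_right)
    also have "\<dots> = (\<Sum>j\<in>?I. if j = i then lam i *\<^sub>R E i t else 0)"
      by (intro sum.cong refl) (use E_mult that in auto)
    finally show ?thesis using that by simp
  qed
  have poly_aE: "poly_at r (a t) * E i t = poly r (lam i) *\<^sub>R E i t" if "t \<in> G" "i \<in> ?I" for r i t
  proof (induction r)
    case (pCons c r)
    thus ?case using aE[OF that] by (simp add: poly_at_pCons distrib_right mult.assoc algebra_simps)
  qed simp
  have "poly_at p (a t) = 0" if t: "t \<in> G" for t
  proof -
    have "poly_at p (a t) = poly_at p (a t) * (\<Sum>i\<in>?I. E i t)" by (simp only: E_sum[OF t] mult_1_right)
    \<comment> \<open>The \<open>E i t\<close> diagonalise \<open>a t\<close>, with eigenvalues \<open>lam i\<close>.\<close>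
    also have "\<dots> = (\<Sum>i\<in>?I. poly p (lam i) *\<^sub>R E i t)"
      unfolding sum_distrib_left by (intro sum.cong refl poly_aE t)
    also have "\<dots> = 0"
    proof (intro sum.neutral ballI)
      fix i assume "i \<in> ?I"
      hence "poly p (lam i) = 0" unfolding assms(3) poly_prod by (intro prod_zero) auto
      thus "poly p (lam i) *\<^sub>R E i t = 0" by simp
    qed
    finally show ?thesis .
  qed
  moreover have "starA (a t) = a t" if t: "t \<in> G" for t
  proof -
    have "starA (e i t) = e i t" for i
      unfolding e_def using poly_at_antihom[OF bounded_linear.linear[OF star(1)] star(3,2)] a1_star by simp
    hence "starA (E i t) = E i t" if "i \<in> ?I" for i
      unfolding E_def by (intro idempotent_near_antihom[OF sm[OF t that] star(1) star(3,2)])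
    thus ?thesis by (simp add: a_def star.sum star.scaleR)
  qed
  moreover have "\<pi> t (a t) = b t" if t: "t \<in> G" for t
    using \<beta>_b[OF t] E_lift[OF t] by (simp add: a_def blinfun.sum_right blinfun.scaleR_right)
  moreover have "a real_analytic_on G" unfolding real_analytic_on_iff
  proof
    fix t assume t: "t \<in> G"
    have "\<exists>s v. ps_bound t s (\<lambda>t. E i t) v" if i: "i \<in> ?I" for i
    proof -
      obtain r w where "ps_bound t r a1 w" using a1_ps[OF t] by blast
      from ps_bound_poly_at[OF this] obtain v where "ps_bound t r (\<lambda>t. e i t) v" unfolding e_def by blast
      from ps_bound_idempotent_near[OF this sp[OF t i]] show ?thesis unfolding E_def .
    qed
    then obtain s v where sv: "\<And>i. i \<in> ?I \<Longrightarrow> ps_bound t (s i) (\<lambda>t. E i t) (v i)" by metis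
    define r where "r = Min (s ` ?I)"
    have ne: "s ` ?I \<noteq> {}" "finite (s ` ?I)" using assms(1) by auto
    have r: "0 < r" unfolding r_def using ps_bound_radius[OF sv] by (subst Min_gr_iff[OF ne(2,1)]) auto
    have rs: "r \<le> s i" if "i \<in> ?I" for i unfolding r_def by (rule Min_le[OF ne(2)]) (use that in auto)
    have "ps_bound t r a (\<Sum>i\<in>?I. norm (lam i) * v i)"
      unfolding a_def
      by (intro ps_bound_sum ps_bound_scaleR ps_bound_const r ps_bound_shrink[OF sv r rs]) auto
    thus "\<exists>r w. ps_bound t r a w" by blast
  qed
  ultimately show ?thesis unfolding S_set_def by (intro exI[of _ a]) auto
qed

end
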